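(* Let $f,g\in\mathcal{S}(\mathbb{R}^{2d},\mathbb{H})$. Then $$\iint_{\mathbb{R}^{2d}\times\mathbb{R}^{2d}}\ln|w|\,|W(f,g)(x,w)|^2\,d\mu_{2d}(x)\,d\mu_{2d}(w)+\|g\|_{2,2d}^2\int_{\mathbb{R}^{2d}}\ln|t|\,|f(t)|^2\,d\mu_{2d}(t)\ge\big(D_{2d}-\ln2\big)\,\|f\|_{2,2d}^2\|g\|_{2,2d}^2,$$ where $D_{2d}=\frac{\Gamma'(d/2)}{\Gamma(d/2)}+\ln 2$.
   Context: $d\ge 1$ is an integer and $\mathbb{H}$ is the algebra of quaternions with units $i,j,k$. $\mathcal{S}(\mathbb{R}^{2d},\mathbb{H})$ is the Schwartz space of $\mathbb{H}$-valued rapidly decreasing smooth functions on $\mathbb{R}^{2d}$. On $\mathbb{R}^n$, $d\mu_n(x)=dx/(2\pi)^{n/2}$ and $\|f\|_{2,n}=\big(\int_{\mathbb{R}^n}|f|^2d\mu_n\big)^{1/2}$. The quaternion Wigner transform is $$W(f,g)(x,w)=\int_{\mathbb{R}^{2d}}e^{-i\,w_1\cdot t_1}f\big(x+\tfrac t2\big)\overline{g\big(x-\tfrac t2\big)}e^{-j\,w_2\cdot t_2}\,d\mu_{2d}(t),\quad x\in\mathbb{R}^{2d},\ w=(w_1,w_2),\ t=(t_1,t_2)\in\mathbb{R}^d\times\mathbb{R}^d.$$ $|w|$, $|t|$ are Euclidean norms on $\mathbb{R}^{2d}$. *)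

theory Defs
  imports "HOL-Analysis.Analysis"
begin

codatatype quat = Quat (QRe: real) (QI: real) (QJ: real) (QK: real)

lemma quat_eqI: "QRe p = QRe q \<Longrightarrow> QI p = QI q \<Longrightarrow> QJ p = QJ q \<Longrightarrow> QK p = QK q \<Longrightarrow> p = q"
  by (rule quat.expand) simp

lemma quat_eq_iff: "p = q \<longleftrightarrow> QRe p = QRe q \<and> QI p = QI q \<and> QJ p = QJ q \<and> QK p = QK q"
  by (auto intro: quat_eqI)

instantiation quat :: ab_group_add
begin

primcorec zero_quat where
  "QRe 0 = 0" | "QI 0 = 0" | "QJ 0 = 0" | "QK 0 = 0"

primcorec plus_quat where
  "QRe (p + q) = QRe p + QRe q"
| "QI (p + q) = QI p + QI q"
| "QJ (p + q) = QJ p + QJ q"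
| "QK (p + q) = QK p + QK q"

primcorec uminus_quat where
  "QRe (- p) = - QRe p" | "QI (- p) = - QI p" | "QJ (- p) = - QJ p" | "QK (- p) = - QK p"

primcorec minus_quat where
  "QRe (p - q) = QRe p - QRe q"
| "QI (p - q) = QI p - QI q"
| "QJ (p - q) = QJ p - QJ q"
| "QK (p - q) = QK p - QK q"

instance
  by standard (simp_all add: quat_eq_iff)

end

instantiation quat :: real_algebra_1
begin

primcorec one_quat where
  "QRe 1 = 1" | "QI 1 = 0" | "QJ 1 = 0" | "QK 1 = 0"

primcorec times_quat where
  "QRe (p * q) = QRe p * QRe q - QI p * QI q - QJ p * QJ q - QK p * QK q"
| "QI (p * q) = QRe p * QI q + QI p * QRe q + QJ p * QK q - QK p * QJ q"
| "QJ (p * q) = QRe p * QJ q - QI p * QK q + QJ p * QRe q + QK p * QI q"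
| "QK (p * q) = QRe p * QK q + QI p * QJ q - QJ p * QI q + QK p * QRe q"

primcorec scaleR_quat where
  "QRe (r *\<^sub>R q) = r * QRe q"
| "QI (r *\<^sub>R q) = r * QI q"
| "QJ (r *\<^sub>R q) = r * QJ q"
| "QK (r *\<^sub>R q) = r * QK q"

instance
  by standard (simp_all add: quat_eq_iff algebra_simps)

end

instantiation quat :: real_inner
begin

definition inner_quat :: "quat \<Rightarrow> quat \<Rightarrow> real" where
  "inner_quat p q = QRe p * QRe q + QI p * QI q + QJ p * QJ q + QK p * QK q"

definition norm_quat :: "quat \<Rightarrow> real" where
  "norm_quat q = sqrt (inner q q)"

definition sgn_quat :: "quat \<Rightarrow> quat" where
  "sgn_quat q = q /\<^sub>R norm q"

definition dist_quat :: "quat \<Rightarrow> quat \<Rightarrow> real" where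
  "dist_quat p q = norm (p - q)"

definition uniformity_quat :: "(quat \<times> quat) filter" where
  "uniformity_quat = (INF e\<in>{0<..}. principal {(p, q). dist p q < e})"

definition open_quat :: "quat set \<Rightarrow> bool" where
  "open_quat U \<longleftrightarrow> (\<forall>x\<in>U. eventually (\<lambda>(x', y). x' = x \<longrightarrow> y \<in> U) uniformity)"

instance
proof
  fix p q s :: quat and r :: real
  show "dist p q = norm (p - q)" by (rule dist_quat_def)
  show "sgn p = p /\<^sub>R norm p" by (rule sgn_quat_def)
  show "uniformity = (INF e\<in>{0<..}. principal {(x, y :: quat). dist x y < e})"
    by (rule uniformity_quat_def)
  show "norm p = sqrt (inner p p)" by (rule norm_quat_def)
  show "inner p q = inner q p" by (simp add: inner_quat_def mult.commute)
  show "inner (p + q) s = inner p s + inner q s" by (simp add: inner_quat_def algebra_simps)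
  show "inner (r *\<^sub>R p) q = r * inner p q" by (simp add: inner_quat_def algebra_simps)
  show "0 \<le> inner p p" by (simp add: inner_quat_def)
  show "inner p p = 0 \<longleftrightarrow> p = 0"
    by (simp add: inner_quat_def quat_eq_iff add_nonneg_eq_0_iff)
qed (simp add: open_quat_def)

end

primcorec quat_i :: quat where
  "QRe quat_i = 0" | "QI quat_i = 1" | "QJ quat_i = 0" | "QK quat_i = 0"

primcorec quat_j :: quat where
  "QRe quat_j = 0" | "QI quat_j = 0" | "QJ quat_j = 1" | "QK quat_j = 0"

primcorec quat_k :: quat where
  "QRe quat_k = 0" | "QI quat_k = 0" | "QJ quat_k = 0" | "QK quat_k = 1"

primcorec qcnj :: "quat \<Rightarrow> quat" where
  "QRe (qcnj q) = QRe q" | "QI (qcnj q) = - QI q" | "QJ (qcnj q) = - QJ q" | "QK (qcnj q) = - QK q"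

lemma quat_unit_mult:
  "quat_i * quat_i = -1" "quat_j * quat_j = -1" "quat_k * quat_k = -1"
  "quat_i * quat_j = quat_k" "quat_j * quat_k = quat_i" "quat_k * quat_i = quat_j"
  by (simp_all add: quat_eq_iff)

lemma mult_qcnj: "q * qcnj q = of_real ((norm q)\<^sup>2)"
  by (simp add: quat_eq_iff of_real_def norm_quat_def inner_quat_def power2_eq_square[symmetric])

instantiation quat :: real_normed_div_algebra
begin

definition inverse_quat :: "quat \<Rightarrow> quat" where
  "inverse_quat q = qcnj q /\<^sub>R (norm q)\<^sup>2"

definition divide_quat :: "quat \<Rightarrow> quat \<Rightarrow> quat" where
  "divide_quat p q = p * inverse q"

instance
proof
  fix p q :: quat
  have comm: "qcnj q * q = q * qcnj q" for q
    by (simp add: quat_eq_iff)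
  show "inverse p * p = 1" "p * inverse p = 1" if "p \<noteq> 0"
    using that by (simp_all add: inverse_quat_def comm mult_qcnj of_real_def)
  show "p div q = p * inverse q" by (rule divide_quat_def)
  show "inverse (0 :: quat) = 0" by (simp add: inverse_quat_def)
  have "(norm (p * q))\<^sup>2 = (norm p * norm q)\<^sup>2"
    by (simp add: power_mult_distrib norm_quat_def inner_quat_def)
      (simp add: power2_eq_square algebra_simps)
  then show "norm (p * q) = norm p * norm q"
    by simp
qed

end

instantiation quat :: euclidean_space
begin

definition Basis_quat :: "quat set" where
  "Basis_quat = {1, quat_i, quat_j, quat_k}"

instance
proof
  show "(Basis :: quat set) \<noteq> {}" by (simp add: Basis_quat_def)
  show "finite (Basis :: quat set)" by (simp add: Basis_quat_def)
  show "inner u v = (if u = v then 1 else 0)" if "u \<in> Basis" "v \<in> Basis" for u v :: quat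
    using that unfolding Basis_quat_def
    by (elim insertE emptyE) (simp_all add: inner_quat_def quat_eq_iff)
  show "(\<forall>u\<in>Basis. inner x u = 0) \<longleftrightarrow> x = 0" for x :: quat
    by (simp add: Basis_quat_def inner_quat_def quat_eq_iff[of x])
qed

end

definition partial_deriv :: "'a \<Rightarrow> ('a::euclidean_space \<Rightarrow> 'b::real_normed_vector) \<Rightarrow> 'a \<Rightarrow> 'b" where
  "partial_deriv b f = (\<lambda>x. frechet_derivative f (at x) b)"

text \<open>A multi-index is represented by a list of basis vectors.  If the iterated partial
  derivatives of all orders are (Frechet) differentiable everywhere, then the function is smooth,
  so their order is irrelevant.\<close>

definition iter_partial :: "'a list \<Rightarrow> ('a::euclidean_space \<Rightarrow> 'b::real_normed_vector) \<Rightarrow> 'a \<Rightarrow> 'b" where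
  "iter_partial bs f = foldr partial_deriv bs f"

definition smooth :: "('a::euclidean_space \<Rightarrow> 'b::real_normed_vector) \<Rightarrow> bool" where
  "smooth f \<longleftrightarrow> (\<forall>bs. set bs \<subseteq> Basis \<longrightarrow> iter_partial bs f differentiable_on UNIV)"

definition schwartz :: "('a::euclidean_space \<Rightarrow> 'b::real_normed_vector) set" where
  "schwartz = {f. smooth f \<and>
     (\<forall>bs m. set bs \<subseteq> Basis \<longrightarrow> (\<exists>C. \<forall>x. norm x ^ m * norm (iter_partial bs f x) \<le> C))}"

definition mu :: "'a::euclidean_space measure" where
  "mu = density lborel (\<lambda>_. ennreal (1 / (2 * pi) powr (real DIM('a) / 2)))"

definition L2norm :: "('a::euclidean_space \<Rightarrow> 'b::real_normed_vector) \<Rightarrow> real" where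
  "L2norm f = sqrt (\<integral>x. (norm (f x))\<^sup>2 \<partial>mu)"

text \<open>\<open>\<real>\<^sup>2\<^sup>d\<close> is modelled as \<open>\<real>\<^sup>d \<times> \<real>\<^sup>d\<close>, whose product norm is the Euclidean one.\<close>

definition wigner ::
  "((real ^ 'd) \<times> (real ^ 'd) \<Rightarrow> quat) \<Rightarrow> ((real ^ 'd) \<times> (real ^ 'd) \<Rightarrow> quat) \<Rightarrow>
   (real ^ 'd) \<times> (real ^ 'd) \<Rightarrow> (real ^ 'd) \<times> (real ^ 'd) \<Rightarrow> quat" where
  "wigner f g x w =
     (\<integral>t. exp (- ((fst w \<bullet> fst t) *\<^sub>R quat_i)) * f (x + t /\<^sub>R 2) * qcnj (g (x - t /\<^sub>R 2))
          * exp (- ((snd w \<bullet> snd t) *\<^sub>R quat_j)) \<partial>mu)"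

end

theory Submission
  imports Defs "HOL-Probability.Characteristic_Functions"
begin

text \<open>
  The inequality is the derivative at \<open>a = 0\<close> of a sharp Pitt inequality,
  \<open>\<integral>\<integral> |w|\<^bsup>-2a\<^esup> |W(f,g)|\<^sup>2 \<le> \<Gamma>(d/2 - a) / \<Gamma>(d/2 + a) * \<parallel>g\<parallel>\<^sup>2 * \<integral> |t|\<^bsup>2a\<^esup> |f|\<^sup>2\<close>, which is an equality (Moyal's formula) at
  \<open>a = 0\<close>; since \<open>|w|\<^bsup>-2a\<^esup> - 1 \<ge> -2a ln |w|\<close>, no limit is needed on the side of the Wigner transform.

  To prove Pitt's inequality, write \<open>|w|\<^bsup>-2a\<^esup>\<close> as a mixture of Gaussians \<open>exp (- s |w|\<^sup>2)\<close>.  For a Gaussian weight, the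
  integral of \<open>|W(f,g)|\<^sup>2\<close> is an absolutely convergent quadruple integral with a positive kernel in which the moduli of \<open>f\<close>
  and \<open>g\<close> can be taken.  Then \<open>g\<close> decouples by the inequality of arithmetic and geometric means, and what is left is the
  Stein-Weiss kernel in \<open>|f|\<close>, whose norm is found by Schur's test with the weight \<open>|u|\<^bsup>-d\<^esup>\<close> and evaluated by Gamma
  integrals.  Letting \<open>s\<close> tend to \<open>0\<close> gives Plancherel's formula, hence Moyal's.
\<close>

section \<open>Gamma and Gaussian integrals\<close>

text \<open>Only the value and the slope at \<open>a = 0\<close> of the constant in Pitt's
  inequality enter. The value is 1 and the slope is \<open>- 2 * Digamma (d / 2)\<close>, so the
  claim, in which the two \<open>ln 2\<close> cancel, is a bound by \<open>Digamma (d / 2)\<close>.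
  The \<open>- ln 2\<close> stems from the half shifts of the Wigner transform: for
  \<open>u = x + t / 2\<close> a difference in \<open>t\<close> is twice the difference in
  \<open>u\<close>, and this dilation removes the factor \<open>2 powr (- 2 * a)\<close> present in
  Pitt's inequality for the Fourier transform itself.

  The obstacle is that the logarithmic integral on the Wigner side must be shown to converge before
  it can be compared with anything. No pointwise decay of the transform in \<open>w\<close> is
  proved. Instead the Gaussian cutoff gives Plancherel's formula for Lipschitz functions with an
  error of order \<open>sqrt s\<close>; this rate, summed over \<open>s = exp (- 2 * k)\<close>,
  controls \<open>ln (norm w)\<close> at infinity, and Pitt's inequality itself controls it near
  0.\<close>

lemma nn_integral_lborel_affine:
  fixes h :: "'a::euclidean_space \<Rightarrow> ennreal"
  assumes [measurable]: "h \<in> borel_measurable borel" and "c \<noteq> 0"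
  shows "(\<integral>\<^sup>+x. h x \<partial>lborel) = ennreal (\<bar>c\<bar> ^ DIM('a)) * (\<integral>\<^sup>+x. h (t + c *\<^sub>R x) \<partial>lborel)"
  by (subst lborel_affine[OF assms(2), of t])
    (simp add: nn_integral_density nn_integral_distr nn_integral_cmult)

lemma nn_integral_lborel_shift:
  fixes h :: "'a::euclidean_space \<Rightarrow> ennreal"
  assumes "h \<in> borel_measurable borel"
  shows "(\<integral>\<^sup>+x. h (t + x) \<partial>lborel) = (\<integral>\<^sup>+x. h x \<partial>lborel)"
  using nn_integral_lborel_affine[OF assms, of 1 t] by simp

text \<open>Read from right to left, this writes the negative power \<open>c powr (- p)\<close> as a
  mixture of the exponentials \<open>exp (- (c * y))\<close>. With \<open>c\<close> a squared norm
  it is the source of every Gaussian mixture below.\<close>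

lemma nn_integral_Gamma:
  fixes p c :: real
  assumes "p > 0" and "c > 0"
  shows "(\<integral>\<^sup>+y\<in>{0<..}. ennreal (y powr (p - 1) * exp (- (c * y))) \<partial>lborel) = ennreal (Gamma p * c powr (- p))"
proof -
  let ?h = "\<lambda>y::real. indicator {0..} y * (y powr (p - 1) * exp (- y))"
  have "(\<lambda>y. y powr (p - 1) * exp (- y)) = (\<lambda>y. y powr (p - 1) / exp y)"
    by (simp add: exp_minus divide_inverse)
  then have "((\<lambda>y. y powr (p - 1) * exp (- y)) has_integral Gamma p) {0..}"
    using Gamma_integral_real[OF assms(1)] by simp
  moreover have "?h = (\<lambda>y. if y \<in> {0..} then y powr (p - 1) * exp (- y) else 0)"
    by (auto simp: fun_eq_iff)
  ultimately have "(?h has_integral Gamma p) UNIV"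
    using has_integral_restrict_UNIV[of "{0..}" "\<lambda>y. y powr (p - 1) * exp (- y)" "Gamma p"] by metis
  then have 1: "(\<integral>\<^sup>+y. ennreal (?h y) \<partial>lborel) = ennreal (Gamma p)"
    by (intro nn_integral_has_integral_lborel) auto
  have "(\<integral>\<^sup>+y. ennreal (?h y) \<partial>lborel) = ennreal c * (\<integral>\<^sup>+y. ennreal (?h (c * y)) \<partial>lborel)"
    using nn_integral_lborel_affine[of "\<lambda>y. ennreal (?h y)" c 0] assms by simp
  also have "(\<integral>\<^sup>+y. ennreal (?h (c * y)) \<partial>lborel) =
      (\<integral>\<^sup>+y. ennreal (c powr (p - 1)) * (ennreal (y powr (p - 1) * exp (- (c * y))) * indicator {0<..} y) \<partial>lborel)"
    using assms by (intro nn_integral_cong)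
      (auto simp: indicator_def powr_mult ennreal_mult[symmetric] zero_le_mult_iff mult.assoc split: if_splits)
  also have "\<dots> = ennreal (c powr (p - 1)) * (\<integral>\<^sup>+y\<in>{0<..}. ennreal (y powr (p - 1) * exp (- (c * y))) \<partial>lborel)"
    by (subst nn_integral_cmult) auto
  finally have 2: "ennreal (Gamma p) = ennreal (c powr p) * (\<integral>\<^sup>+y\<in>{0<..}. ennreal (y powr (p - 1) * exp (- (c * y))) \<partial>lborel)"
    using 1 assms by (simp add: mult.assoc[symmetric] ennreal_mult[symmetric] powr_diff)
  have "ennreal (Gamma p * c powr (- p)) = ennreal (c powr (- p)) * ennreal (Gamma p)"
    using assms by (simp add: ennreal_mult[symmetric] mult.commute Gamma_real_pos less_imp_le)
  also have "\<dots> = ennreal (c powr (- p) * c powr p) * (\<integral>\<^sup>+y\<in>{0<..}. ennreal (y powr (p - 1) * exp (- (c * y))) \<partial>lborel)"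
    unfolding 2 by (simp add: ennreal_mult mult.assoc)
  also have "c powr (- p) * c powr p = 1"
    using assms by (simp add: powr_add[symmetric])
  finally show ?thesis by simp
qed

text \<open>Writing \<open>(1 + x) powr (- (a + b))\<close> as a Gamma integral over
  \<open>y\<close> and exchanging the integrals leaves a Gamma integral in \<open>x\<close>, worth
  \<open>Gamma a * y powr (- a)\<close>, and then one in \<open>y\<close> with exponent
  \<open>b\<close>.\<close>

lemma nn_integral_beta_halfline:
  fixes a b :: real
  assumes "a > 0" and "b > 0"
  shows "(\<integral>\<^sup>+x\<in>{0<..}. ennreal (x powr (a - 1) * (1 + x) powr (- (a + b))) \<partial>lborel)
    = ennreal (Gamma a * Gamma b / Gamma (a + b))"
proof -
  let ?G = "\<lambda>x y::real. ennreal (x powr (a - 1)) * ennreal (y powr (a + b - 1) * exp (- ((1 + x) * y))) * indicator {0<..} x * indicator {0<..} y"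
  have "ennreal (Gamma (a + b)) * (\<integral>\<^sup>+x\<in>{0<..}. ennreal (x powr (a - 1) * (1 + x) powr (- (a + b))) \<partial>lborel)
     = (\<integral>\<^sup>+x. ennreal (Gamma (a + b)) * (ennreal (x powr (a - 1) * (1 + x) powr (- (a + b))) * indicator {0<..} x) \<partial>lborel)"
    by (subst nn_integral_cmult) auto
  also have "\<dots> = (\<integral>\<^sup>+x. (\<integral>\<^sup>+y. ?G x y \<partial>lborel) \<partial>lborel)"
  proof (intro nn_integral_cong)
    fix x :: real
    have "(\<integral>\<^sup>+y. ?G x y \<partial>lborel) = (\<integral>\<^sup>+y. (ennreal (x powr (a - 1)) * indicator {0<..} x) * (ennreal (y powr (a + b - 1) * exp (- ((1 + x) * y))) * indicator {0<..} y) \<partial>lborel)"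
      by (simp add: ac_simps)
    also have "\<dots> = (ennreal (x powr (a - 1)) * indicator {0<..} x) * (\<integral>\<^sup>+y\<in>{0<..}. ennreal (y powr (a + b - 1) * exp (- ((1 + x) * y))) \<partial>lborel)"
      by (subst nn_integral_cmult) auto
    also have "\<dots> = ennreal (Gamma (a + b)) * (ennreal (x powr (a - 1) * (1 + x) powr (- (a + b))) * indicator {0<..} x)"
    proof (cases "x > 0")
      case True
      have "(\<integral>\<^sup>+y\<in>{0<..}. ennreal (y powr (a + b - 1) * exp (- ((1 + x) * y))) \<partial>lborel) = ennreal (Gamma (a + b) * (1 + x) powr (- (a + b)))"
        using True assms by (intro nn_integral_Gamma) auto
      moreover have "Gamma (a + b) > 0" using assms by (simp add: Gamma_real_pos)
      ultimately show ?thesis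
        using True by (simp add: ennreal_mult[symmetric] mult.left_commute del: minus_add_distrib)
    qed simp
    finally show "ennreal (Gamma (a + b)) * (ennreal (x powr (a - 1) * (1 + x) powr (- (a + b))) * indicator {0<..} x) = (\<integral>\<^sup>+y. ?G x y \<partial>lborel)" ..
  qed
  also have "\<dots> = (\<integral>\<^sup>+y. (\<integral>\<^sup>+x. ?G x y \<partial>lborel) \<partial>lborel)"
    by (rule lborel_pair.Fubini') measurable
  also have "\<dots> = (\<integral>\<^sup>+y. ennreal (Gamma a) * (ennreal (y powr (b - 1) * exp (- (1 * y))) * indicator {0<..} y) \<partial>lborel)"
  proof (intro nn_integral_cong)
    fix y :: real
    have "(\<integral>\<^sup>+x. ?G x y \<partial>lborel) = (\<integral>\<^sup>+x. (ennreal (y powr (a + b - 1) * exp (- y)) * indicator {0<..} y) * (ennreal (x powr (a - 1) * exp (- (y * x))) * indicator {0<..} x) \<partial>lborel)"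
      by (intro nn_integral_cong) (auto simp: indicator_def ennreal_mult[symmetric] algebra_simps exp_add[symmetric])
    also have "\<dots> = (ennreal (y powr (a + b - 1) * exp (- y)) * indicator {0<..} y) * (\<integral>\<^sup>+x\<in>{0<..}. ennreal (x powr (a - 1) * exp (- (y * x))) \<partial>lborel)"
      by (subst nn_integral_cmult) auto
    also have "\<dots> = ennreal (Gamma a) * (ennreal (y powr (b - 1) * exp (- (1 * y))) * indicator {0<..} y)"
    proof (cases "y > 0")
      case True
      have "y powr (a + b - 1) * y powr (- a) = y powr (b - 1)"
        by (simp add: powr_add[symmetric])
      with True assms show ?thesis
        by (simp add: nn_integral_Gamma ennreal_mult[symmetric] Gamma_real_pos less_imp_le) 
    qed simp
    finally show "(\<integral>\<^sup>+x. ?G x y \<partial>lborel) = ennreal (Gamma a) * (ennreal (y powr (b - 1) * exp (- (1 * y))) * indicator {0<..} y)" .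
  qed
  also have "\<dots> = ennreal (Gamma a) * ennreal (Gamma b)"
    using assms nn_integral_Gamma[of b 1] by (subst nn_integral_cmult) auto
  finally have 1: "ennreal (Gamma (a + b)) * (\<integral>\<^sup>+x\<in>{0<..}. ennreal (x powr (a - 1) * (1 + x) powr (- (a + b))) \<partial>lborel)
     = ennreal (Gamma a * Gamma b)"
    using assms by (simp add: ennreal_mult Gamma_real_pos less_imp_le)
  have G: "Gamma (a + b) > 0" "Gamma a > 0" "Gamma b > 0"
    using assms by (simp_all add: Gamma_real_pos)
  have "ennreal (Gamma a * Gamma b / Gamma (a + b)) = ennreal (inverse (Gamma (a + b))) * ennreal (Gamma a * Gamma b)"
    using G by (simp add: ennreal_mult[symmetric] divide_inverse mult.commute)
  also have "\<dots> = ennreal (inverse (Gamma (a + b)) * Gamma (a + b)) * (\<integral>\<^sup>+x\<in>{0<..}. ennreal (x powr (a - 1) * (1 + x) powr (- (a + b))) \<partial>lborel)"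
    unfolding 1[symmetric] using G by (subst ennreal_mult) (auto simp: mult.assoc)
  also have "inverse (Gamma (a + b)) * Gamma (a + b) = 1"
    using G by simp
  finally show ?thesis by simp
qed

text \<open>This is the characteristic function of the standard normal distribution, rescaled by
  \<open>r = sqrt (2 * s)\<close>.\<close>

lemma gaussian_char_real:
  fixes s \<tau> :: real
  assumes "s > 0"
  shows "has_bochner_integral lborel (\<lambda>x. exp (- (s * x\<^sup>2)) *\<^sub>R cis (x * \<tau>))
    (complex_of_real (sqrt (pi / s) * exp (- \<tau>\<^sup>2 / (4 * s))))"
proof -
  define r where "r = sqrt (2 * s)"
  have r: "r > 0" "r\<^sup>2 = 2 * s" using assms by (auto simp: r_def)
  let ?t = "\<tau> / r"
  have int1: "integrable std_normal_distribution (\<lambda>x. iexp (?t * x))"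
    using real_distribution.axioms(1)[OF real_dist_normal_dist] 
    by (intro finite_measure.integrable_const_bound[where B=1]) (auto simp: prob_space_def)
  have "has_bochner_integral std_normal_distribution (\<lambda>x. iexp (?t * x)) (complex_of_real (exp (- (?t^2) / 2)))"
    using int1 fun_cong[OF char_std_normal_distribution, of ?t]
    by (simp only: has_bochner_integral_iff char_def)
  then have "has_bochner_integral lborel (\<lambda>x. std_normal_density x *\<^sub>R iexp (?t * x)) (complex_of_real (exp (- (?t^2) / 2)))"
    by (auto simp: has_bochner_integral_iff integrable_density integral_density)
  then have "has_bochner_integral lborel (\<lambda>x. std_normal_density (0 + r * x) *\<^sub>R iexp (?t * (0 + r * x))) 
     (complex_of_real (exp (- (?t^2) / 2)) /\<^sub>R \<bar>r\<bar>)"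
    using lborel_has_bochner_integral_real_affine_iff[of r "\<lambda>x. std_normal_density x *\<^sub>R iexp (?t * x)" _ 0] r by simp
  then have "has_bochner_integral lborel (\<lambda>x. sqrt (2 * pi) *\<^sub>R (std_normal_density (0 + r * x) *\<^sub>R iexp (?t * (0 + r * x)))) 
     (sqrt (2 * pi) *\<^sub>R (complex_of_real (exp (- (?t^2) / 2)) /\<^sub>R \<bar>r\<bar>))"
    by (rule has_bochner_integral_scaleR_right)
  moreover have "sqrt (2 * pi) *\<^sub>R (std_normal_density (0 + r * x) *\<^sub>R iexp (?t * (0 + r * x))) = exp (- (s * x\<^sup>2)) *\<^sub>R cis (x * \<tau>)" for x
    using r by (simp add: std_normal_density_def power_mult_distrib cis_conv_exp mult.commute)
  moreover have "sqrt (2 * pi) *\<^sub>R (complex_of_real (exp (- (?t^2) / 2)) /\<^sub>R \<bar>r\<bar>) = complex_of_real (sqrt (pi / s) * exp (- \<tau>\<^sup>2 / (4 * s)))"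
  proof -
    have "sqrt (2 * pi) / r = sqrt (pi / s)"
      unfolding r_def by (simp add: real_sqrt_divide[symmetric])
    then have "sqrt (2 * pi) * (exp (- (?t^2) / 2) / r) = sqrt (pi / s) * exp (- \<tau>\<^sup>2 / (4 * s))"
      using r by (simp add: power_divide) (metis mult.commute times_divide_eq_left times_divide_eq_right)
    moreover have "sqrt (2 * pi) *\<^sub>R (complex_of_real (exp (- (?t^2) / 2)) /\<^sub>R \<bar>r\<bar>) = complex_of_real (sqrt (2 * pi) * (exp (- (?t^2) / 2) / r))"
      using r by (simp add: scaleR_conv_of_real field_simps)
    ultimately show ?thesis by simp
  qed
  ultimately show ?thesis by simp
qed

text \<open>Lebesgue measure is the image of a product measure under the coordinates of an
  orthonormal basis, and both the Gaussian and the character factor over these coordinates.\<close>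

lemma gaussian_char:
  fixes \<tau> :: "'a::euclidean_space" and s :: real
  assumes "s > 0"
  shows "has_bochner_integral lborel (\<lambda>w. exp (- (s * (norm w)\<^sup>2)) *\<^sub>R cis (w \<bullet> \<tau>))
    (complex_of_real ((pi / s) powr (DIM('a) / 2) * exp (- (norm \<tau>)\<^sup>2 / (4 * s))))"
proof -
  interpret product_sigma_finite "\<lambda>b::'a. lborel :: real measure" ..
  let ?P = "\<Pi>\<^sub>M b\<in>(Basis::'a set). (lborel :: real measure)"
  let ?\<phi> = "\<lambda>b x. exp (- (s * x\<^sup>2)) *\<^sub>R cis (x * (\<tau> \<bullet> b))"
  let ?h = "\<lambda>w::'a. exp (- (s * (norm w)\<^sup>2)) *\<^sub>R cis (w \<bullet> \<tau>)"
  have \<phi>: "integrable lborel (?\<phi> b)" "integral\<^sup>L lborel (?\<phi> b) = complex_of_real (sqrt (pi / s) * exp (- (\<tau> \<bullet> b)\<^sup>2 / (4 * s)))" for b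
    using gaussian_char_real[OF assms, of "\<tau> \<bullet> b"] by (auto simp: has_bochner_integral_iff)
  have h_eq: "?h (\<Sum>b\<in>Basis. x b *\<^sub>R b) = (\<Prod>b\<in>Basis. ?\<phi> b (x b))" for x :: "'a \<Rightarrow> real"
  proof -
    have n: "(norm (\<Sum>b\<in>Basis. x b *\<^sub>R b))\<^sup>2 = (\<Sum>b\<in>(Basis::'a set). (x b)\<^sup>2)"
      unfolding power2_norm_eq_inner by (subst euclidean_inner) (simp add: power2_eq_square)
    have i: "(\<Sum>b\<in>Basis. x b *\<^sub>R b) \<bullet> \<tau> = (\<Sum>b\<in>Basis. x b * (\<tau> \<bullet> b))"
      by (subst euclidean_inner) simp
    have c: "cis (\<Sum>b\<in>A. u b) = (\<Prod>b\<in>A. cis (u b))" if "finite A" for A :: "'a set" and u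
      using that by induction (auto simp: cis_mult[symmetric])
    show ?thesis
      unfolding n i by (simp add: sum_distrib_left exp_sum c prod.distrib scaleR_conv_of_real flip: sum_negf)
  qed
  have "integrable ?P (\<lambda>x. ?h (\<Sum>b\<in>Basis. x b *\<^sub>R b))"
    unfolding h_eq by (rule product_integrable_prod) (auto simp: \<phi>)
  moreover have "integral\<^sup>L ?P (\<lambda>x. ?h (\<Sum>b\<in>Basis. x b *\<^sub>R b)) 
     = (\<Prod>b\<in>(Basis::'a set). complex_of_real (sqrt (pi / s) * exp (- (\<tau> \<bullet> b)\<^sup>2 / (4 * s))))"
    unfolding h_eq by (subst product_integral_prod) (auto simp: \<phi>)
  moreover have "(\<Prod>b\<in>(Basis::'a set). complex_of_real (sqrt (pi / s) * exp (- (\<tau> \<bullet> b)\<^sup>2 / (4 * s))))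
     = complex_of_real ((pi / s) powr (DIM('a) / 2) * exp (- (norm \<tau>)\<^sup>2 / (4 * s)))"
  proof -
    have n: "(norm \<tau>)\<^sup>2 = (\<Sum>b\<in>Basis. (\<tau> \<bullet> b)\<^sup>2)"
      unfolding power2_norm_eq_inner by (subst euclidean_inner) (simp add: power2_eq_square)
    have "sqrt (pi / s) ^ DIM('a) = (pi / s) powr (DIM('a) / 2)"
      using assms by (simp add: powr_half_sqrt[symmetric] powr_realpow[symmetric] powr_powr)
    then have "(\<Prod>b\<in>(Basis::'a set). sqrt (pi / s) * exp (- (\<tau> \<bullet> b)\<^sup>2 / (4 * s))) 
      = (pi / s) powr (DIM('a) / 2) * exp (- (norm \<tau>)\<^sup>2 / (4 * s))"
      unfolding n by (simp add: prod.distrib exp_sum[symmetric] sum_divide_distrib[symmetric] sum_negf)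
    then show ?thesis by (metis of_real_prod)
  qed
  moreover have [measurable]: "?h \<in> borel_measurable borel"
    by (intro borel_measurable_continuous_onI continuous_intros)
  moreover have "integrable lborel ?h \<longleftrightarrow> integrable ?P (\<lambda>x. ?h (\<Sum>b\<in>Basis. x b *\<^sub>R b))"
    by (subst (1) lborel_eq[where 'a='a], rule integrable_distr_eq) measurable
  moreover have "integral\<^sup>L lborel ?h = integral\<^sup>L ?P (\<lambda>x. ?h (\<Sum>b\<in>Basis. x b *\<^sub>R b))"
    by (subst (1) lborel_eq[where 'a='a], rule integral_distr) measurable
  ultimately show ?thesis
    unfolding has_bochner_integral_iff by (simp only:)
qed

lemma gaussian_cos:
  fixes \<tau> :: "'a::euclidean_space"
  assumes "s > 0"
  shows "has_bochner_integral lborel (\<lambda>w. exp (- (s * (norm w)\<^sup>2)) * cos (w \<bullet> \<tau>))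
    ((pi / s) powr (DIM('a) / 2) * exp (- (norm \<tau>)\<^sup>2 / (4 * s)))"
  using has_bochner_integral_bounded_linear[OF bounded_linear_Re gaussian_char[OF assms, of \<tau>]] by simp

lemma gaussian_sin:
  fixes \<tau> :: "'a::euclidean_space"
  assumes "s > 0"
  shows "has_bochner_integral lborel (\<lambda>w. exp (- (s * (norm w)\<^sup>2)) * sin (w \<bullet> \<tau>)) 0"
  using has_bochner_integral_bounded_linear[OF bounded_linear_Im gaussian_char[OF assms, of \<tau>]] by simp

lemma integral_gaussian:
  assumes "s > 0"
  shows "has_bochner_integral lborel (\<lambda>w::'a::euclidean_space. exp (- (s * (norm w)\<^sup>2))) ((pi / s) powr (DIM('a) / 2))"
  using gaussian_cos[OF assms, of "0::'a"] by simp

lemma nn_integral_gaussian: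
  assumes "s > 0"
  shows "(\<integral>\<^sup>+w. ennreal (exp (- (s * (norm (w::'a::euclidean_space))\<^sup>2))) \<partial>lborel) = ennreal ((pi / s) powr (DIM('a) / 2))"
  using integral_gaussian[OF assms, where 'a='a] 
  by (subst nn_integral_eq_integral) (auto simp: has_bochner_integral_iff)

section \<open>The two-sided quaternion Fourier transform\<close>

text \<open>Euler's formula for an arbitrary imaginary unit. The product of
  \<open>exp (- r q)\<close> with \<open>cos r + sin r q\<close> has derivative zero because
  \<open>q\<close> commutes with its own exponential and squares to \<open>- 1\<close>.\<close>

lemma exp_scaleR_quat_unit:
  fixes q :: quat
  assumes "q * q = - 1"
  shows "exp (r *\<^sub>R q) = cos r *\<^sub>R 1 + sin r *\<^sub>R q"
proof -
  let ?c = "\<lambda>r. cos r *\<^sub>R 1 + sin r *\<^sub>R q"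
  let ?h = "\<lambda>r. exp (r *\<^sub>R (- q)) * ?c r"
  have "(?h has_vector_derivative 0) (at r within UNIV)" for r
  proof -
    have "(?c has_vector_derivative ((- sin r) *\<^sub>R 1 + cos r *\<^sub>R q)) (at r)"
      by (auto intro!: derivative_eq_intros simp: has_vector_derivative_def)
        (auto simp: algebra_simps)
    from has_vector_derivative_mult[OF exp_scaleR_has_vector_derivative_right[of "- q"] this]
    have "(?h has_vector_derivative (exp (r *\<^sub>R (- q)) * ((- sin r) *\<^sub>R 1 + cos r *\<^sub>R q) + exp (r *\<^sub>R (- q)) * (- q) * ?c r)) (at r)" .
    moreover have "exp (r *\<^sub>R (- q)) * ((- sin r) *\<^sub>R 1 + cos r *\<^sub>R q) + exp (r *\<^sub>R (- q)) * (- q) * ?c r = 0"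
      by (simp add: algebra_simps assms)
    ultimately show ?thesis by simp
  qed
  then obtain c where c: "?h r = c" for r
    using has_vector_derivative_zero_constant[of UNIV ?h] by auto
  have "?h r = 1" using c[of r] c[of 0] by simp
  then have "exp (r *\<^sub>R q) * ?h r = exp (r *\<^sub>R q)" by simp
  moreover have "exp (r *\<^sub>R q) * ?h r = ?c r"
    using exp_minus_inverse[of "r *\<^sub>R q"] by (simp add: mult.assoc[symmetric])
  ultimately show ?thesis by simp
qed

text \<open>The kernel of the transform is an operator on the value \<open>p\<close>, not a factor:
  the two exponentials commute neither with \<open>p\<close> nor with each other, so they cannot be
  collected on one side.\<close>

definition twist :: "('a::real_inner) \<times> 'a \<Rightarrow> 'a \<times> 'a \<Rightarrow> quat \<Rightarrow> quat" where
  "twist w t p = exp (- ((fst w \<bullet> fst t) *\<^sub>R quat_i)) * p * exp (- ((snd w \<bullet> snd t) *\<^sub>R quat_j))"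

lemma exp_quat_i: "exp (- (r *\<^sub>R quat_i)) = cos r *\<^sub>R 1 - sin r *\<^sub>R quat_i"
  using exp_scaleR_quat_unit[of quat_i "- r"] by (simp add: quat_unit_mult)

lemma exp_quat_j: "exp (- (r *\<^sub>R quat_j)) = cos r *\<^sub>R 1 - sin r *\<^sub>R quat_j"
  using exp_scaleR_quat_unit[of quat_j "- r"] by (simp add: quat_unit_mult)

lemma norm_twist [simp]: "norm (twist w t p) = norm p"
proof -
  have "norm (exp (- (r *\<^sub>R quat_i))) = 1" "norm (exp (- (r *\<^sub>R quat_j))) = 1" for r
    by (simp_all add: exp_quat_i exp_quat_j norm_quat_def inner_quat_def flip: power2_eq_square)
  then show ?thesis by (simp add: twist_def norm_mult)
qed

lemma borel_measurable_fst' [measurable (raw)]: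
  fixes f :: "'c \<Rightarrow> 'a::second_countable_topology \<times> 'b::second_countable_topology"
  assumes "f \<in> borel_measurable M"
  shows "(\<lambda>x. fst (f x)) \<in> borel_measurable M"
  by (rule measurable_compose[OF assms]) (intro borel_measurable_continuous_onI continuous_intros)

lemma borel_measurable_snd' [measurable (raw)]:
  fixes f :: "'c \<Rightarrow> 'a::second_countable_topology \<times> 'b::second_countable_topology"
  assumes "f \<in> borel_measurable M"
  shows "(\<lambda>x. snd (f x)) \<in> borel_measurable M"
  by (rule measurable_compose[OF assms]) (intro borel_measurable_continuous_onI continuous_intros)

lemma borel_measurable_twist [measurable (raw)]:
  fixes f g :: "'c \<Rightarrow> ('a::euclidean_space) \<times> 'a"
  assumes [measurable]: "f \<in> borel_measurable M" "g \<in> borel_measurable M" "h \<in> borel_measurable M"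
  shows "(\<lambda>x. twist (f x) (g x) (h x)) \<in> borel_measurable M"
proof -
  have "continuous_on UNIV (\<lambda>z :: ('a \<times> 'a) \<times> ('a \<times> 'a) \<times> quat. twist (fst z) (fst (snd z)) (snd (snd z)))"
    unfolding twist_def exp_quat_i exp_quat_j by (intro continuous_intros)
  then have m: "(\<lambda>z :: ('a \<times> 'a) \<times> ('a \<times> 'a) \<times> quat. twist (fst z) (fst (snd z)) (snd (snd z))) \<in> borel_measurable borel"
    by (rule borel_measurable_continuous_onI)
  have "(\<lambda>x. (f x, g x, h x)) \<in> borel_measurable M" by measurable
  from measurable_compose[OF this m] show ?thesis by simp
qed

text \<open>Multiplication by a unit quaternion on either side is orthogonal, so the exponentials
  belonging to \<open>t'\<close> can be moved to the other argument, where they merge with those of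
  \<open>t\<close>. Only the differences \<open>A\<close> and \<open>B\<close> remain.\<close>

lemma inner_twist:
  "inner (twist w t p) (twist w t' q) =
     (let A = fst w \<bullet> (fst t - fst t'); B = snd w \<bullet> (snd t - snd t') in
       cos A * cos B * inner p q - sin A * cos B * inner (quat_i * p) q
       - cos A * sin B * inner (p * quat_j) q + sin A * sin B * inner (quat_i * p * quat_j) q)"
  unfolding twist_def exp_quat_i exp_quat_j Let_def inner_diff_right cos_diff sin_diff inner_quat_def
  by simp algebra

text \<open>After averaging over \<open>w\<close> only the term \<open>cos A * cos B\<close> of the product formula survives.  It is half the sum of
  two cosines of \<open>w \<bullet> \<tau>\<close> and \<open>w \<bullet> \<tau>'\<close>, where \<open>\<tau>'\<close> reflects the second half of \<open>\<tau>\<close> and so has the same norm; thus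
  radial weights do not see the non-commutativity.\<close>

lemma gaussian_inner_twist:
  fixes t t' :: "('a::euclidean_space) \<times> 'a"
  assumes "s > 0"
  shows "has_bochner_integral lborel (\<lambda>w. exp (- (s * (norm w)\<^sup>2)) * inner (twist w t p) (twist w t' q))
    ((pi / s) ^ DIM('a) * exp (- (norm (t - t'))\<^sup>2 / (4 * s)) * inner p q)"
proof -
  define \<tau> where "\<tau> = t - t'"
  define \<tau>' where "\<tau>' = (fst \<tau>, - snd \<tau>)"
  let ?e = "\<lambda>w::'a \<times> 'a. exp (- (s * (norm w)\<^sup>2))"
  let ?E = "(pi / s) ^ DIM('a) * exp (- (norm \<tau>)\<^sup>2 / (4 * s))"
  have n: "norm \<tau>' = norm \<tau>" by (simp add: \<tau>'_def norm_prod_def)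
  have d: "(pi / s) powr (DIM('a \<times> 'a) / 2) = (pi / s) ^ DIM('a)"
    using assms by (simp add: powr_realpow)
  have C: "has_bochner_integral lborel (\<lambda>w. ?e w * cos (w \<bullet> \<tau>)) ?E"
    using gaussian_cos[OF assms, of \<tau>] unfolding d .
  have C': "has_bochner_integral lborel (\<lambda>w. ?e w * cos (w \<bullet> \<tau>')) ?E"
    using gaussian_cos[OF assms, of \<tau>'] unfolding d n .
  note S = gaussian_sin[OF assms, of \<tau>] gaussian_sin[OF assms, of \<tau>']
  \<comment> \<open>The four products of sines and cosines are regrouped into functions of
    \<open>A + B = w \<bullet> \<tau>\<close> and \<open>A - B = w \<bullet> \<tau>'\<close>. Both
    cosines have the same integral, so the terms with \<open>quat_i * p * quat_j\<close>
    cancel.\<close>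
  have "has_bochner_integral lborel (\<lambda>w. 
       (?e w * cos (w \<bullet> \<tau>)) * ((inner p q - inner (quat_i * p * quat_j) q) / 2)
     + (?e w * cos (w \<bullet> \<tau>')) * ((inner p q + inner (quat_i * p * quat_j) q) / 2)
     - (?e w * sin (w \<bullet> \<tau>)) * ((inner (quat_i * p) q + inner (p * quat_j) q) / 2)
     - (?e w * sin (w \<bullet> \<tau>')) * ((inner (quat_i * p) q - inner (p * quat_j) q) / 2))
     (?E * ((inner p q - inner (quat_i * p * quat_j) q) / 2)
     + ?E * ((inner p q + inner (quat_i * p * quat_j) q) / 2)
     - 0 * ((inner (quat_i * p) q + inner (p * quat_j) q) / 2)
     - 0 * ((inner (quat_i * p) q - inner (p * quat_j) q) / 2))"
    by (intro has_bochner_integral_add has_bochner_integral_diff has_bochner_integral_mult_left C C' S)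
  moreover have "?e w * inner (twist w t p) (twist w t' q) = 
       (?e w * cos (w \<bullet> \<tau>)) * ((inner p q - inner (quat_i * p * quat_j) q) / 2)
     + (?e w * cos (w \<bullet> \<tau>')) * ((inner p q + inner (quat_i * p * quat_j) q) / 2)
     - (?e w * sin (w \<bullet> \<tau>)) * ((inner (quat_i * p) q + inner (p * quat_j) q) / 2)
     - (?e w * sin (w \<bullet> \<tau>')) * ((inner (quat_i * p) q - inner (p * quat_j) q) / 2)" for w
  proof -
    have "w \<bullet> \<tau> = fst w \<bullet> fst \<tau> + snd w \<bullet> snd \<tau>" "w \<bullet> \<tau>' = fst w \<bullet> fst \<tau> - snd w \<bullet> snd \<tau>"
      by (simp_all add: inner_prod_def \<tau>'_def)
    moreover have "fst t - fst t' = fst \<tau>" "snd t - snd t' = snd \<tau>" by (simp_all add: \<tau>_def)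
    ultimately show ?thesis
      by (simp only: inner_twist Let_def cos_add cos_diff sin_add sin_diff) (simp add: field_simps)
  qed
  moreover have "?E * inner p q = ?E * ((inner p q - inner (quat_i * p * quat_j) q) / 2)
     + ?E * ((inner p q + inner (quat_i * p * quat_j) q) / 2)
     - 0 * ((inner (quat_i * p) q + inner (p * quat_j) q) / 2)
     - 0 * ((inner (quat_i * p) q - inner (p * quat_j) q) / 2)"
    by (simp only: distrib_left[symmetric] mult_zero_left add_divide_distrib[symmetric]) simp
  ultimately show ?thesis
    unfolding \<tau>_def[symmetric] by (simp only:)
qed

section \<open>Gaussian-weighted energy of the transform as a double integral\<close>

lemma integrable_lborel_mult_prod:
  fixes f :: "'a::euclidean_space \<Rightarrow> real" and g :: "'b::euclidean_space \<Rightarrow> real"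
  assumes f: "integrable lborel f" and g: "integrable lborel g"
  shows "integrable (lborel \<Otimes>\<^sub>M lborel) (\<lambda>z. f (fst z) * g (snd z))"
proof -
  have [measurable]: "f \<in> borel_measurable borel" "g \<in> borel_measurable borel"
    using borel_measurable_integrable[OF f] borel_measurable_integrable[OF g] by auto
  show ?thesis
  proof (rule lborel_pair.Fubini_integrable)
    show "integrable lborel (\<lambda>x. \<integral>y. norm (f (fst (x, y)) * g (snd (x, y))) \<partial>lborel)"
      using f by (simp add: abs_mult)
  qed (use g in auto)
qed

lemma
  fixes k :: "'a::euclidean_space \<Rightarrow> real"
  assumes k: "integrable lborel k"
  shows integrable_lborel_reflect: "integrable lborel (\<lambda>x. k (t - x))"
    and integral_lborel_reflect: "(\<integral>x. k (t - x) \<partial>lborel) = (\<integral>x. k x \<partial>lborel)"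
proof -
  have [measurable]: "k \<in> borel_measurable borel"
    using borel_measurable_integrable[OF k] by simp
  have eq: "lborel = density (distr lborel borel (\<lambda>x. t - x)) (\<lambda>_. 1)"
    using lborel_affine[of "-1" t] by simp
  then have eq: "lborel = distr lborel borel (\<lambda>x. t - x)"
    by (simp only: density_1)
  show "integrable lborel (\<lambda>x. k (t - x))"
    using k by (subst (asm) eq, subst (asm) integrable_distr_eq) auto
  show "(\<integral>x. k (t - x) \<partial>lborel) = (\<integral>x. k x \<partial>lborel)"
    by (subst (2) eq, subst integral_distr) auto
qed

text \<open>It evaluates the main term when \<open>k\<close> is \<open>gkernel s\<close>, and the
  error term when \<open>k\<close> is \<open>gkernel s\<close> times the norm.\<close>

lemma has_bochner_integral_convolution:
  fixes f k :: "'a::euclidean_space \<Rightarrow> real"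
  assumes k: "integrable lborel k" and f: "integrable lborel f"
  shows "has_bochner_integral (lborel \<Otimes>\<^sub>M lborel) (\<lambda>z. k (fst z - snd z) * f (fst z)) 
    ((\<integral>x. k x \<partial>lborel) * (\<integral>x. f x \<partial>lborel))"
proof -
  have [measurable]: "f \<in> borel_measurable borel" "k \<in> borel_measurable borel"
    using borel_measurable_integrable[OF f] borel_measurable_integrable[OF k] by auto
  note kabs = integrable_abs[OF k]
  have int: "integrable (lborel \<Otimes>\<^sub>M lborel) (\<lambda>z. k (fst z - snd z) * f (fst z))"
  proof (rule lborel_pair.Fubini_integrable)
    have "(\<integral>y. norm (k (fst (x, y) - snd (x, y)) * f (fst (x, y))) \<partial>lborel) = (\<integral>x. \<bar>k x\<bar> \<partial>lborel) * \<bar>f x\<bar>" for x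
      using integral_lborel_reflect[OF kabs, of x] by (simp add: abs_mult)
    then show "integrable lborel (\<lambda>x. \<integral>y. norm (k (fst (x, y) - snd (x, y)) * f (fst (x, y))) \<partial>lborel)"
      using f by simp
  qed (use integrable_lborel_reflect[OF k] in auto)
  have "integral\<^sup>L (lborel \<Otimes>\<^sub>M lborel) (\<lambda>z. k (fst z - snd z) * f (fst z)) = (\<integral>x. (\<integral>y. k (x - y) * f x \<partial>lborel) \<partial>lborel)"
    using lborel_pair.integral_fst'[OF int] by simp
  also have "\<dots> = (\<integral>x. k x \<partial>lborel) * (\<integral>x. f x \<partial>lborel)"
    by (simp add: integral_lborel_reflect[OF k])
  finally show ?thesis using int by (simp add: has_bochner_integral_iff)
qed

text \<open>Taken against Lebesgue measure without a normalising factor, which is restored in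
  \<open>wigner_eq_qft\<close>. Hence the powers of \<open>2 * pi\<close> in Plancherel's formula
  for it.\<close>

definition qft :: "(('a::euclidean_space) \<times> 'a \<Rightarrow> quat) \<Rightarrow> 'a \<times> 'a \<Rightarrow> quat" where
  "qft F w = (\<integral>t. twist w t (F t) \<partial>lborel)"

lemma borel_measurable_qft [measurable]:
  fixes F :: "('a::euclidean_space) \<times> 'a \<Rightarrow> quat"
  assumes [measurable]: "F \<in> borel_measurable borel"
  shows "qft F \<in> borel_measurable borel"
proof -
  have "(\<lambda>w. \<integral>t. twist w t (F t) \<partial>lborel) \<in> borel_measurable (borel :: ('a \<times> 'a) measure)"
    by measurable
  then show ?thesis by (simp add: qft_def[abs_def])
qed

lemma integrable_twist:
  fixes F :: "('a::euclidean_space) \<times> 'a \<Rightarrow> quat"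
  assumes F: "integrable lborel F"
  shows "integrable lborel (\<lambda>t. twist w t (F t))"
proof -
  have [measurable]: "F \<in> borel_measurable borel"
    using borel_measurable_integrable[OF F] by simp
  show ?thesis by (rule Bochner_Integration.integrable_bound[OF F]) auto
qed

text \<open>The squared norm is expanded into a double integral over \<open>t\<close> and
  \<open>t'\<close>. The Gaussian makes the triple integral absolutely convergent, so the integral
  over \<open>w\<close> can be done first, where \<open>gaussian_inner_twist\<close> evaluates
  it.\<close>

lemma
  fixes F :: "('a::euclidean_space) \<times> 'a \<Rightarrow> quat"
  assumes F: "integrable lborel F" and s: "s > 0"
  shows gaussian_qft: "has_bochner_integral lborel (\<lambda>w. exp (- (s * (norm w)\<^sup>2)) * (norm (qft F w))\<^sup>2)
      (\<integral>z. (pi / s) ^ DIM('a) * exp (- (norm (fst z - snd z))\<^sup>2 / (4 * s)) * inner (F (fst z)) (F (snd z)) \<partial>(lborel \<Otimes>\<^sub>M lborel))"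
      (is "has_bochner_integral _ _ (\<integral>z. ?K z \<partial>_)")
    and integrable_gaussian_qft_kernel: "integrable (lborel \<Otimes>\<^sub>M lborel) (\<lambda>z. (pi / s) ^ DIM('a) * exp (- (norm (fst z - snd z))\<^sup>2 / (4 * s)) * inner (F (fst z)) (F (snd z)))"
proof -
  have [measurable]: "F \<in> borel_measurable borel"
    using borel_measurable_integrable[OF F] by simp
  let ?e = "\<lambda>w::'a \<times> 'a. exp (- (s * (norm w)\<^sup>2))"
  let ?I = "\<lambda>w z. inner (twist w (fst z) (F (fst z))) (twist w (snd z) (F (snd z)))"
  have FF: "integrable lborel (\<lambda>z. norm (F (fst z)) * norm (F (snd z)))"
    using integrable_lborel_mult_prod[OF integrable_norm[OF F] integrable_norm[OF F]] by (simp add: lborel_prod)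
  have Ib: "\<bar>?I w z\<bar> \<le> norm (F (fst z)) * norm (F (snd z))" for w z
    using Cauchy_Schwarz_ineq2[of "twist w (fst z) (F (fst z))" "twist w (snd z) (F (snd z))"] by simp
  have Iint: "integrable lborel (?I w)" for w
    by (rule Bochner_Integration.integrable_bound[OF FF]) (use Ib in \<open>auto intro: order.trans[OF _ abs_ge_self]\<close>)
  have e: "integrable lborel ?e"
    using integral_gaussian[OF s, where 'a="'a \<times> 'a"] by (simp add: has_bochner_integral_iff)
  have int: "integrable (lborel \<Otimes>\<^sub>M lborel) (\<lambda>(w, z). ?e w * ?I w z)"
  proof (rule Bochner_Integration.integrable_bound[OF integrable_lborel_mult_prod[OF e FF]])
    show "AE x in lborel \<Otimes>\<^sub>M lborel. norm (case x of (w, z) \<Rightarrow> ?e w * ?I w z)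
         \<le> norm (?e (fst x) * (norm (F (fst (snd x))) * norm (F (snd (snd x)))))"
      using Ib by (auto simp: abs_mult intro!: mult_left_mono)
  qed measurable
  have qq: "(norm (qft F w))\<^sup>2 = (\<integral>z. ?I w z \<partial>lborel)" for w
  proof -
    note tw = integrable_twist[OF F, of w]
    have "(norm (qft F w))\<^sup>2 = inner (qft F w) (qft F w)" by (rule power2_norm_eq_inner)
    also have "\<dots> = (\<integral>t. inner (twist w t (F t)) (qft F w) \<partial>lborel)"
      by (subst (1) qft_def) (rule integral_inner_left[symmetric, OF tw])
    also have "\<dots> = (\<integral>t. (\<integral>t'. inner (twist w t (F t)) (twist w t' (F t')) \<partial>lborel) \<partial>lborel)"
      by (subst (1) qft_def) (simp add: integral_inner_right[OF tw])
    also have "\<dots> = (\<integral>z. ?I w z \<partial>(lborel \<Otimes>\<^sub>M lborel))"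
      using lborel_pair.integral_fst'[of "?I w"] Iint[of w] by (simp add: lborel_prod)
    finally show ?thesis by (simp add: lborel_prod)
  qed
  have inner_w: "(\<integral>w. ?e w * ?I w z \<partial>lborel) = ?K z" for z
    by (rule has_bochner_integral_integral_eq[OF gaussian_inner_twist[OF s]])
  have 1: "(\<lambda>w. \<integral>z. ?e w * ?I w z \<partial>lborel) = (\<lambda>w. ?e w * (norm (qft F w))\<^sup>2)"
    by (simp add: qq)
  have "integrable lborel (\<lambda>w. ?e w * (norm (qft F w))\<^sup>2)"
    using lborel_pair.integrable_fst[OF int] unfolding 1 .
  moreover have "(\<integral>w. ?e w * (norm (qft F w))\<^sup>2 \<partial>lborel) = (\<integral>z. ?K z \<partial>lborel)"
    using lborel_pair.Fubini_integral[OF int] unfolding 1 inner_w by simp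
  ultimately show "has_bochner_integral lborel (\<lambda>w. ?e w * (norm (qft F w))\<^sup>2) (\<integral>z. ?K z \<partial>(lborel \<Otimes>\<^sub>M lborel))"
    by (simp add: has_bochner_integral_iff lborel_prod)
  show "integrable (lborel \<Otimes>\<^sub>M lborel) ?K"
    using lborel_pair.integrable_snd[OF int] unfolding inner_w by (simp add: lborel_prod)
qed

lemma has_bochner_integral_convolution':
  fixes f k :: "'a::euclidean_space \<Rightarrow> real"
  assumes k: "integrable lborel k" and f: "integrable lborel f"
  shows "has_bochner_integral (lborel \<Otimes>\<^sub>M lborel) (\<lambda>z. k (snd z - fst z) * f (snd z)) 
    ((\<integral>x. k x \<partial>lborel) * (\<integral>x. f x \<partial>lborel))"
proof -
  note * = has_bochner_integral_convolution[OF k f, unfolded has_bochner_integral_iff]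
  show ?thesis
    using lborel_pair.integrable_product_swap[OF *[THEN conjunct1]] *
      lborel_pair.integral_product_swap[OF borel_measurable_integrable[OF *[THEN conjunct1]]]
    unfolding has_bochner_integral_iff case_prod_unfold by simp
qed

text \<open>The Fourier transform of \<open>\<lambda>w. exp (- s * (norm w)\<^sup>2)\<close>.\<close>

definition gkernel :: "real \<Rightarrow> ('a::euclidean_space) \<times> 'a \<Rightarrow> real" where
  "gkernel s \<tau> = (pi / s) ^ DIM('a) * exp (- (norm \<tau>)\<^sup>2 / (4 * s))"

lemma borel_measurable_gkernel [measurable]: "gkernel s \<in> borel_measurable borel"
  unfolding gkernel_def by measurable

lemma borel_measurable_gkernel' [measurable (raw)]:
  assumes [measurable]: "h \<in> borel_measurable M" "k \<in> borel_measurable M"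
  shows "(\<lambda>x. gkernel (h x) (k x)) \<in> borel_measurable M"
  unfolding gkernel_def by measurable

lemma gkernel_nonneg: "s > 0 \<Longrightarrow> gkernel s \<tau> \<ge> 0"
  by (simp add: gkernel_def)

lemma gkernel_minus: "gkernel s (x - y) = gkernel s (y - x)"
  by (simp add: gkernel_def norm_minus_commute)

text \<open>The mass does not depend on \<open>s\<close>: up to this factor the kernels form an
  approximate identity as \<open>s\<close> tends to 0. It becomes the constant in Plancherel's
  formula.\<close>

lemma has_bochner_integral_gkernel:
  assumes "s > 0"
  shows "has_bochner_integral lborel (gkernel s :: ('a::euclidean_space) \<times> 'a \<Rightarrow> real) ((2 * pi) ^ (2 * DIM('a)))"
proof -
  have "has_bochner_integral lborel (\<lambda>w::'a\<times>'a. (pi / s) ^ DIM('a) * exp (- (1 / (4 * s) * (norm w)\<^sup>2))) 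
    ((pi / s) ^ DIM('a) * (pi / (1 / (4 * s))) powr (DIM('a \<times> 'a) / 2))"
    using assms by (intro has_bochner_integral_mult_right integral_gaussian) auto
  moreover have "(pi / s) ^ DIM('a) * (pi / (1 / (4 * s))) powr (DIM('a \<times> 'a) / 2) = (2 * pi) ^ (2 * DIM('a))"
  proof -
    have "(pi / s) ^ DIM('a) * (pi / (1 / (4 * s))) powr (DIM('a \<times> 'a) / 2) = ((pi / s) * (pi * (4 * s))) ^ DIM('a)"
      using assms by (simp add: powr_realpow power_mult_distrib power_divide)
    also have "(pi / s) * (pi * (4 * s)) = (2 * pi)\<^sup>2"
      using assms by (simp add: power2_eq_square)
    finally show ?thesis by (simp only: power_mult[symmetric])
  qed
  ultimately show ?thesis
    by (simp add: gkernel_def[abs_def])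
qed

text \<open>Twice the mass of the wider Gaussian with \<open>8 * s\<close> in place of
  \<open>4 * s\<close>, which majorises the first moment of \<open>gkernel s\<close> after a factor
  \<open>sqrt s\<close> is taken out.\<close>

definition moment_const :: "'a::euclidean_space itself \<Rightarrow> real" where
  "moment_const _ = 2 * (8 * pi\<^sup>2) ^ DIM('a)"

text \<open>Under the kernel \<open>norm \<tau>\<close> is of order \<open>sqrt s\<close>. The
  linear factor is absorbed by giving up half of the Gaussian exponent, which reduces the moment to
  another Gaussian integral.\<close>

lemma gkernel_first_moment:
  assumes s: "s > 0"
  shows "integrable lborel (\<lambda>\<tau> :: ('a::euclidean_space) \<times> 'a. gkernel s \<tau> * norm \<tau>)" (is ?A)
    and "(\<integral>\<tau>. gkernel s \<tau> * norm (\<tau> :: 'a \<times> 'a) \<partial>lborel) \<le> moment_const TYPE('a) * sqrt s" (is ?B)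
proof -
  let ?b = "\<lambda>w::'a\<times>'a. (2 * sqrt s * (pi / s) ^ DIM('a)) * exp (- (1 / (8 * s) * (norm w)\<^sup>2))"
  have "has_bochner_integral lborel ?b
    ((2 * sqrt s * (pi / s) ^ DIM('a)) * (pi / (1 / (8 * s))) powr (DIM('a \<times> 'a) / 2))"
    using s by (intro has_bochner_integral_mult_right integral_gaussian) auto
  moreover have "(2 * sqrt s * (pi / s) ^ DIM('a)) * (pi / (1 / (8 * s))) powr (DIM('a \<times> 'a) / 2) = moment_const TYPE('a) * sqrt s"
  proof -
    have "(pi / s) ^ DIM('a) * (pi / (1 / (8 * s))) powr (DIM('a \<times> 'a) / 2) = ((pi / s) * (pi * (8 * s))) ^ DIM('a)"
      using s by (simp add: powr_realpow power_mult_distrib power_divide)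
    also have "(pi / s) * (pi * (8 * s)) = 8 * pi\<^sup>2"
      using s by (simp add: power2_eq_square)
    finally show ?thesis by (simp add: moment_const_def mult.assoc)
  qed
  ultimately have b: "has_bochner_integral lborel ?b (moment_const TYPE('a) * sqrt s)" by (simp only:)
  have le: "gkernel s \<tau> * norm \<tau> \<le> ?b \<tau>" for \<tau> :: "'a \<times> 'a"
  proof -
    define x where "x = norm \<tau> / sqrt s"
    have x: "norm \<tau> = sqrt s * x" "(norm \<tau>)\<^sup>2 / s = x\<^sup>2" using s by (simp_all add: x_def power_divide)
    \<comment> \<open>This says \<open>x \<le> 1 + x^2 / 4\<close>, which is weakened to the form
      \<open>2 * (1 + x^2 / 8)\<close> so that the tangent line bound for \<open>exp\<close>
      applies.\<close>
    have "0 \<le> (x - 2)\<^sup>2" by simp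
    then have "x \<le> 2 * (1 + x\<^sup>2 / 8)" by (simp add: power2_eq_square algebra_simps)
    also have "\<dots> \<le> 2 * exp (x\<^sup>2 / 8)" by (rule mult_left_mono[OF exp_ge_add_one_self]) simp
    finally have "exp (- (x\<^sup>2 / 4)) * x \<le> exp (- (x\<^sup>2 / 4)) * (2 * exp (x\<^sup>2 / 8))" by simp
    also have "\<dots> = 2 * exp (- (x\<^sup>2 / 8))" by (simp add: exp_add[symmetric])
    finally have "(sqrt s * (pi / s) ^ DIM('a)) * (exp (- (x\<^sup>2 / 4)) * x) \<le> (sqrt s * (pi / s) ^ DIM('a)) * (2 * exp (- (x\<^sup>2 / 8)))"
      using s by (intro mult_left_mono) auto
    then show ?thesis
      using s by (simp add: gkernel_def x(1) power_mult_distrib mult_ac)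
  qed
  have le': "norm (gkernel s \<tau> * norm \<tau>) \<le> norm (?b \<tau>)" for \<tau> :: "'a \<times> 'a"
    using order.trans[OF le[of \<tau>] abs_ge_self] gkernel_nonneg[OF s, of \<tau>] by (simp only: real_norm_def abs_mult abs_norm_cancel abs_of_nonneg)
  show A: ?A
  proof (rule Bochner_Integration.integrable_bound)
    show "integrable lborel ?b" using b by (rule integrable.intros)
    show "AE \<tau> in lborel. norm (gkernel s \<tau> * norm \<tau>) \<le> norm (?b \<tau>)" by (intro AE_I2 le')
  qed measurable
  have "(\<integral>\<tau>. gkernel s \<tau> * norm (\<tau> :: 'a \<times> 'a) \<partial>lborel) \<le> integral\<^sup>L lborel ?b"
    by (intro integral_mono A integrable.intros[OF b] le)
  then show ?B
    by (simp only: has_bochner_integral_integral_eq[OF b])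
qed

text \<open>The kernel is positive, so Cauchy-Schwarz replaces the inner product of quaternions by
  the product of their norms. What remains of Pitt's inequality concerns real non-negative
  integrands only.\<close>

lemma nn_integral_gaussian_qft_le:
  fixes F :: "('a::euclidean_space) \<times> 'a \<Rightarrow> quat"
  assumes F: "integrable lborel F" and s: "s > 0"
  shows "(\<integral>\<^sup>+w. ennreal (exp (- (s * (norm w)\<^sup>2)) * (norm (qft F w))\<^sup>2) \<partial>lborel)
    \<le> (\<integral>\<^sup>+t. (\<integral>\<^sup>+t'. ennreal (gkernel s (t - t') * (norm (F t) * norm (F t'))) \<partial>lborel) \<partial>lborel)"
proof -
  have [measurable]: "F \<in> borel_measurable borel"
    using borel_measurable_integrable[OF F] by simp
  let ?f = "\<lambda>z. gkernel s (fst z - snd z) * inner (F (fst z)) (F (snd z))"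
  note G = gaussian_qft[OF F s, folded gkernel_def]
  have "(\<integral>\<^sup>+w. ennreal (exp (- (s * (norm w)\<^sup>2)) * (norm (qft F w))\<^sup>2) \<partial>lborel) = ennreal (integral\<^sup>L (lborel \<Otimes>\<^sub>M lborel) ?f)"
    using G by (subst nn_integral_eq_integral) (auto simp: has_bochner_integral_iff)
  also have "\<dots> \<le> ennreal (norm (integral\<^sup>L (lborel \<Otimes>\<^sub>M lborel) ?f))" by (simp add: ennreal_leI)
  also have "\<dots> \<le> (\<integral>\<^sup>+z. ennreal (norm (?f z)) \<partial>(lborel \<Otimes>\<^sub>M lborel))"
    by (rule integral_norm_bound_ennreal[OF integrable_gaussian_qft_kernel[OF F s, folded gkernel_def]])
  also have "\<dots> \<le> (\<integral>\<^sup>+z. ennreal (gkernel s (fst z - snd z) * (norm (F (fst z)) * norm (F (snd z)))) \<partial>(lborel \<Otimes>\<^sub>M lborel))"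
    unfolding real_norm_def abs_mult abs_of_nonneg[OF gkernel_nonneg[OF s]]
    by (intro nn_integral_mono ennreal_leI mult_left_mono Cauchy_Schwarz_ineq2 gkernel_nonneg[OF s])
  also have "\<dots> = (\<integral>\<^sup>+t. (\<integral>\<^sup>+t'. ennreal (gkernel s (t - t') * (norm (F t) * norm (F t'))) \<partial>lborel) \<partial>lborel)"
    by (subst lborel.nn_integral_fst[symmetric]) simp_all
  finally show ?thesis .
qed

text \<open>With this bound, integrability of \<open>ln (norm w)\<close> at infinity needs only a Lipschitz estimate, no integration by parts.\<close>

lemma suminf_exp_bound_ln:
  fixes r y :: real
  assumes "y \<ge> 0" "r \<ge> 0"
  shows "ennreal (max 0 (ln r) * y) \<le> 2 * (\<Sum>k. ennreal ((1 - exp (- (exp (- 2 * real k) * r\<^sup>2))) * y))"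
proof (cases "r > 1")
  case True
  define N where "N = nat \<lfloor>ln r\<rfloor>"
  have N: "real N \<le> ln r" "ln r \<le> real (Suc N)"
    using True by (auto simp: N_def) linarith
  \<comment> \<open>For \<open>k \<le> N\<close> the number \<open>exp (- 2 * k) * r^2\<close> is at
    least 1, so the summand is at least \<open>1 - exp (- 1)\<close>, hence at least one half. There
    are \<open>N + 1\<close> such terms, which is at least \<open>ln r\<close>; this explains the
    factor 2.\<close>
  have half: "1 / 2 \<le> 1 - exp (- (exp (- 2 * real k) * r\<^sup>2))" if "k < Suc N" for k
  proof -
    have "exp (real k) \<le> exp (ln r)" using that N by (simp only: exp_le_cancel_iff)
    then have "exp (real k) \<le> r" using True by simp
    then have "(exp (real k))\<^sup>2 \<le> r\<^sup>2" by (intro power_mono) auto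
    then have "exp (2 * real k) \<le> r\<^sup>2" by (simp add: exp_double)
    then have "exp (- 2 * real k) * exp (2 * real k) \<le> exp (- 2 * real k) * r\<^sup>2" by (intro mult_left_mono) auto
    then have "1 \<le> exp (- 2 * real k) * r\<^sup>2" by (simp add: exp_add[symmetric])
    then have "exp (- (exp (- 2 * real k) * r\<^sup>2)) \<le> exp (- 1)" by simp
    also have "\<dots> \<le> 1 / 2" using exp_ge_add_one_self[of 1] by (simp add: exp_minus field_simps)
    finally show ?thesis by simp
  qed
  have "max 0 (ln r) * y \<le> real (Suc N) * y"
    using N assms True by (intro mult_right_mono) auto
  also have "\<dots> = 2 * (\<Sum>k<Suc N. 1 / 2 * y)" by simp
  also have "\<dots> \<le> 2 * (\<Sum>k<Suc N. (1 - exp (- (exp (- 2 * real k) * r\<^sup>2))) * y)"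
    using half assms by (intro mult_left_mono sum_mono mult_right_mono) auto
  finally have "ennreal (max 0 (ln r) * y) \<le> ennreal (2 * (\<Sum>k<Suc N. (1 - exp (- (exp (- 2 * real k) * r\<^sup>2))) * y))"
    by (rule ennreal_leI)
  also have "\<dots> = 2 * (\<Sum>k<Suc N. ennreal ((1 - exp (- (exp (- 2 * real k) * r\<^sup>2))) * y))"
    using assms by (subst sum_ennreal) (auto simp: ennreal_mult' sum_nonneg simp del: sum.lessThan_Suc)
  also have "\<dots> \<le> 2 * (\<Sum>k. ennreal ((1 - exp (- (exp (- 2 * real k) * r\<^sup>2))) * y))"
    by (intro mult_left_mono sum_le_suminf) auto
  finally show ?thesis .
next
  case False
  then have "max 0 (ln r) = 0" using assms by (cases "r = 0") auto
  then show ?thesis by simp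
qed

section \<open>Plancherel's formula and high frequencies of integrable Lipschitz functions\<close>

context
  fixes F :: "('a::euclidean_space) \<times> 'a \<Rightarrow> quat" and L :: real
  assumes F: "integrable lborel F" and F2: "integrable lborel (\<lambda>t. (norm (F t))\<^sup>2)"
    and lip: "\<And>t t'. norm (F t - F t') \<le> L * norm (t - t')"
begin

lemma lipschitz_const_nonneg: "L \<ge> 0"
proof -
  obtain b :: 'a where "b \<in> Basis" using nonempty_Basis by blast
  then have "norm (b, 0 :: 'a) = 1" by (simp add: norm_prod_def)
  then show ?thesis using order.trans[OF norm_ge_zero lip[of "(b, 0)" 0]] by simp
qed

text \<open>The inner product of \<open>F t\<close> and \<open>F t'\<close> falls short of the
  square of \<open>norm (F t)\<close> by at most \<open>norm (F t) * L * norm (t - t')\<close>.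
  Against the kernel, the main term yields its mass and the error its first moment. The Lipschitz
  condition, in place of mere continuity, supplies the rate \<open>sqrt s\<close>.\<close>

lemma gaussian_qft_lower:
  assumes s: "s > 0"
  shows "(2 * pi) ^ (2 * DIM('a)) * (\<integral>t. (norm (F t))\<^sup>2 \<partial>lborel) - L * moment_const TYPE('a) * sqrt s * (\<integral>t. norm (F t) \<partial>lborel)
    \<le> (\<integral>w. exp (- (s * (norm w)\<^sup>2)) * (norm (qft F w))\<^sup>2 \<partial>lborel)"
proof -
  let ?P = "lborel \<Otimes>\<^sub>M lborel :: (('a \<times> 'a) \<times> ('a \<times> 'a)) measure"
  let ?k1 = "\<lambda>\<tau>::'a\<times>'a. gkernel s \<tau> * norm \<tau>"
  let ?f = "\<lambda>z. gkernel s (fst z - snd z) * inner (F (fst z)) (F (snd z))"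
  have k: "integrable lborel (gkernel s :: 'a \<times> 'a \<Rightarrow> real)" "(\<integral>\<tau>. gkernel s (\<tau> :: 'a \<times> 'a) \<partial>lborel) = (2 * pi) ^ (2 * DIM('a))"
    using has_bochner_integral_gkernel[OF s] by (auto simp: has_bochner_integral_iff)
  note k1 = gkernel_first_moment[OF s, where 'a='a]
  note c1 = has_bochner_integral_convolution[OF k(1) F2, unfolded has_bochner_integral_iff]
  note c2 = has_bochner_integral_convolution[OF k1(1) integrable_norm[OF F], unfolded has_bochner_integral_iff]
  have "(2 * pi) ^ (2 * DIM('a)) * (\<integral>t. (norm (F t))\<^sup>2 \<partial>lborel) - L * moment_const TYPE('a) * sqrt s * (\<integral>t. norm (F t) \<partial>lborel)
    \<le> (2 * pi) ^ (2 * DIM('a)) * (\<integral>t. (norm (F t))\<^sup>2 \<partial>lborel) - L * ((\<integral>\<tau>. ?k1 \<tau> \<partial>lborel) * (\<integral>t. norm (F t) \<partial>lborel))"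
    using mult_right_mono[OF mult_left_mono[OF k1(2) lipschitz_const_nonneg], of "\<integral>t. norm (F t) \<partial>lborel"] by (simp add: mult_ac)
  also have "\<dots> = (\<integral>z. gkernel s (fst z - snd z) * (norm (F (fst z)))\<^sup>2 - L * (?k1 (fst z - snd z) * norm (F (fst z))) \<partial>?P)"
    using c1 c2 k by simp
  also have "\<dots> \<le> integral\<^sup>L ?P ?f"
  proof (rule integral_mono)
    fix z :: "('a \<times> 'a) \<times> ('a \<times> 'a)"
    obtain t t' where z: "z = (t, t')" by (cases z)
    have "inner (F t) (F t') = (norm (F t))\<^sup>2 - inner (F t) (F t - F t')"
      by (simp add: inner_diff_right power2_norm_eq_inner)
    moreover have "inner (F t) (F t - F t') \<le> norm (F t) * (L * norm (t - t'))"
      using norm_cauchy_schwarz[of "F t" "F t - F t'"] mult_left_mono[OF lip[of t t'] norm_ge_zero[of "F t"]] by linarith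
    ultimately have "(norm (F t))\<^sup>2 - L * norm (t - t') * norm (F t) \<le> inner (F t) (F t')"
      by (simp add: mult_ac)
    from mult_left_mono[OF this gkernel_nonneg[OF s, of "t - t'"]]
    show "gkernel s (fst z - snd z) * (norm (F (fst z)))\<^sup>2 - L * (?k1 (fst z - snd z) * norm (F (fst z))) \<le> ?f z"
      by (simp add: z algebra_simps)
  qed (use c1 c2 integrable_gaussian_qft_kernel[OF F s, folded gkernel_def] in auto)
  also have "\<dots> = (\<integral>w. exp (- (s * (norm w)\<^sup>2)) * (norm (qft F w))\<^sup>2 \<partial>lborel)"
    using gaussian_qft[OF F s, folded gkernel_def] by (simp add: has_bochner_integral_iff)
  finally show ?thesis .
qed

text \<open>The arithmetic-geometric mean inequality splits the inner product into two squares; the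
  kernel is symmetric, so each contributes half of its mass.\<close>

lemma gaussian_qft_upper:
  assumes s: "s > 0"
  shows "(\<integral>w. exp (- (s * (norm w)\<^sup>2)) * (norm (qft F w))\<^sup>2 \<partial>lborel) \<le> (2 * pi) ^ (2 * DIM('a)) * (\<integral>t. (norm (F t))\<^sup>2 \<partial>lborel)"
proof -
  let ?P = "lborel \<Otimes>\<^sub>M lborel :: (('a \<times> 'a) \<times> ('a \<times> 'a)) measure"
  let ?f = "\<lambda>z. gkernel s (fst z - snd z) * inner (F (fst z)) (F (snd z))"
  have k: "integrable lborel (gkernel s :: 'a \<times> 'a \<Rightarrow> real)" "(\<integral>\<tau>. gkernel s (\<tau> :: 'a \<times> 'a) \<partial>lborel) = (2 * pi) ^ (2 * DIM('a))"
    using has_bochner_integral_gkernel[OF s] by (auto simp: has_bochner_integral_iff)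
  note c1 = has_bochner_integral_convolution[OF k(1) F2, unfolded has_bochner_integral_iff]
  note c2 = has_bochner_integral_convolution'[OF k(1) F2, unfolded has_bochner_integral_iff]
  have "(\<integral>w. exp (- (s * (norm w)\<^sup>2)) * (norm (qft F w))\<^sup>2 \<partial>lborel) = integral\<^sup>L ?P ?f"
    using gaussian_qft[OF F s, folded gkernel_def] by (simp add: has_bochner_integral_iff)
  also have "\<dots> \<le> (\<integral>z. (gkernel s (fst z - snd z) * (norm (F (fst z)))\<^sup>2 + gkernel s (snd z - fst z) * (norm (F (snd z)))\<^sup>2) / 2 \<partial>?P)"
  proof (rule integral_mono)
    fix z :: "('a \<times> 'a) \<times> ('a \<times> 'a)"
    obtain t t' where z: "z = (t, t')" by (cases z)
    have "inner (F t) (F t') \<le> norm (F t) * norm (F t')" by (rule norm_cauchy_schwarz)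
    also have "\<dots> \<le> ((norm (F t))\<^sup>2 + (norm (F t'))\<^sup>2) / 2"
      using sum_squares_bound[of "norm (F t)" "norm (F t')"] by simp
    finally have "?f z \<le> gkernel s (t - t') * (((norm (F t))\<^sup>2 + (norm (F t'))\<^sup>2) / 2)"
      unfolding z fst_conv snd_conv by (rule mult_left_mono) (rule gkernel_nonneg[OF s])
    then show "?f z \<le> (gkernel s (fst z - snd z) * (norm (F (fst z)))\<^sup>2 + gkernel s (snd z - fst z) * (norm (F (snd z)))\<^sup>2) / 2"
      by (simp add: z gkernel_minus[of s t' t] algebra_simps add_divide_distrib)
  qed (use c1 c2 integrable_gaussian_qft_kernel[OF F s, folded gkernel_def] in auto)
  also have "\<dots> = (2 * pi) ^ (2 * DIM('a)) * (\<integral>t. (norm (F t))\<^sup>2 \<partial>lborel)"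
    using c1 c2 k by simp
  finally show ?thesis .
qed

text \<open>On the transform side the limit is taken by monotone convergence, which presupposes no
  integrability of the squared transform. The other side is squeezed between the lower and the upper
  Gaussian bound.\<close>

lemma plancherel_qft:
  "(\<integral>\<^sup>+w. ennreal ((norm (qft F w))\<^sup>2) \<partial>lborel) = ennreal ((2 * pi) ^ (2 * DIM('a)) * (\<integral>t. (norm (F t))\<^sup>2 \<partial>lborel))"
proof -
  have [measurable]: "F \<in> borel_measurable borel"
    using borel_measurable_integrable[OF F] by simp
  let ?s = "\<lambda>k. inverse (real (Suc k))"
  let ?h = "\<lambda>k w. exp (- (?s k * (norm w)\<^sup>2)) * (norm (qft F w))\<^sup>2"
  let ?T = "(2 * pi) ^ (2 * DIM('a)) * (\<integral>t. (norm (F t))\<^sup>2 \<partial>lborel)"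
  have s: "?s k > 0" for k by simp
  have "(\<lambda>k. \<integral>\<^sup>+w. ennreal (?h k w) \<partial>lborel) \<longlonglongrightarrow> (\<integral>\<^sup>+w. ennreal ((norm (qft F w))\<^sup>2) \<partial>lborel)"
  proof (rule nn_integral_LIMSEQ)
    show "incseq (\<lambda>k w. ennreal (?h k w))"
      by (intro incseq_SucI le_funI ennreal_leI mult_right_mono) (auto intro!: mult_right_mono simp: field_simps)
    have "(\<lambda>k. ?h k w) \<longlonglongrightarrow> exp (- (0 * (norm w)\<^sup>2)) * (norm (qft F w))\<^sup>2" for w
      by (intro tendsto_intros LIMSEQ_inverse_real_of_nat)
    then show "(\<lambda>k. ennreal (?h k w)) \<longlonglongrightarrow> ennreal ((norm (qft F w))\<^sup>2)" for w
      by (intro tendsto_ennrealI) simp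
  qed auto
  moreover have "(\<integral>\<^sup>+w. ennreal (?h k w) \<partial>lborel) = ennreal (\<integral>w. ?h k w \<partial>lborel)" for k
    using gaussian_qft[OF F s] by (intro nn_integral_eq_integral) (auto simp: has_bochner_integral_iff)
  moreover have "(\<lambda>k. ennreal (\<integral>w. ?h k w \<partial>lborel)) \<longlonglongrightarrow> ennreal ?T"
  proof (rule tendsto_ennrealI, rule tendsto_sandwich[OF _ _ _ tendsto_const])
    show "\<forall>\<^sub>F k in sequentially. ?T - L * moment_const TYPE('a) * sqrt (?s k) * (\<integral>t. norm (F t) \<partial>lborel) \<le> (\<integral>w. ?h k w \<partial>lborel)"
      by (intro always_eventually allI gaussian_qft_lower s)
    show "\<forall>\<^sub>F k in sequentially. (\<integral>w. ?h k w \<partial>lborel) \<le> ?T"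
      by (intro always_eventually allI gaussian_qft_upper s)
    have "(\<lambda>k. ?T - L * moment_const TYPE('a) * sqrt (?s k) * (\<integral>t. norm (F t) \<partial>lborel)) \<longlonglongrightarrow> ?T - L * moment_const TYPE('a) * sqrt 0 * (\<integral>t. norm (F t) \<partial>lborel)"
      by (intro tendsto_intros LIMSEQ_inverse_real_of_nat)
    then show "(\<lambda>k. ?T - L * moment_const TYPE('a) * sqrt (?s k) * (\<integral>t. norm (F t) \<partial>lborel)) \<longlonglongrightarrow> ?T" by simp
  qed
  ultimately show ?thesis
    by (simp only:) (rule LIMSEQ_unique)
qed

lemma integrable_qft_sq: "integrable lborel (\<lambda>w. (norm (qft F w))\<^sup>2)"
    and integral_qft_sq: "(\<integral>w. (norm (qft F w))\<^sup>2 \<partial>lborel) = (2 * pi) ^ (2 * DIM('a)) * (\<integral>t. (norm (F t))\<^sup>2 \<partial>lborel)"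
proof -
  have [measurable]: "F \<in> borel_measurable borel"
    using borel_measurable_integrable[OF F] by simp
  have "has_bochner_integral lborel (\<lambda>w. (norm (qft F w))\<^sup>2) ((2 * pi) ^ (2 * DIM('a)) * (\<integral>t. (norm (F t))\<^sup>2 \<partial>lborel))"
    by (rule has_bochner_integral_nn_integral) (auto simp: plancherel_qft)
  then show "integrable lborel (\<lambda>w. (norm (qft F w))\<^sup>2)"
    "(\<integral>w. (norm (qft F w))\<^sup>2 \<partial>lborel) = (2 * pi) ^ (2 * DIM('a)) * (\<integral>t. (norm (F t))\<^sup>2 \<partial>lborel)"
    by (auto simp: has_bochner_integral_iff)
qed

text \<open>Subtracting the lower Gaussian bound from Plancherel's formula cancels the main terms
  and leaves the Lipschitz error alone.\<close>

lemma qft_tail: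
  assumes s: "s > 0"
  shows "(\<integral>\<^sup>+w. ennreal ((1 - exp (- (s * (norm w)\<^sup>2))) * (norm (qft F w))\<^sup>2) \<partial>lborel)
    \<le> ennreal (L * moment_const TYPE('a) * sqrt s * (\<integral>t. norm (F t) \<partial>lborel))"
proof -
  note g = gaussian_qft[OF F s, THEN integrable.intros]
  have eq: "(1 - exp (- (s * (norm w)\<^sup>2))) * (norm (qft F w))\<^sup>2 = (norm (qft F w))\<^sup>2 - exp (- (s * (norm w)\<^sup>2)) * (norm (qft F w))\<^sup>2" for w
    by (simp add: algebra_simps)
  have int: "integrable lborel (\<lambda>w. (1 - exp (- (s * (norm w)\<^sup>2))) * (norm (qft F w))\<^sup>2)"
    unfolding eq using g integrable_qft_sq by (intro Bochner_Integration.integrable_diff)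
  have "(\<integral>\<^sup>+w. ennreal ((1 - exp (- (s * (norm w)\<^sup>2))) * (norm (qft F w))\<^sup>2) \<partial>lborel)
    = ennreal (\<integral>w. (1 - exp (- (s * (norm w)\<^sup>2))) * (norm (qft F w))\<^sup>2 \<partial>lborel)"
    using s by (intro nn_integral_eq_integral int) auto
  also have "(\<integral>w. (1 - exp (- (s * (norm w)\<^sup>2))) * (norm (qft F w))\<^sup>2 \<partial>lborel)
     = (\<integral>w. (norm (qft F w))\<^sup>2 \<partial>lborel) - (\<integral>w. exp (- (s * (norm w)\<^sup>2)) * (norm (qft F w))\<^sup>2 \<partial>lborel)"
    unfolding eq using g integrable_qft_sq by (intro Bochner_Integration.integral_diff)
  finally show ?thesis
    using gaussian_qft_lower[OF s] by (auto simp: integral_qft_sq intro!: ennreal_leI)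
qed

text \<open>For \<open>s = exp (- 2 * k)\<close> the tail bounds form a geometric series of ratio
  \<open>exp (- 1)\<close>, since each carries a factor \<open>sqrt s\<close>. The result is linear
  in the integral of \<open>norm (F t)\<close>, which later allows integration over a family of
  functions sharing one \<open>L\<close>.\<close>

lemma qft_log_tail:
  "(\<integral>\<^sup>+w. ennreal (max 0 (ln (norm w)) * (norm (qft F w))\<^sup>2) \<partial>lborel)
    \<le> ennreal (2 * L * moment_const TYPE('a) / (1 - exp (- 1)) * (\<integral>t. norm (F t) \<partial>lborel))"
proof -
  have [measurable]: "F \<in> borel_measurable borel"
    using borel_measurable_integrable[OF F] by simp
  let ?s = "\<lambda>k. exp (- 2 * real k)"
  let ?c = "L * moment_const TYPE('a) * (\<integral>t. norm (F t) \<partial>lborel)"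
  have c: "?c \<ge> 0" using lipschitz_const_nonneg by (simp add: moment_const_def)
  have sq: "sqrt (?s k) = exp (- 1) ^ k" for k
  proof (rule real_sqrt_unique)
    show "(exp (- 1) ^ k)\<^sup>2 = exp (- 2 * real k)"
      by (simp add: power_mult[symmetric] exp_of_nat_mult[symmetric])
  qed auto
  have e: "exp (- 1) < (1::real)" by simp
  have "(\<integral>\<^sup>+w. ennreal (max 0 (ln (norm w)) * (norm (qft F w))\<^sup>2) \<partial>lborel) 
    \<le> (\<integral>\<^sup>+w. 2 * (\<Sum>k. ennreal ((1 - exp (- (?s k * (norm w)\<^sup>2))) * (norm (qft F w))\<^sup>2)) \<partial>lborel)"
    by (intro nn_integral_mono suminf_exp_bound_ln) auto
  also have "\<dots> = 2 * (\<Sum>k. \<integral>\<^sup>+w. ennreal ((1 - exp (- (?s k * (norm w)\<^sup>2))) * (norm (qft F w))\<^sup>2) \<partial>lborel)"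
    by (simp add: nn_integral_cmult nn_integral_suminf)
  also have "\<dots> \<le> 2 * (\<Sum>k. ennreal (?c * exp (- 1) ^ k))"
  proof (intro mult_left_mono suminf_le summableI)
    fix k
    show "(\<integral>\<^sup>+w. ennreal ((1 - exp (- (?s k * (norm w)\<^sup>2))) * (norm (qft F w))\<^sup>2) \<partial>lborel) \<le> ennreal (?c * exp (- 1) ^ k)"
      using qft_tail[of "?s k"] unfolding sq by (simp add: mult_ac)
  qed auto
  also have "(\<Sum>k. ennreal (?c * exp (- 1) ^ k)) = ennreal (\<Sum>k. ?c * exp (- 1) ^ k)"
    using e by (intro suminf_ennreal2 mult_nonneg_nonneg[OF c] summable_mult summable_geometric) auto
  also have "(\<Sum>k. ?c * exp (- 1) ^ k) = ?c / (1 - exp (- 1))"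
    using e by (subst suminf_mult) (auto intro: summable_geometric simp: suminf_geometric)
  also have "2 * ennreal (?c / (1 - exp (- 1))) = ennreal (2 * (?c / (1 - exp (- 1))))"
    by (subst ennreal_mult') simp_all
  finally show ?thesis by (simp add: mult_ac)
qed

end

section \<open>Gaussian kernels averaged against powers of the norm\<close>

lemma power2_powr:
  fixes x p :: real
  assumes "x \<ge> 0"
  shows "(x\<^sup>2) powr p = x powr (2 * p)"
  using assms by (cases "x = 0") (simp_all add: powr_def ln_realpow)

text \<open>The substitution \<open>s = \<sigma> / l\<close> frees the denominators
  \<open>1 + l * s\<close> from \<open>l\<close>. The integral over \<open>l\<close> is then a Gamma
  integral with exponent \<open>m - a\<close>, and the one over \<open>\<sigma>\<close> a Beta
  integral with parameters \<open>a\<close> and \<open>m\<close>.\<close>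

lemma nn_integral_power_gamma_kernel:
  fixes a m \<rho> :: real
  assumes "0 < a" "a < m" "\<rho> > 0"
  shows "(\<integral>\<^sup>+s\<in>{0<..}. (\<integral>\<^sup>+l\<in>{0<..}. ennreal (s powr (a - 1) * l powr (m - 1) * (1 + l * s) powr (- (2 * m)) * exp (- (l * \<rho> / (1 + l * s)))) \<partial>lborel) \<partial>lborel)
    = ennreal (Gamma (m - a) * (Gamma a * Gamma m / Gamma (a + m)) * \<rho> powr (a - m))"
proof -
  let ?I = "\<lambda>x. indicator {0<..} x :: ennreal"
  let ?h = "\<lambda>s l. s powr (a - 1) * l powr (m - 1) * (1 + l * s) powr (- (2 * m)) * exp (- (l * \<rho> / (1 + l * s)))"
  let ?k = "\<lambda>\<sigma> l. \<sigma> powr (a - 1) * l powr (m - a - 1) * (1 + \<sigma>) powr (- (2 * m)) * exp (- (l * \<rho> / (1 + \<sigma>)))"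
  have "(\<integral>\<^sup>+s\<in>{0<..}. (\<integral>\<^sup>+l\<in>{0<..}. ennreal (?h s l) \<partial>lborel) \<partial>lborel)
     = (\<integral>\<^sup>+s. (\<integral>\<^sup>+l. ennreal (?h s l) * ?I l * ?I s \<partial>lborel) \<partial>lborel)"
    by (simp add: nn_integral_multc)
  also have "\<dots> = (\<integral>\<^sup>+l. (\<integral>\<^sup>+s. ennreal (?h s l) * ?I l * ?I s \<partial>lborel) \<partial>lborel)"
    by (rule lborel_pair.Fubini') measurable
  also have "\<dots> = (\<integral>\<^sup>+l. (\<integral>\<^sup>+\<sigma>. ennreal (?k \<sigma> l) * ?I l * ?I \<sigma> \<partial>lborel) \<partial>lborel)"
  proof (rule nn_integral_cong)
    fix l :: real
    show "(\<integral>\<^sup>+s. ennreal (?h s l) * ?I l * ?I s \<partial>lborel) = (\<integral>\<^sup>+\<sigma>. ennreal (?k \<sigma> l) * ?I l * ?I \<sigma> \<partial>lborel)"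
    proof (cases "l > 0")
      case True
      have "(\<integral>\<^sup>+s. ennreal (?h s l) * ?I l * ?I s \<partial>lborel) = ennreal (inverse l) * (\<integral>\<^sup>+\<sigma>. ennreal (?h (inverse l * \<sigma>) l) * ?I l * ?I (inverse l * \<sigma>) \<partial>lborel)"
        using nn_integral_lborel_affine[of "\<lambda>s. ennreal (?h s l) * ?I l * ?I s" "inverse l" 0] True by simp
      also have "\<dots> = (\<integral>\<^sup>+\<sigma>. ennreal (inverse l) * (ennreal (?h (inverse l * \<sigma>) l) * ?I l * ?I (inverse l * \<sigma>)) \<partial>lborel)"
        by (rule nn_integral_cmult[symmetric]) measurable
      also have "\<dots> = (\<integral>\<^sup>+\<sigma>. ennreal (?k \<sigma> l) * ?I l * ?I \<sigma> \<partial>lborel)"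
      proof (rule nn_integral_cong)
        fix \<sigma> :: real
        have "inverse l * ?h (inverse l * \<sigma>) l = ?k \<sigma> l" if "\<sigma> > 0"
        proof -
          have "inverse l * ((inverse l * \<sigma>) powr (a - 1) * l powr (m - 1)) = \<sigma> powr (a - 1) * l powr (m - a - 1)"
          proof -
            have i: "inverse l = l powr (- 1)" "inverse l powr (a - 1) = l powr (1 - a)"
              using True by (simp add: powr_minus) (simp add: powr_def ln_inverse algebra_simps)
            have "l powr (- 1) * (l powr (1 - a) * l powr (m - 1)) = l powr (m - a - 1)"
              by (simp only: powr_add[symmetric], rule arg_cong[where f = "(powr) l"], simp)
            then show ?thesis
              using that True by (simp add: powr_mult i(2)) (simp add: i(1) mult_ac)
          qed
          then show ?thesis using True by (simp add: mult.assoc[symmetric])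
        qed
        moreover have "?I (inverse l * \<sigma>) = ?I \<sigma>" using True by (simp add: indicator_def zero_less_mult_iff)
        ultimately show "ennreal (inverse l) * (ennreal (?h (inverse l * \<sigma>) l) * ?I l * ?I (inverse l * \<sigma>)) = ennreal (?k \<sigma> l) * ?I l * ?I \<sigma>"
          using True by (cases "\<sigma> > 0") (auto simp: ennreal_mult'[symmetric])
      qed
      finally show ?thesis .
    qed simp
  qed
  also have "\<dots> = (\<integral>\<^sup>+\<sigma>. (\<integral>\<^sup>+l. ennreal (?k \<sigma> l) * ?I l * ?I \<sigma> \<partial>lborel) \<partial>lborel)"
    by (rule lborel_pair.Fubini') measurable
  also have "\<dots> = (\<integral>\<^sup>+\<sigma>. ennreal (Gamma (m - a) * \<rho> powr (a - m)) * (ennreal (\<sigma> powr (a - 1) * (1 + \<sigma>) powr (- (a + m))) * ?I \<sigma>) \<partial>lborel)"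
  proof (rule nn_integral_cong)
    fix \<sigma> :: real
    show "(\<integral>\<^sup>+l. ennreal (?k \<sigma> l) * ?I l * ?I \<sigma> \<partial>lborel) = ennreal (Gamma (m - a) * \<rho> powr (a - m)) * (ennreal (\<sigma> powr (a - 1) * (1 + \<sigma>) powr (- (a + m))) * ?I \<sigma>)"
    proof (cases "\<sigma> > 0")
      case True
      have "(\<integral>\<^sup>+l. ennreal (?k \<sigma> l) * ?I l * ?I \<sigma> \<partial>lborel) 
        = (\<integral>\<^sup>+l. ennreal (\<sigma> powr (a - 1) * (1 + \<sigma>) powr (- (2 * m))) * (ennreal (l powr (m - a - 1) * exp (- (\<rho> / (1 + \<sigma>) * l))) * ?I l) \<partial>lborel)"
        using True by (intro nn_integral_cong) (auto simp: indicator_def ennreal_mult'[symmetric] mult_ac)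
      also have "\<dots> = ennreal (\<sigma> powr (a - 1) * (1 + \<sigma>) powr (- (2 * m))) * ennreal (Gamma (m - a) * (\<rho> / (1 + \<sigma>)) powr (- (m - a)))"
        using True assms by (subst nn_integral_cmult, measurable) (subst nn_integral_Gamma, auto)
      also have "\<dots> = ennreal ((\<sigma> powr (a - 1) * (1 + \<sigma>) powr (- (2 * m))) * (Gamma (m - a) * (\<rho> / (1 + \<sigma>)) powr (- (m - a))))"
        by (rule ennreal_mult'[symmetric]) simp
      also have "(\<sigma> powr (a - 1) * (1 + \<sigma>) powr (- (2 * m))) * (Gamma (m - a) * (\<rho> / (1 + \<sigma>)) powr (- (m - a)))
         = (Gamma (m - a) * \<rho> powr (a - m)) * (\<sigma> powr (a - 1) * (1 + \<sigma>) powr (- (a + m)))"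
      proof -
        have "(\<rho> / (1 + \<sigma>)) powr (- (m - a)) = \<rho> powr (a - m) * (1 + \<sigma>) powr (m - a)"
          using True assms by (simp add: powr_divide powr_minus_divide[of _ "m - a", symmetric] powr_diff field_simps)
        moreover have "(1 + \<sigma>) powr (- (2 * m)) * (1 + \<sigma>) powr (m - a) = (1 + \<sigma>) powr (- (a + m))"
          by (simp only: powr_add[symmetric], rule arg_cong[where f = "(powr) (1 + \<sigma>)"], simp)
        ultimately show ?thesis by (simp add: mult_ac) 
      qed
      also have "ennreal \<dots> = ennreal (Gamma (m - a) * \<rho> powr (a - m)) * ennreal (\<sigma> powr (a - 1) * (1 + \<sigma>) powr (- (a + m)))"
        using assms by (intro ennreal_mult') (simp add: Gamma_real_pos less_imp_le)
      finally show ?thesis using True by simp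
    qed simp
  qed
  also have "\<dots> = ennreal (Gamma (m - a) * \<rho> powr (a - m)) * ennreal (Gamma a * Gamma m / Gamma (a + m))"
    using assms by (subst nn_integral_cmult, measurable) (subst nn_integral_beta_halfline, auto)
  also have "\<dots> = ennreal ((Gamma (m - a) * \<rho> powr (a - m)) * (Gamma a * Gamma m / Gamma (a + m)))"
    using assms by (intro ennreal_mult'[symmetric]) (simp add: Gamma_real_pos less_imp_le)
  finally show ?thesis by (simp add: mult_ac)
qed

lemma nn_integral_heat_gaussian:
  fixes u :: "('a::euclidean_space) \<times> 'a"
  assumes "s > 0" "l > 0"
  shows "(\<integral>\<^sup>+y. ennreal (gkernel s (2 *\<^sub>R (u - y)) * exp (- (l * (norm y)\<^sup>2))) \<partial>lborel)
    = ennreal (pi ^ (2 * DIM('a)) * (1 + l * s) powr (- real DIM('a)) * exp (- (l * (norm u)\<^sup>2 / (1 + l * s))))"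
proof -
  \<comment> \<open>Completing the square: \<open>v\<close> minimises
    \<open>norm (u - y) ^ 2 / s + l * norm y ^ 2\<close> over \<open>y\<close>, with minimum
    \<open>l * norm u ^ 2 / (1 + l * s)\<close>, and \<open>c\<close> is the coefficient of the
    remaining square. The factor 2 inside the kernel turns its \<open>4 * s\<close> into
    \<open>s\<close>.\<close>
  define c where "c = 1 / s + l"
  define v where "v = (1 / (1 + l * s)) *\<^sub>R u"
  have pos: "c > 0" "1 + l * s > 0" using assms by (auto simp: c_def intro: add_pos_pos)
  let ?C = "(pi / s) ^ DIM('a) * exp (- (l * (norm u)\<^sup>2 / (1 + l * s)))"
  have eq: "gkernel s (2 *\<^sub>R (u - (v + x))) * exp (- (l * (norm (v + x))\<^sup>2)) = ?C * exp (- (c * (norm x)\<^sup>2))" for x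
  proof -
    have "(norm (u - (v + x)))\<^sup>2 / s + l * (norm (v + x))\<^sup>2 = l * (norm u)\<^sup>2 / (1 + l * s) + c * (norm x)\<^sup>2"
    proof -
      define U where "U = inner u u" define X where "X = inner x x" define Y where "Y = inner u x"
      define b where "b = 1 / (1 + l * s)"
      have b: "b * (1 + l * s) = 1" using pos by (simp add: b_def)
      have e1: "(norm (u - (v + x)))\<^sup>2 = U + b\<^sup>2 * U + X - 2 * b * U - 2 * Y + 2 * b * Y"
        unfolding power2_norm_eq_inner v_def b_def[symmetric] U_def X_def Y_def
        by (simp add: inner_diff_left inner_diff_right inner_add_left inner_add_right inner_commute algebra_simps power2_eq_square)
      have e2: "(norm (v + x))\<^sup>2 = b\<^sup>2 * U + X + 2 * b * Y"
        unfolding power2_norm_eq_inner v_def b_def[symmetric] U_def X_def Y_def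
        by (simp add: inner_diff_left inner_diff_right inner_add_left inner_add_right inner_commute algebra_simps power2_eq_square)
      have e3: "(norm u)\<^sup>2 = U" "(norm x)\<^sup>2 = X" by (simp_all add: power2_norm_eq_inner U_def X_def)
      have "U + b\<^sup>2 * U + X - 2 * b * U - 2 * Y + 2 * b * Y + l * s * (b\<^sup>2 * U + X + 2 * b * Y) = l * s * U * b + (1 + l * s) * X"
        using b by algebra
      then have "s * (((U + b\<^sup>2 * U + X - 2 * b * U - 2 * Y + 2 * b * Y) / s + l * (b\<^sup>2 * U + X + 2 * b * Y))) = s * (l * U * b + (1 / s + l) * X)"
      proof -
        assume H: "U + b\<^sup>2 * U + X - 2 * b * U - 2 * Y + 2 * b * Y + l * s * (b\<^sup>2 * U + X + 2 * b * Y) = l * s * U * b + (1 + l * s) * X"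
        have "s * (P / s + l * Q) = P + l * s * Q" for P Q
          using assms by (simp add: field_simps)
        from trans[OF this H] show ?thesis using assms by (simp add: field_simps)
      qed
      then show ?thesis
        using assms unfolding e1 e2 e3 c_def by (simp add: b_def)
    qed
    moreover have "(norm (2 *\<^sub>R (u - (v + x))))\<^sup>2 / (4 * s) = (norm (u - (v + x)))\<^sup>2 / s"
      by (simp add: power_mult_distrib)
    ultimately show ?thesis
      by (simp add: gkernel_def mult_exp_exp minus_divide_left[symmetric] mult.assoc)
  qed
  have "(\<integral>\<^sup>+y. ennreal (gkernel s (2 *\<^sub>R (u - y)) * exp (- (l * (norm y)\<^sup>2))) \<partial>lborel)
     = (\<integral>\<^sup>+x. ennreal (gkernel s (2 *\<^sub>R (u - (v + x))) * exp (- (l * (norm (v + x))\<^sup>2))) \<partial>lborel)"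
    by (rule nn_integral_lborel_shift[symmetric]) measurable
  also have "\<dots> = (\<integral>\<^sup>+x. ennreal ?C * ennreal (exp (- (c * (norm (x::'a\<times>'a))\<^sup>2))) \<partial>lborel)"
    unfolding eq using assms by (simp add: ennreal_mult)
  also have "\<dots> = ennreal ?C * ennreal ((pi / c) powr (DIM('a \<times> 'a) / 2))"
    by (subst nn_integral_cmult) (simp_all add: nn_integral_gaussian[OF pos(1)])
  also have "\<dots> = ennreal (?C * (pi / c) powr (DIM('a \<times> 'a) / 2))"
    using assms by (intro ennreal_mult'[symmetric]) simp
  also have "?C * (pi / c) powr (DIM('a \<times> 'a) / 2) = pi ^ (2 * DIM('a)) * (1 + l * s) powr (- real DIM('a)) * exp (- (l * (norm u)\<^sup>2 / (1 + l * s)))"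
  proof -
    have "(pi / s) ^ DIM('a) * (pi / c) powr (DIM('a \<times> 'a) / 2) = ((pi / s) * (pi / c)) ^ DIM('a)"
      using pos assms by (simp add: powr_realpow power_mult_distrib power_divide)
    also have "(pi / s) * (pi / c) = pi\<^sup>2 * inverse (1 + l * s)"
      using assms pos by (simp add: c_def field_simps power2_eq_square)
    also have "\<dots> ^ DIM('a) = pi ^ (2 * DIM('a)) * (1 + l * s) powr (- real DIM('a))"
      using pos by (simp add: power_mult_distrib power_mult[symmetric] powr_minus powr_realpow power_inverse)
    finally show ?thesis by (simp add: mult_ac)
  qed
  finally show ?thesis .
qed

text \<open>Averaging the kernel over \<open>s\<close> yields a Riesz kernel; the power \<open>|y| powr (- DIM('a))\<close> (half the critical
  exponent) is written as a mixture of Gaussians, which makes the composition explicit.\<close>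

lemma nn_integral_heat_power:
  fixes u :: "('a::euclidean_space) \<times> 'a" and a :: real
  assumes "0 < a" "a < DIM('a) / 2" "u \<noteq> 0"
  shows "(\<integral>\<^sup>+s\<in>{0<..}. ennreal (s powr (a - 1)) * (\<integral>\<^sup>+y. ennreal (gkernel s (2 *\<^sub>R (u - y)) * norm y powr (- real DIM('a))) \<partial>lborel) \<partial>lborel)
    = ennreal (pi ^ (2 * DIM('a)) * Gamma a * (Gamma (DIM('a) / 2 - a) / Gamma (DIM('a) / 2 + a)) * norm u powr (2 * a - DIM('a)))"
proof -
  define m where "m = DIM('a) / 2"
  have m: "0 < m" "a < m" "real DIM('a) = 2 * m" using assms by (auto simp: m_def)
  have Gm: "Gamma m > 0" using m by (simp add: Gamma_real_pos)
  let ?I = "\<lambda>x. indicator {0<..} x :: ennreal"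
  let ?h = "\<lambda>s l. s powr (a - 1) * l powr (m - 1) * (1 + l * s) powr (- (2 * m)) * exp (- (l * (norm u)\<^sup>2 / (1 + l * s)))"
  have y: "ennreal (gkernel s (2 *\<^sub>R (u - y)) * norm y powr (- real DIM('a))) = 
      ennreal (1 / Gamma m) * (\<integral>\<^sup>+l. ennreal (gkernel s (2 *\<^sub>R (u - y)) * exp (- (l * (norm y)\<^sup>2))) * (ennreal (l powr (m - 1)) * ?I l) \<partial>lborel)"
    if "s > 0" "y \<noteq> 0" for s and y :: "'a \<times> 'a"
  proof -
    have "(\<integral>\<^sup>+l. ennreal (gkernel s (2 *\<^sub>R (u - y)) * exp (- (l * (norm y)\<^sup>2))) * (ennreal (l powr (m - 1)) * ?I l) \<partial>lborel)
      = (\<integral>\<^sup>+l. ennreal (gkernel s (2 *\<^sub>R (u - y))) * (ennreal (l powr (m - 1) * exp (- ((norm y)\<^sup>2 * l))) * ?I l) \<partial>lborel)"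
      by (intro nn_integral_cong) (simp add: ennreal_mult gkernel_nonneg that mult_ac)
    also have "\<dots> = ennreal (gkernel s (2 *\<^sub>R (u - y))) * ennreal (Gamma m * ((norm y)\<^sup>2) powr (- m))"
    proof (subst nn_integral_cmult)
      have "(\<integral>\<^sup>+l\<in>{0<..}. ennreal (l powr (m - 1) * exp (- ((norm y)\<^sup>2 * l))) \<partial>lborel) = ennreal (Gamma m * ((norm y)\<^sup>2) powr (- m))"
        by (rule nn_integral_Gamma) (simp_all add: that m)
      then show "ennreal (gkernel s (2 *\<^sub>R (u - y))) * (\<integral>\<^sup>+l\<in>{0<..}. ennreal (l powr (m - 1) * exp (- ((norm y)\<^sup>2 * l))) \<partial>lborel)
        = ennreal (gkernel s (2 *\<^sub>R (u - y))) * ennreal (Gamma m * ((norm y)\<^sup>2) powr (- m))" by (simp only:)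
    qed measurable
    also have "((norm y)\<^sup>2) powr (- m) = norm y powr (- real DIM('a))"
      by (simp add: power2_powr m(3))
    also have "ennreal (1 / Gamma m) * (ennreal (gkernel s (2 *\<^sub>R (u - y))) * ennreal (Gamma m * norm y powr (- real DIM('a))))
       = ennreal (gkernel s (2 *\<^sub>R (u - y)) * norm y powr (- real DIM('a)))"
      using Gm by (simp add: ennreal_mult[symmetric] gkernel_nonneg that)
    finally show ?thesis ..
  qed
  have "(\<integral>\<^sup>+s\<in>{0<..}. ennreal (s powr (a - 1)) * (\<integral>\<^sup>+y. ennreal (gkernel s (2 *\<^sub>R (u - y)) * norm y powr (- real DIM('a))) \<partial>lborel) \<partial>lborel)
     = (\<integral>\<^sup>+s. ennreal (pi ^ (2 * DIM('a)) / Gamma m) * ((\<integral>\<^sup>+l\<in>{0<..}. ennreal (?h s l) \<partial>lborel) * ?I s) \<partial>lborel)"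
  proof (rule nn_integral_cong)
    fix s :: real
    show "ennreal (s powr (a - 1)) * (\<integral>\<^sup>+y. ennreal (gkernel s (2 *\<^sub>R (u - y)) * norm y powr (- real DIM('a))) \<partial>lborel) * ?I s
       = ennreal (pi ^ (2 * DIM('a)) / Gamma m) * ((\<integral>\<^sup>+l\<in>{0<..}. ennreal (?h s l) \<partial>lborel) * ?I s)"
    proof (cases "s > 0")
      case True
      have "(\<integral>\<^sup>+y. ennreal (gkernel s (2 *\<^sub>R (u - y)) * norm y powr (- real DIM('a))) \<partial>lborel)
        = (\<integral>\<^sup>+y. ennreal (1 / Gamma m) * (\<integral>\<^sup>+l. ennreal (gkernel s (2 *\<^sub>R (u - y)) * exp (- (l * (norm y)\<^sup>2))) * (ennreal (l powr (m - 1)) * ?I l) \<partial>lborel) \<partial>lborel)"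
        \<comment> \<open>At \<open>y = 0\<close> the two sides differ: \<open>0 powr x\<close> is 0
          by convention, whereas the Gamma integral on the right diverges.\<close>
        using AE_lborel_singleton[of "0::'a\<times>'a"] by (intro nn_integral_cong_AE, eventually_elim) (rule y[OF True])
      also have "\<dots> = ennreal (1 / Gamma m) * (\<integral>\<^sup>+y. (\<integral>\<^sup>+l. ennreal (gkernel s (2 *\<^sub>R (u - y)) * exp (- (l * (norm y)\<^sup>2))) * (ennreal (l powr (m - 1)) * ?I l) \<partial>lborel) \<partial>lborel)"
        by (rule nn_integral_cmult) measurable
      also have "(\<integral>\<^sup>+y. (\<integral>\<^sup>+l. ennreal (gkernel s (2 *\<^sub>R (u - y)) * exp (- (l * (norm y)\<^sup>2))) * (ennreal (l powr (m - 1)) * ?I l) \<partial>lborel) \<partial>lborel)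
         = (\<integral>\<^sup>+l. (\<integral>\<^sup>+y. ennreal (gkernel s (2 *\<^sub>R (u - y)) * exp (- (l * (norm y)\<^sup>2))) * (ennreal (l powr (m - 1)) * ?I l) \<partial>lborel) \<partial>lborel)"
        by (rule lborel_pair.Fubini') measurable
      also have "\<dots> = (\<integral>\<^sup>+l. ennreal (pi ^ (2 * DIM('a)) * (1 + l * s) powr (- real DIM('a)) * exp (- (l * (norm u)\<^sup>2 / (1 + l * s)))) * (ennreal (l powr (m - 1)) * ?I l) \<partial>lborel)"
      proof (rule nn_integral_cong)
        fix l :: real
        show "(\<integral>\<^sup>+y. ennreal (gkernel s (2 *\<^sub>R (u - y)) * exp (- (l * (norm y)\<^sup>2))) * (ennreal (l powr (m - 1)) * ?I l) \<partial>lborel)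
          = ennreal (pi ^ (2 * DIM('a)) * (1 + l * s) powr (- real DIM('a)) * exp (- (l * (norm u)\<^sup>2 / (1 + l * s)))) * (ennreal (l powr (m - 1)) * ?I l)"
          by (subst nn_integral_multc, measurable) (cases "l > 0"; simp add: nn_integral_heat_gaussian[OF True])
      qed
      finally have *: "(\<integral>\<^sup>+y. ennreal (gkernel s (2 *\<^sub>R (u - y)) * norm y powr (- real DIM('a))) \<partial>lborel)
        = ennreal (1 / Gamma m) * (\<integral>\<^sup>+l. ennreal (pi ^ (2 * DIM('a)) * (1 + l * s) powr (- real DIM('a)) * exp (- (l * (norm u)\<^sup>2 / (1 + l * s)))) * (ennreal (l powr (m - 1)) * ?I l) \<partial>lborel)" .
      have "ennreal (pi ^ (2 * DIM('a)) / Gamma m) * (\<integral>\<^sup>+l\<in>{0<..}. ennreal (?h s l) \<partial>lborel)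
        = ennreal (1 / Gamma m * s powr (a - 1)) * (ennreal (pi ^ (2 * DIM('a)) / s powr (a - 1)) * (\<integral>\<^sup>+l\<in>{0<..}. ennreal (?h s l) \<partial>lborel))"
        using True Gm by (subst mult.assoc[symmetric], subst ennreal_mult'[symmetric]) (auto simp: field_simps)
      also have "ennreal (pi ^ (2 * DIM('a)) / s powr (a - 1)) * (\<integral>\<^sup>+l\<in>{0<..}. ennreal (?h s l) \<partial>lborel)
        = (\<integral>\<^sup>+l. ennreal (pi ^ (2 * DIM('a)) / s powr (a - 1)) * (ennreal (?h s l) * ?I l) \<partial>lborel)"
        by (rule nn_integral_cmult[symmetric]) measurable
      also have "\<dots> = (\<integral>\<^sup>+l. ennreal (pi ^ (2 * DIM('a)) * (1 + l * s) powr (- real DIM('a)) * exp (- (l * (norm u)\<^sup>2 / (1 + l * s)))) * (ennreal (l powr (m - 1)) * ?I l) \<partial>lborel)"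
        using True m by (intro nn_integral_cong) (auto simp: indicator_def ennreal_mult'[symmetric] ennreal_mult''[symmetric])
      finally have **: "ennreal (pi ^ (2 * DIM('a)) / Gamma m) * (\<integral>\<^sup>+l\<in>{0<..}. ennreal (?h s l) \<partial>lborel) =
        ennreal (1 / Gamma m * s powr (a - 1)) * (\<integral>\<^sup>+l. ennreal (pi ^ (2 * DIM('a)) * (1 + l * s) powr (- real DIM('a)) * exp (- (l * (norm u)\<^sup>2 / (1 + l * s)))) * (ennreal (l powr (m - 1)) * ?I l) \<partial>lborel)" .
      have e: "ennreal (1 / Gamma m * s powr (a - 1)) = ennreal (1 / Gamma m) * ennreal (s powr (a - 1))"
        by (rule ennreal_mult'') simp
      have I: "?I s = 1" using True by simp
      show ?thesis
        unfolding * I mult_1_right ** e by (simp only: mult_ac)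
    qed simp
  qed
  also have "\<dots> = ennreal (pi ^ (2 * DIM('a)) / Gamma m) * (\<integral>\<^sup>+s\<in>{0<..}. (\<integral>\<^sup>+l\<in>{0<..}. ennreal (?h s l) \<partial>lborel) \<partial>lborel)"
    by (rule nn_integral_cmult) measurable
  also have "\<dots> = ennreal (pi ^ (2 * DIM('a)) / Gamma m) * ennreal (Gamma (m - a) * (Gamma a * Gamma m / Gamma (a + m)) * ((norm u)\<^sup>2) powr (a - m))"
    using assms m by (subst nn_integral_power_gamma_kernel) auto
  also have "\<dots> = ennreal (pi ^ (2 * DIM('a)) / Gamma m * (Gamma (m - a) * (Gamma a * Gamma m / Gamma (a + m)) * ((norm u)\<^sup>2) powr (a - m)))"
    using Gm by (intro ennreal_mult'[symmetric]) simp
  also have "((norm u)\<^sup>2) powr (a - m) = norm u powr (2 * a - DIM('a))"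
    by (simp add: power2_powr m(3) right_diff_distrib)
  also have "pi ^ (2 * DIM('a)) / Gamma m * (Gamma (m - a) * (Gamma a * Gamma m / Gamma (a + m)) * norm u powr (2 * a - DIM('a)))
     = pi ^ (2 * DIM('a)) * Gamma a * (Gamma (m - a) / Gamma (m + a)) * norm u powr (2 * a - DIM('a))"
    using Gm by (simp add: add.commute)
  finally show ?thesis unfolding m_def .
qed

section \<open>Pitt's inequality for the Wigner transform\<close>

lemma nn_integral_half_shift:
  fixes h :: "'a::euclidean_space \<Rightarrow> ennreal"
  assumes "h \<in> borel_measurable borel"
  shows "(\<integral>\<^sup>+t. h (x + t /\<^sub>R 2) \<partial>lborel) = ennreal (2 ^ DIM('a)) * (\<integral>\<^sup>+u. h u \<partial>lborel)"
proof -
  have "ennreal (2 ^ DIM('a)) * (\<integral>\<^sup>+u. h u \<partial>lborel) = ennreal (2 ^ DIM('a) * inverse 2 ^ DIM('a)) * (\<integral>\<^sup>+t. h (x + t /\<^sub>R 2) \<partial>lborel)"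
    using nn_integral_lborel_affine[OF assms, of "inverse 2" x] by (simp add: ennreal_mult mult.assoc)
  then show ?thesis by (simp flip: power_mult_distrib)
qed

lemma nn_integral_double_shift:
  fixes h :: "'a::euclidean_space \<Rightarrow> ennreal"
  assumes "h \<in> borel_measurable borel"
  shows "(\<integral>\<^sup>+x. h (2 *\<^sub>R x - u) \<partial>lborel) = ennreal (inverse 2 ^ DIM('a)) * (\<integral>\<^sup>+v. h v \<partial>lborel)"
proof -
  have "ennreal (inverse 2 ^ DIM('a)) * (\<integral>\<^sup>+v. h v \<partial>lborel) = ennreal (inverse 2 ^ DIM('a) * 2 ^ DIM('a)) * (\<integral>\<^sup>+x. h (2 *\<^sub>R x - u) \<partial>lborel)"
    using nn_integral_lborel_affine[OF assms, of 2 "- u"] by (simp add: ennreal_mult mult.assoc)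
  then show ?thesis by (simp flip: power_mult_distrib)
qed

text \<open>The map from \<open>(x, t)\<close> to \<open>(u, v) = (x + t / 2, x - t / 2)\<close>
  preserves volume. It is performed one variable at a time: passing from \<open>t\<close> to
  \<open>u\<close> costs a power of 2, and passing from \<open>x\<close> to
  \<open>v = 2 x - u\<close> returns it.\<close>

lemma nn_integral_wigner_shift:
  fixes h :: "'a::euclidean_space \<times> 'a \<Rightarrow> ennreal"
  assumes [measurable]: "h \<in> borel_measurable borel"
  shows "(\<integral>\<^sup>+x. (\<integral>\<^sup>+t. h (x + t /\<^sub>R 2, x - t /\<^sub>R 2) \<partial>lborel) \<partial>lborel) = (\<integral>\<^sup>+u. (\<integral>\<^sup>+v. h (u, v) \<partial>lborel) \<partial>lborel)"
proof -
  have "(\<integral>\<^sup>+t. h (x + t /\<^sub>R 2, x - t /\<^sub>R 2) \<partial>lborel) = ennreal (2 ^ DIM('a)) * (\<integral>\<^sup>+u. h (u, 2 *\<^sub>R x - u) \<partial>lborel)" for x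
  proof -
    have e: "2 *\<^sub>R x - (x + t /\<^sub>R 2) = x - t /\<^sub>R 2" for t
      by (simp add: scaleR_2)
    have "(\<integral>\<^sup>+t. h (x + t /\<^sub>R 2, 2 *\<^sub>R x - (x + t /\<^sub>R 2)) \<partial>lborel) = ennreal (2 ^ DIM('a)) * (\<integral>\<^sup>+u. h (u, 2 *\<^sub>R x - u) \<partial>lborel)"
      by (rule nn_integral_half_shift[of "\<lambda>u. h (u, 2 *\<^sub>R x - u)"]) measurable
    then show ?thesis by (simp only: e)
  qed
  then have "(\<integral>\<^sup>+x. (\<integral>\<^sup>+t. h (x + t /\<^sub>R 2, x - t /\<^sub>R 2) \<partial>lborel) \<partial>lborel) = ennreal (2 ^ DIM('a)) * (\<integral>\<^sup>+x. (\<integral>\<^sup>+u. h (u, 2 *\<^sub>R x - u) \<partial>lborel) \<partial>lborel)"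
    by (simp add: nn_integral_cmult)
  also have "(\<integral>\<^sup>+x. (\<integral>\<^sup>+u. h (u, 2 *\<^sub>R x - u) \<partial>lborel) \<partial>lborel) = (\<integral>\<^sup>+u. (\<integral>\<^sup>+x. h (u, 2 *\<^sub>R x - u) \<partial>lborel) \<partial>lborel)"
    by (rule lborel_pair.Fubini') measurable
  also have "\<dots> = (\<integral>\<^sup>+u. ennreal (inverse 2 ^ DIM('a)) * (\<integral>\<^sup>+v. h (u, v) \<partial>lborel) \<partial>lborel)"
    by (intro nn_integral_cong nn_integral_double_shift) measurable
  also have "\<dots> = ennreal (inverse 2 ^ DIM('a)) * (\<integral>\<^sup>+u. (\<integral>\<^sup>+v. h (u, v) \<partial>lborel) \<partial>lborel)"
    by (rule nn_integral_cmult) measurable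
  also have "ennreal (2 ^ DIM('a)) * \<dots> = ennreal (2 ^ DIM('a) * inverse 2 ^ DIM('a)) * (\<integral>\<^sup>+u. (\<integral>\<^sup>+v. h (u, v) \<partial>lborel) \<partial>lborel)"
    by (simp add: ennreal_mult mult.assoc)
  finally show ?thesis by (simp flip: power_mult_distrib)
qed

text \<open>The factors are paired crosswise, \<open>a\<close> with \<open>b'\<close> and
  \<open>a'\<close> with \<open>b\<close>. The free parameter \<open>r\<close> is there to carry the
  weights of Schur's test.\<close>

lemma weighted_amgm:
  fixes a b a' b' r :: real
  assumes "r > 0"
  shows "a * b * (a' * b') \<le> (r * (a\<^sup>2 * b'\<^sup>2) + inverse r * (a'\<^sup>2 * b\<^sup>2)) / 2"
proof -
  have "0 \<le> (r * (a * b') - a' * b)\<^sup>2" by simp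
  then have "2 * r * (a * b * (a' * b')) \<le> r\<^sup>2 * (a\<^sup>2 * b'\<^sup>2) + a'\<^sup>2 * b\<^sup>2"
    by (simp add: power2_eq_square algebra_simps)
  then show ?thesis using assms by (simp add: field_simps power2_eq_square)
qed

text \<open>Schur's test with the weight \<open>norm u powr (- DIM('a))\<close>.  Pairing \<open>A u\<close> with \<open>B (2 *\<^sub>R x - u')\<close>, rather than with
  \<open>B (2 *\<^sub>R x - u)\<close>, makes the integral over \<open>x\<close> separate.\<close>

lemma nn_integral_pitt_kernel:
  fixes A B :: "('a::euclidean_space) \<times> 'a \<Rightarrow> real"
  assumes [measurable]: "A \<in> borel_measurable borel" "B \<in> borel_measurable borel" and s: "s > 0"
  shows "(\<integral>\<^sup>+x. (\<integral>\<^sup>+u. (\<integral>\<^sup>+u'. ennreal (gkernel s (2 *\<^sub>R (u - u')) * (A u * B (2 *\<^sub>R x - u) * (A u' * B (2 *\<^sub>R x - u')))) \<partial>lborel) \<partial>lborel) \<partial>lborel)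
    \<le> ennreal (inverse 2 ^ DIM('a \<times> 'a)) * (\<integral>\<^sup>+v. ennreal ((B v)\<^sup>2) \<partial>lborel) *
       (\<integral>\<^sup>+u. ennreal ((A u)\<^sup>2 * norm u powr DIM('a)) * (\<integral>\<^sup>+u'. ennreal (gkernel s (2 *\<^sub>R (u - u')) * norm u' powr (- real DIM('a))) \<partial>lborel) \<partial>lborel)"
proof -
  let ?P = "\<lambda>x u u'. gkernel s (2 *\<^sub>R (u - u')) * (A u * B (2 *\<^sub>R x - u) * (A u' * B (2 *\<^sub>R x - u')))"
  \<comment> \<open>Half of this is one of the two terms of the arithmetic-geometric mean bound. The
    other term has \<open>u\<close> and \<open>u'\<close> exchanged, so both have the same double
    integral.\<close>
  let ?T = "\<lambda>x u u'. ((A u)\<^sup>2 * norm u powr DIM('a)) * (gkernel s (2 *\<^sub>R (u - u')) * norm u' powr (- real DIM('a))) * (B (2 *\<^sub>R x - u'))\<^sup>2"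
  have T: "?T x u u' \<ge> 0" for x u u'
    by (intro mult_nonneg_nonneg gkernel_nonneg[OF s]) auto
  have half: "ennreal (z / 2) + ennreal (z / 2) = ennreal z" if "z \<ge> 0" for z
    using that by (subst ennreal_plus[symmetric]) auto
  have le: "?P x u u' \<le> (?T x u u' + ?T x u' u) / 2" if "u \<noteq> 0" "u' \<noteq> 0" for x u u'
  proof -
    \<comment> \<open>The ratio of the Schur weights at \<open>u'\<close> and at \<open>u\<close>.
      It is positive only away from the origin, where \<open>0 powr x = 0\<close> would spoil
      it.\<close>
    define r where "r = norm u powr DIM('a) * norm u' powr (- real DIM('a))"
    have r: "r > 0" "inverse r = norm u' powr DIM('a) * norm u powr (- real DIM('a))"
      using that by (auto simp: r_def powr_minus)
    have "gkernel s (2 *\<^sub>R (u' - u)) = gkernel s (2 *\<^sub>R (u - u'))"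
      using gkernel_minus[of s "2 *\<^sub>R u'" "2 *\<^sub>R u"] by (simp add: scaleR_diff_right)
    then have "(?T x u u' + ?T x u' u) / 2 = gkernel s (2 *\<^sub>R (u - u')) *
      ((r * ((A u)\<^sup>2 * (B (2 *\<^sub>R x - u'))\<^sup>2) + inverse r * ((A u')\<^sup>2 * (B (2 *\<^sub>R x - u))\<^sup>2)) / 2)"
      unfolding r(2) unfolding r_def by (simp add: algebra_simps)
    then show ?thesis
      by (simp only:) (intro mult_left_mono weighted_amgm r(1) gkernel_nonneg[OF s])
  qed
  have PT: "(\<integral>\<^sup>+u. (\<integral>\<^sup>+u'. ennreal (?P x u u') \<partial>lborel) \<partial>lborel) \<le> (\<integral>\<^sup>+u. (\<integral>\<^sup>+u'. ennreal (?T x u u') \<partial>lborel) \<partial>lborel)" for x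
  proof -
    have "(\<integral>\<^sup>+u. (\<integral>\<^sup>+u'. ennreal (?P x u u') \<partial>lborel) \<partial>lborel)
      \<le> (\<integral>\<^sup>+u. (\<integral>\<^sup>+u'. ennreal (?T x u u' / 2) + ennreal (?T x u' u / 2) \<partial>lborel) \<partial>lborel)"
    proof (rule nn_integral_mono_AE)
      show "AE u in lborel. (\<integral>\<^sup>+u'. ennreal (?P x u u') \<partial>lborel) \<le> (\<integral>\<^sup>+u'. ennreal (?T x u u' / 2) + ennreal (?T x u' u / 2) \<partial>lborel)"
        using AE_lborel_singleton[of "0::'a\<times>'a"]
      proof eventually_elim
        fix u :: "'a \<times> 'a" assume u: "u \<noteq> 0"
        show "(\<integral>\<^sup>+u'. ennreal (?P x u u') \<partial>lborel) \<le> (\<integral>\<^sup>+u'. ennreal (?T x u u' / 2) + ennreal (?T x u' u / 2) \<partial>lborel)"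
        proof (rule nn_integral_mono_AE)
          show "AE u' in lborel. ennreal (?P x u u') \<le> ennreal (?T x u u' / 2) + ennreal (?T x u' u / 2)"
            using AE_lborel_singleton[of "0::'a\<times>'a"]
          proof eventually_elim
            fix u' :: "'a \<times> 'a" assume u': "u' \<noteq> 0"
            have "ennreal (?P x u u') \<le> ennreal (?T x u u' / 2 + ?T x u' u / 2)"
              using le[OF u u', of x] by (intro ennreal_leI) (simp add: add_divide_distrib)
            also have "\<dots> = ennreal (?T x u u' / 2) + ennreal (?T x u' u / 2)"
              using T[of u u' x] T[of u' u x] by (intro ennreal_plus divide_nonneg_pos) auto
            finally show "ennreal (?P x u u') \<le> ennreal (?T x u u' / 2) + ennreal (?T x u' u / 2)" .
          qed
        qed
      qed
    qed
    also have "\<dots> = (\<integral>\<^sup>+u. (\<integral>\<^sup>+u'. ennreal (?T x u u' / 2) \<partial>lborel) \<partial>lborel) + (\<integral>\<^sup>+u. (\<integral>\<^sup>+u'. ennreal (?T x u' u / 2) \<partial>lborel) \<partial>lborel)"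
      by (simp add: nn_integral_add)
    also have "(\<integral>\<^sup>+u. (\<integral>\<^sup>+u'. ennreal (?T x u' u / 2) \<partial>lborel) \<partial>lborel) = (\<integral>\<^sup>+u'. (\<integral>\<^sup>+u. ennreal (?T x u' u / 2) \<partial>lborel) \<partial>lborel)"
      by (rule lborel_pair.Fubini') measurable
    also have "(\<integral>\<^sup>+u. (\<integral>\<^sup>+u'. ennreal (?T x u u' / 2) \<partial>lborel) \<partial>lborel) + (\<integral>\<^sup>+u. (\<integral>\<^sup>+u'. ennreal (?T x u u' / 2) \<partial>lborel) \<partial>lborel)
       = (\<integral>\<^sup>+u. (\<integral>\<^sup>+u'. ennreal (?T x u u' / 2) + ennreal (?T x u u' / 2) \<partial>lborel) \<partial>lborel)"
      by (simp add: nn_integral_add)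
    also have "\<dots> = (\<integral>\<^sup>+u. (\<integral>\<^sup>+u'. ennreal (?T x u u') \<partial>lborel) \<partial>lborel)"
    proof (intro nn_integral_cong)
      fix u u' :: "'a \<times> 'a"
      show "ennreal (?T x u u' / 2) + ennreal (?T x u u' / 2) = ennreal (?T x u u')"
        by (rule half[OF T])
    qed
    finally show ?thesis .
  qed
  have "(\<integral>\<^sup>+x. (\<integral>\<^sup>+u. (\<integral>\<^sup>+u'. ennreal (?P x u u') \<partial>lborel) \<partial>lborel) \<partial>lborel) \<le> (\<integral>\<^sup>+x. (\<integral>\<^sup>+u. (\<integral>\<^sup>+u'. ennreal (?T x u u') \<partial>lborel) \<partial>lborel) \<partial>lborel)"
    by (intro nn_integral_mono PT)
  also have "\<dots> = (\<integral>\<^sup>+u. (\<integral>\<^sup>+x. (\<integral>\<^sup>+u'. ennreal (?T x u u') \<partial>lborel) \<partial>lborel) \<partial>lborel)"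
    by (rule lborel_pair.Fubini') measurable
  also have "\<dots> = (\<integral>\<^sup>+u. (\<integral>\<^sup>+u'. (\<integral>\<^sup>+x. ennreal (?T x u u') \<partial>lborel) \<partial>lborel) \<partial>lborel)"
    by (intro nn_integral_cong lborel_pair.Fubini') measurable
  also have "\<dots> = (\<integral>\<^sup>+u. (\<integral>\<^sup>+u'. (ennreal (inverse 2 ^ DIM('a \<times> 'a)) * (\<integral>\<^sup>+v. ennreal ((B v)\<^sup>2) \<partial>lborel)) *
      (ennreal ((A u)\<^sup>2 * norm u powr DIM('a)) * ennreal (gkernel s (2 *\<^sub>R (u - u')) * norm u' powr (- real DIM('a)))) \<partial>lborel) \<partial>lborel)"
  proof (intro nn_integral_cong)
    fix u u' :: "'a \<times> 'a"
    let ?c = "((A u)\<^sup>2 * norm u powr DIM('a)) * (gkernel s (2 *\<^sub>R (u - u')) * norm u' powr (- real DIM('a)))"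
    have c: "?c \<ge> 0" by (intro mult_nonneg_nonneg gkernel_nonneg[OF s]) auto
    have "(\<integral>\<^sup>+x. ennreal (?T x u u') \<partial>lborel) = (\<integral>\<^sup>+x. ennreal ?c * ennreal ((B (2 *\<^sub>R x - u'))\<^sup>2) \<partial>lborel)"
      by (intro nn_integral_cong ennreal_mult'' zero_le_power2)
    also have "\<dots> = ennreal ?c * (ennreal (inverse 2 ^ DIM('a \<times> 'a)) * (\<integral>\<^sup>+v. ennreal ((B v)\<^sup>2) \<partial>lborel))"
      by (subst nn_integral_cmult, measurable) (subst nn_integral_double_shift[of "\<lambda>v. ennreal ((B v)\<^sup>2)"], auto)
    also have "ennreal ?c = ennreal ((A u)\<^sup>2 * norm u powr DIM('a)) * ennreal (gkernel s (2 *\<^sub>R (u - u')) * norm u' powr (- real DIM('a)))"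
      by (intro ennreal_mult') simp
    finally show "(\<integral>\<^sup>+x. ennreal (?T x u u') \<partial>lborel) = (ennreal (inverse 2 ^ DIM('a \<times> 'a)) * (\<integral>\<^sup>+v. ennreal ((B v)\<^sup>2) \<partial>lborel)) *
      (ennreal ((A u)\<^sup>2 * norm u powr DIM('a)) * ennreal (gkernel s (2 *\<^sub>R (u - u')) * norm u' powr (- real DIM('a))))"
      by (simp only: mult_ac)
  qed
  also have "\<dots> = (\<integral>\<^sup>+u. (ennreal (inverse 2 ^ DIM('a \<times> 'a)) * (\<integral>\<^sup>+v. ennreal ((B v)\<^sup>2) \<partial>lborel)) *
      (\<integral>\<^sup>+u'. ennreal ((A u)\<^sup>2 * norm u powr DIM('a)) * ennreal (gkernel s (2 *\<^sub>R (u - u')) * norm u' powr (- real DIM('a))) \<partial>lborel) \<partial>lborel)"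
    by (rule nn_integral_cong, rule nn_integral_cmult, measurable)
  also have "\<dots> = (ennreal (inverse 2 ^ DIM('a \<times> 'a)) * (\<integral>\<^sup>+v. ennreal ((B v)\<^sup>2) \<partial>lborel)) *
      (\<integral>\<^sup>+u. (\<integral>\<^sup>+u'. ennreal ((A u)\<^sup>2 * norm u powr DIM('a)) * ennreal (gkernel s (2 *\<^sub>R (u - u')) * norm u' powr (- real DIM('a))) \<partial>lborel) \<partial>lborel)"
    by (rule nn_integral_cmult) measurable
  also have "(\<integral>\<^sup>+u. (\<integral>\<^sup>+u'. ennreal ((A u)\<^sup>2 * norm u powr DIM('a)) * ennreal (gkernel s (2 *\<^sub>R (u - u')) * norm u' powr (- real DIM('a))) \<partial>lborel) \<partial>lborel)
     = (\<integral>\<^sup>+u. ennreal ((A u)\<^sup>2 * norm u powr DIM('a)) * (\<integral>\<^sup>+u'. ennreal (gkernel s (2 *\<^sub>R (u - u')) * norm u' powr (- real DIM('a))) \<partial>lborel) \<partial>lborel)"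
    by (rule nn_integral_cong, rule nn_integral_cmult, measurable)
  finally show ?thesis .
qed

section \<open>Pitt's inequality for the two-point correlation of \<open>f\<close> and
  \<open>g\<close>\<close>

lemma norm_qcnj [simp]: "norm (qcnj q) = norm q"
  by (simp add: norm_quat_def inner_quat_def)

lemma bounded_linear_qcnj: "bounded_linear qcnj"
  by (rule bounded_linear_intro[where K = 1]) (simp_all add: quat_eq_iff)

lemma borel_measurable_qcnj [measurable]: "qcnj \<in> borel_measurable borel"
  by (intro borel_measurable_continuous_onI linear_continuous_on bounded_linear_qcnj)

text \<open>For fixed \<open>x\<close> this is the function of \<open>t\<close> whose two-sided
  transform is, up to normalisation, the Wigner transform at \<open>x\<close>.\<close>

definition correlation :: "('a::real_vector \<Rightarrow> quat) \<Rightarrow> ('a \<Rightarrow> quat) \<Rightarrow> 'a \<Rightarrow> 'a \<Rightarrow> quat" where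
  "correlation f g x t = f (x + t /\<^sub>R 2) * qcnj (g (x - t /\<^sub>R 2))"

lemma norm_correlation: "norm (correlation f g x t) = norm (f (x + t /\<^sub>R 2)) * norm (g (x - t /\<^sub>R 2))"
  by (simp add: correlation_def norm_mult)

lemma borel_measurable_correlation [measurable (raw)]:
  fixes f g :: "'a::euclidean_space \<Rightarrow> quat"
  assumes [measurable]: "f \<in> borel_measurable borel" "g \<in> borel_measurable borel" "h \<in> borel_measurable M" "k \<in> borel_measurable M"
  shows "(\<lambda>z. correlation f g (h z) (k z)) \<in> borel_measurable M"
  unfolding correlation_def by measurable

lemma borel_measurable_qft_correlation [measurable (raw)]:
  fixes f g :: "('a::euclidean_space) \<times> 'a \<Rightarrow> quat"
  assumes [measurable]: "f \<in> borel_measurable borel" "g \<in> borel_measurable borel" "h \<in> borel_measurable M" "k \<in> borel_measurable M"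
  shows "(\<lambda>z. qft (correlation f g (h z)) (k z)) \<in> borel_measurable M"
  unfolding qft_def by measurable

context
  fixes f g :: "('a::euclidean_space) \<times> 'a \<Rightarrow> quat"
  assumes f [measurable]: "f \<in> borel_measurable borel" and g [measurable]: "g \<in> borel_measurable borel"
    and fg: "\<And>x. integrable lborel (correlation f g x)"
begin

text \<open>With \<open>u = x + t / 2\<close> and \<open>u' = x + t' / 2\<close> the arguments of
  \<open>g\<close> become \<open>2 x - u\<close> and \<open>2 x - u'\<close>, and
  \<open>t - t'\<close> becomes \<open>2 (u - u')\<close>. Each substitution contributes
  \<open>2 ^ DIM('a \<times> 'a)\<close>, and the separated integral over \<open>x\<close> takes one
  of these factors back.\<close>

lemma nn_integral_gaussian_qft_correlation_le:
  assumes s: "s > 0"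
  shows "(\<integral>\<^sup>+x. (\<integral>\<^sup>+w. ennreal (exp (- (s * (norm w)\<^sup>2)) * (norm (qft (correlation f g x) w))\<^sup>2) \<partial>lborel) \<partial>lborel)
    \<le> ennreal (2 ^ DIM('a \<times> 'a)) * (\<integral>\<^sup>+v. ennreal ((norm (g v))\<^sup>2) \<partial>lborel) *
       (\<integral>\<^sup>+u. ennreal ((norm (f u))\<^sup>2 * norm u powr DIM('a)) * (\<integral>\<^sup>+u'. ennreal (gkernel s (2 *\<^sub>R (u - u')) * norm u' powr (- real DIM('a))) \<partial>lborel) \<partial>lborel)"
    (is "_ \<le> _ * ?B * ?R")
proof -
  let ?N = "DIM('a \<times> 'a)"
  let ?P = "\<lambda>x u u'. ennreal (gkernel s (2 *\<^sub>R (u - u')) * (norm (f u) * norm (g (2 *\<^sub>R x - u)) * (norm (f u') * norm (g (2 *\<^sub>R x - u')))))"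
  have "(\<integral>\<^sup>+x. (\<integral>\<^sup>+w. ennreal (exp (- (s * (norm w)\<^sup>2)) * (norm (qft (correlation f g x) w))\<^sup>2) \<partial>lborel) \<partial>lborel)
    \<le> (\<integral>\<^sup>+x. (\<integral>\<^sup>+t. (\<integral>\<^sup>+t'. ennreal (gkernel s (t - t') * (norm (correlation f g x t) * norm (correlation f g x t'))) \<partial>lborel) \<partial>lborel) \<partial>lborel)"
    by (intro nn_integral_mono nn_integral_gaussian_qft_le fg s)
  also have "\<dots> = (\<integral>\<^sup>+x. ennreal (2 ^ ?N) * (ennreal (2 ^ ?N) * (\<integral>\<^sup>+u. (\<integral>\<^sup>+u'. ?P x u u' \<partial>lborel) \<partial>lborel)) \<partial>lborel)"
  proof (intro nn_integral_cong)
    fix x :: "'a \<times> 'a"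
    have e: "ennreal (gkernel s (t - t') * (norm (correlation f g x t) * norm (correlation f g x t'))) = ?P x (x + t /\<^sub>R 2) (x + t' /\<^sub>R 2)" for t t'
    proof -
      have "2 *\<^sub>R x - (x + t /\<^sub>R 2) = x - t /\<^sub>R 2" "2 *\<^sub>R x - (x + t' /\<^sub>R 2) = x - t' /\<^sub>R 2"
        "2 *\<^sub>R ((x + t /\<^sub>R 2) - (x + t' /\<^sub>R 2)) = t - t'"
        by (simp_all add: scaleR_2) (simp add: scaleR_2[symmetric] scaleR_diff_right)
      then show ?thesis by (simp only: norm_correlation)
    qed
    have "(\<integral>\<^sup>+t'. ?P x u (x + t' /\<^sub>R 2) \<partial>lborel) = ennreal (2 ^ ?N) * (\<integral>\<^sup>+u'. ?P x u u' \<partial>lborel)" for u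
      by (rule nn_integral_half_shift) measurable
    then have "(\<integral>\<^sup>+t. (\<integral>\<^sup>+t'. ?P x (x + t /\<^sub>R 2) (x + t' /\<^sub>R 2) \<partial>lborel) \<partial>lborel) = (\<integral>\<^sup>+t. ennreal (2 ^ ?N) * (\<integral>\<^sup>+u'. ?P x (x + t /\<^sub>R 2) u' \<partial>lborel) \<partial>lborel)"
      by (simp only:)
    also have "\<dots> = ennreal (2 ^ ?N) * (\<integral>\<^sup>+t. (\<integral>\<^sup>+u'. ?P x (x + t /\<^sub>R 2) u' \<partial>lborel) \<partial>lborel)"
      by (rule nn_integral_cmult) measurable
    also have "(\<integral>\<^sup>+t. (\<integral>\<^sup>+u'. ?P x (x + t /\<^sub>R 2) u' \<partial>lborel) \<partial>lborel) = ennreal (2 ^ ?N) * (\<integral>\<^sup>+u. (\<integral>\<^sup>+u'. ?P x u u' \<partial>lborel) \<partial>lborel)"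
      by (rule nn_integral_half_shift) measurable
    finally show "(\<integral>\<^sup>+t. (\<integral>\<^sup>+t'. ennreal (gkernel s (t - t') * (norm (correlation f g x t) * norm (correlation f g x t'))) \<partial>lborel) \<partial>lborel)
      = ennreal (2 ^ ?N) * (ennreal (2 ^ ?N) * (\<integral>\<^sup>+u. (\<integral>\<^sup>+u'. ?P x u u' \<partial>lborel) \<partial>lborel))"
      unfolding e .
  qed
  also have "\<dots> = ennreal (2 ^ ?N) * (ennreal (2 ^ ?N) * (\<integral>\<^sup>+x. (\<integral>\<^sup>+u. (\<integral>\<^sup>+u'. ?P x u u' \<partial>lborel) \<partial>lborel) \<partial>lborel))"
    by (subst nn_integral_cmult, measurable)+
  also have "\<dots> \<le> ennreal (2 ^ ?N) * (ennreal (2 ^ ?N) * (ennreal (inverse 2 ^ ?N) * ?B * ?R))"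
    by (intro mult_left_mono nn_integral_pitt_kernel s) auto
  also have "\<dots> = ennreal (2 ^ ?N * (2 ^ ?N * inverse 2 ^ ?N)) * ?B * ?R"
    by (simp only: ennreal_mult' mult.assoc zero_le_power zero_le_numeral)
  also have "2 ^ ?N * (2 ^ ?N * inverse 2 ^ ?N) = (2 ^ ?N :: real)"
    by (simp flip: power_mult_distrib)
  finally show ?thesis .
qed

text \<open>The weight is a Gamma mixture of Gaussians in \<open>s\<close>, normalised by
  \<open>1 / Gamma a\<close>. Averaging the kernels produces a factor \<open>Gamma a\<close>, so the
  singularities at \<open>a = 0\<close> cancel and the constant tends to the one in Plancherel's
  formula.\<close>

lemma pitt_correlation:
  fixes a :: real
  assumes a: "0 < a" "a < DIM('a) / 2"
  shows "(\<integral>\<^sup>+x. (\<integral>\<^sup>+w. ennreal (norm w powr (- (2 * a)) * (norm (qft (correlation f g x) w))\<^sup>2) \<partial>lborel) \<partial>lborel)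
    \<le> ennreal ((2 * pi) ^ (2 * DIM('a)) * (Gamma (DIM('a) / 2 - a) / Gamma (DIM('a) / 2 + a))) * (\<integral>\<^sup>+v. ennreal ((norm (g v))\<^sup>2) \<partial>lborel) *
       (\<integral>\<^sup>+u. ennreal (norm u powr (2 * a) * (norm (f u))\<^sup>2) \<partial>lborel)"
    (is "_ \<le> ennreal ?C * ?B * ?R")
proof -
  let ?I = "\<lambda>x. indicator {0<..} x :: ennreal"
  let ?q = "\<lambda>x w. (norm (qft (correlation f g x) w))\<^sup>2"
  let ?H = "\<lambda>s u :: 'a \<times> 'a. \<integral>\<^sup>+u'. ennreal (gkernel s (2 *\<^sub>R (u - u')) * norm u' powr (- real DIM('a))) \<partial>lborel"
  have Ga: "Gamma a > 0" "Gamma (DIM('a) / 2 - a) > 0" "Gamma (DIM('a) / 2 + a) > 0" using a by (auto intro!: Gamma_real_pos)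
  have 1: "ennreal (norm w powr (- (2 * a)) * q) = ennreal (1 / Gamma a) * (\<integral>\<^sup>+s. (ennreal (s powr (a - 1)) * ?I s) * ennreal (exp (- (s * (norm w)\<^sup>2)) * q) \<partial>lborel)"
    if "w \<noteq> 0" "q \<ge> 0" for w :: "'a \<times> 'a" and q
  proof -
    have "(\<integral>\<^sup>+s. (ennreal (s powr (a - 1)) * ?I s) * ennreal (exp (- (s * (norm w)\<^sup>2)) * q) \<partial>lborel)
       = (\<integral>\<^sup>+s. ennreal q * (ennreal (s powr (a - 1) * exp (- ((norm w)\<^sup>2 * s))) * ?I s) \<partial>lborel)"
      by (intro nn_integral_cong) (simp add: ennreal_mult that mult_ac)
    also have "\<dots> = ennreal q * (\<integral>\<^sup>+s\<in>{0<..}. ennreal (s powr (a - 1) * exp (- ((norm w)\<^sup>2 * s))) \<partial>lborel)"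
      by (rule nn_integral_cmult) measurable
    also have "\<dots> = ennreal q * ennreal (Gamma a * ((norm w)\<^sup>2) powr (- a))"
      using that a by (subst nn_integral_Gamma) auto
    also have "((norm w)\<^sup>2) powr (- a) = norm w powr (- (2 * a))"
      by (simp add: power2_powr)
    finally show ?thesis
      using Ga that by (simp add: ennreal_mult'[symmetric] ennreal_mult''[symmetric] mult_ac)
  qed
  have "(\<integral>\<^sup>+x. (\<integral>\<^sup>+w. (\<integral>\<^sup>+s. (ennreal (s powr (a - 1)) * ?I s) * ennreal (exp (- (s * (norm w)\<^sup>2)) * ?q x w) \<partial>lborel) \<partial>lborel) \<partial>lborel)
     = (\<integral>\<^sup>+x. (\<integral>\<^sup>+s. (\<integral>\<^sup>+w. (ennreal (s powr (a - 1)) * ?I s) * ennreal (exp (- (s * (norm w)\<^sup>2)) * ?q x w) \<partial>lborel) \<partial>lborel) \<partial>lborel)"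
    by (intro nn_integral_cong lborel_pair.Fubini') measurable
  also have "\<dots> = (\<integral>\<^sup>+s. (\<integral>\<^sup>+x. (\<integral>\<^sup>+w. (ennreal (s powr (a - 1)) * ?I s) * ennreal (exp (- (s * (norm w)\<^sup>2)) * ?q x w) \<partial>lborel) \<partial>lborel) \<partial>lborel)"
    by (rule lborel_pair.Fubini') measurable
  also have "\<dots> = (\<integral>\<^sup>+s. (ennreal (s powr (a - 1)) * ?I s) * (\<integral>\<^sup>+x. (\<integral>\<^sup>+w. ennreal (exp (- (s * (norm w)\<^sup>2)) * ?q x w) \<partial>lborel) \<partial>lborel) \<partial>lborel)"
  proof (rule nn_integral_cong)
    fix s :: real
    have "(\<integral>\<^sup>+w. (ennreal (s powr (a - 1)) * ?I s) * ennreal (exp (- (s * (norm w)\<^sup>2)) * ?q x w) \<partial>lborel)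
      = (ennreal (s powr (a - 1)) * ?I s) * (\<integral>\<^sup>+w. ennreal (exp (- (s * (norm w)\<^sup>2)) * ?q x w) \<partial>lborel)" for x
      by (rule nn_integral_cmult) measurable
    then show "(\<integral>\<^sup>+x. (\<integral>\<^sup>+w. (ennreal (s powr (a - 1)) * ?I s) * ennreal (exp (- (s * (norm w)\<^sup>2)) * ?q x w) \<partial>lborel) \<partial>lborel)
      = (ennreal (s powr (a - 1)) * ?I s) * (\<integral>\<^sup>+x. (\<integral>\<^sup>+w. ennreal (exp (- (s * (norm w)\<^sup>2)) * ?q x w) \<partial>lborel) \<partial>lborel)"
      by (simp only:) (rule nn_integral_cmult, measurable)
  qed
  also have "\<dots> \<le> (\<integral>\<^sup>+s. (ennreal (s powr (a - 1)) * ?I s) * (ennreal (2 ^ DIM('a \<times> 'a)) * ?B * (\<integral>\<^sup>+u. ennreal ((norm (f u))\<^sup>2 * norm u powr DIM('a)) * ?H s u \<partial>lborel)) \<partial>lborel)"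
  proof (intro nn_integral_mono)
    fix s :: real
    show "(ennreal (s powr (a - 1)) * ?I s) * (\<integral>\<^sup>+x. (\<integral>\<^sup>+w. ennreal (exp (- (s * (norm w)\<^sup>2)) * ?q x w) \<partial>lborel) \<partial>lborel)
      \<le> (ennreal (s powr (a - 1)) * ?I s) * (ennreal (2 ^ DIM('a \<times> 'a)) * ?B * (\<integral>\<^sup>+u. ennreal ((norm (f u))\<^sup>2 * norm u powr DIM('a)) * ?H s u \<partial>lborel))"
    proof (cases "s > 0")
      case True
      then show ?thesis by (intro mult_left_mono nn_integral_gaussian_qft_correlation_le) simp_all
    qed simp
  qed
  also have "\<dots> = (\<integral>\<^sup>+s. (ennreal (2 ^ DIM('a \<times> 'a)) * ?B) * ((ennreal (s powr (a - 1)) * ?I s) * (\<integral>\<^sup>+u. ennreal ((norm (f u))\<^sup>2 * norm u powr DIM('a)) * ?H s u \<partial>lborel)) \<partial>lborel)"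
    by (rule nn_integral_cong) (simp only: mult_ac)
  also have "\<dots> = (ennreal (2 ^ DIM('a \<times> 'a)) * ?B) * (\<integral>\<^sup>+s. (ennreal (s powr (a - 1)) * ?I s) * (\<integral>\<^sup>+u. ennreal ((norm (f u))\<^sup>2 * norm u powr DIM('a)) * ?H s u \<partial>lborel) \<partial>lborel)"
    by (rule nn_integral_cmult) measurable
  also have "(\<integral>\<^sup>+s. (ennreal (s powr (a - 1)) * ?I s) * (\<integral>\<^sup>+u. ennreal ((norm (f u))\<^sup>2 * norm u powr DIM('a)) * ?H s u \<partial>lborel) \<partial>lborel)
    = (\<integral>\<^sup>+s. (\<integral>\<^sup>+u. (ennreal (s powr (a - 1)) * ?I s) * (ennreal ((norm (f u))\<^sup>2 * norm u powr DIM('a)) * ?H s u) \<partial>lborel) \<partial>lborel)"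
    by (rule nn_integral_cong, rule nn_integral_cmult[symmetric], measurable)
  also have "(\<integral>\<^sup>+s. (\<integral>\<^sup>+u. (ennreal (s powr (a - 1)) * ?I s) * (ennreal ((norm (f u))\<^sup>2 * norm u powr DIM('a)) * ?H s u) \<partial>lborel) \<partial>lborel)
    = (\<integral>\<^sup>+u. (\<integral>\<^sup>+s. (ennreal (s powr (a - 1)) * ?I s) * (ennreal ((norm (f u))\<^sup>2 * norm u powr DIM('a)) * ?H s u) \<partial>lborel) \<partial>lborel)"
    by (rule lborel_pair.Fubini') measurable
  also have "\<dots> = (\<integral>\<^sup>+u. ennreal ((norm (f u))\<^sup>2 * norm u powr DIM('a)) * (\<integral>\<^sup>+s\<in>{0<..}. ennreal (s powr (a - 1)) * ?H s u \<partial>lborel) \<partial>lborel)"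
  proof (rule nn_integral_cong)
    fix u :: "'a \<times> 'a"
    have "(\<integral>\<^sup>+s. (ennreal (s powr (a - 1)) * ?I s) * (ennreal ((norm (f u))\<^sup>2 * norm u powr DIM('a)) * ?H s u) \<partial>lborel)
      = (\<integral>\<^sup>+s. ennreal ((norm (f u))\<^sup>2 * norm u powr DIM('a)) * (ennreal (s powr (a - 1)) * ?H s u * ?I s) \<partial>lborel)"
      by (simp only: mult_ac)
    also have "\<dots> = ennreal ((norm (f u))\<^sup>2 * norm u powr DIM('a)) * (\<integral>\<^sup>+s\<in>{0<..}. ennreal (s powr (a - 1)) * ?H s u \<partial>lborel)"
      by (rule nn_integral_cmult) measurable
    finally show "(\<integral>\<^sup>+s. (ennreal (s powr (a - 1)) * ?I s) * (ennreal ((norm (f u))\<^sup>2 * norm u powr DIM('a)) * ?H s u) \<partial>lborel)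
      = ennreal ((norm (f u))\<^sup>2 * norm u powr DIM('a)) * (\<integral>\<^sup>+s\<in>{0<..}. ennreal (s powr (a - 1)) * ?H s u \<partial>lborel)" .
  qed
  also have "\<dots> = (\<integral>\<^sup>+u. ennreal (pi ^ (2 * DIM('a)) * Gamma a * (Gamma (DIM('a) / 2 - a) / Gamma (DIM('a) / 2 + a))) * ennreal (norm u powr (2 * a) * (norm (f u))\<^sup>2) \<partial>lborel)"
    using AE_lborel_singleton[of "0::'a\<times>'a"]
  proof (intro nn_integral_cong_AE, eventually_elim)
    fix u :: "'a \<times> 'a" assume u: "u \<noteq> 0"
    \<comment> \<open>The power left over by the kernel, \<open>2 * a - DIM('a)\<close>, meets the
      Schur weight \<open>norm u powr DIM('a)\<close>; only the weight
      \<open>norm u powr (2 * a)\<close> survives.\<close>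
    have "norm u powr DIM('a) * norm u powr (2 * a - DIM('a)) = norm u powr (2 * a)"
      using u by (simp add: powr_add[symmetric])
    then show "ennreal ((norm (f u))\<^sup>2 * norm u powr DIM('a)) * (\<integral>\<^sup>+s\<in>{0<..}. ennreal (s powr (a - 1)) * ?H s u \<partial>lborel)
       = ennreal (pi ^ (2 * DIM('a)) * Gamma a * (Gamma (DIM('a) / 2 - a) / Gamma (DIM('a) / 2 + a))) * ennreal (norm u powr (2 * a) * (norm (f u))\<^sup>2)"
      using Ga by (subst nn_integral_heat_power[OF a u]) (simp add: ennreal_mult[symmetric] mult_ac)
  qed
  also have "\<dots> = ennreal (pi ^ (2 * DIM('a)) * Gamma a * (Gamma (DIM('a) / 2 - a) / Gamma (DIM('a) / 2 + a))) * ?R"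
    by (rule nn_integral_cmult) measurable
  finally have main: "(\<integral>\<^sup>+x. (\<integral>\<^sup>+w. (\<integral>\<^sup>+s. (ennreal (s powr (a - 1)) * ?I s) * ennreal (exp (- (s * (norm w)\<^sup>2)) * ?q x w) \<partial>lborel) \<partial>lborel) \<partial>lborel)
    \<le> ennreal (2 ^ DIM('a \<times> 'a)) * ?B * (ennreal (pi ^ (2 * DIM('a)) * Gamma a * (Gamma (DIM('a) / 2 - a) / Gamma (DIM('a) / 2 + a))) * ?R)" .
  have "(\<integral>\<^sup>+x. (\<integral>\<^sup>+w. ennreal (norm w powr (- (2 * a)) * ?q x w) \<partial>lborel) \<partial>lborel)
    = (\<integral>\<^sup>+x. (\<integral>\<^sup>+w. ennreal (1 / Gamma a) * (\<integral>\<^sup>+s. (ennreal (s powr (a - 1)) * ?I s) * ennreal (exp (- (s * (norm w)\<^sup>2)) * ?q x w) \<partial>lborel) \<partial>lborel) \<partial>lborel)"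
  proof (rule nn_integral_cong)
    fix x :: "'a \<times> 'a"
    show "(\<integral>\<^sup>+w. ennreal (norm w powr (- (2 * a)) * ?q x w) \<partial>lborel)
      = (\<integral>\<^sup>+w. ennreal (1 / Gamma a) * (\<integral>\<^sup>+s. (ennreal (s powr (a - 1)) * ?I s) * ennreal (exp (- (s * (norm w)\<^sup>2)) * ?q x w) \<partial>lborel) \<partial>lborel)"
      using AE_lborel_singleton[of "0::'a\<times>'a"] by (intro nn_integral_cong_AE, eventually_elim) (rule 1, auto)
  qed
  also have "\<dots> = (\<integral>\<^sup>+x. ennreal (1 / Gamma a) * (\<integral>\<^sup>+w. (\<integral>\<^sup>+s. (ennreal (s powr (a - 1)) * ?I s) * ennreal (exp (- (s * (norm w)\<^sup>2)) * ?q x w) \<partial>lborel) \<partial>lborel) \<partial>lborel)"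
    by (rule nn_integral_cong, rule nn_integral_cmult, measurable)
  also have "\<dots> = ennreal (1 / Gamma a) * (\<integral>\<^sup>+x. (\<integral>\<^sup>+w. (\<integral>\<^sup>+s. (ennreal (s powr (a - 1)) * ?I s) * ennreal (exp (- (s * (norm w)\<^sup>2)) * ?q x w) \<partial>lborel) \<partial>lborel) \<partial>lborel)"
    by (rule nn_integral_cmult) measurable
  also have "\<dots> \<le> ennreal (1 / Gamma a) * (ennreal (2 ^ DIM('a \<times> 'a)) * ?B * (ennreal (pi ^ (2 * DIM('a)) * Gamma a * (Gamma (DIM('a) / 2 - a) / Gamma (DIM('a) / 2 + a))) * ?R))"
    by (rule mult_left_mono[OF main]) simp
  also have "ennreal (1 / Gamma a) * (ennreal (2 ^ DIM('a \<times> 'a)) * ?B * (ennreal (pi ^ (2 * DIM('a)) * Gamma a * (Gamma (DIM('a) / 2 - a) / Gamma (DIM('a) / 2 + a))) * ?R))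
     = (ennreal (1 / Gamma a) * ennreal (2 ^ DIM('a \<times> 'a)) * ennreal (pi ^ (2 * DIM('a)) * Gamma a * (Gamma (DIM('a) / 2 - a) / Gamma (DIM('a) / 2 + a)))) * ?B * ?R"
    by (simp only: mult_ac)
  also have "ennreal (1 / Gamma a) * ennreal (2 ^ DIM('a \<times> 'a)) * ennreal (pi ^ (2 * DIM('a)) * Gamma a * (Gamma (DIM('a) / 2 - a) / Gamma (DIM('a) / 2 + a))) = ennreal ?C"
  proof -
    define G where "G = Gamma (DIM('a) / 2 - a) / Gamma (DIM('a) / 2 + a)"
    have m: "ennreal x * ennreal y * ennreal z = ennreal (x * y * z)" if "x \<ge> 0" "y \<ge> 0" for x y z
      using that by (simp add: ennreal_mult')
    have "ennreal (1 / Gamma a) * ennreal (2 ^ DIM('a \<times> 'a)) * ennreal (pi ^ (2 * DIM('a)) * Gamma a * G)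
      = ennreal (1 / Gamma a * 2 ^ DIM('a \<times> 'a) * (pi ^ (2 * DIM('a)) * Gamma a * G))"
      by (rule m) (use Ga(1) in simp_all)
    also have "1 / Gamma a * 2 ^ DIM('a \<times> 'a) * (pi ^ (2 * DIM('a)) * Gamma a * G) = (2 * pi) ^ (2 * DIM('a)) * G"
    proof -
      have "DIM('a \<times> 'a) = 2 * DIM('a)" by simp
      then show ?thesis using Ga(1) by (simp only: power_mult_distrib) simp
    qed
    finally show ?thesis unfolding G_def .
  qed
  finally show ?thesis .
qed

end

section \<open>Integrability of Schwartz functions\<close>

text \<open>A mixture of Gaussians replaces polar coordinates: integrating out \<open>x\<close>
  lowers the exponent of \<open>l\<close> by half the dimension, and a convergent Gamma integral
  remains.\<close>

lemma nn_integral_inverse_power_finite: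
  "(\<integral>\<^sup>+x. ennreal ((1 + (norm (x::'a::euclidean_space))\<^sup>2) powr (- real DIM('a))) \<partial>lborel) < \<infinity>"
proof -
  let ?n = "real DIM('a)"
  let ?I = "\<lambda>x. indicator {0<..} x :: ennreal"
  have n: "?n > 0" by simp
  have G: "Gamma ?n > 0" using n by (rule Gamma_real_pos)
  have "(\<integral>\<^sup>+x. ennreal (Gamma ?n * (1 + (norm (x::'a))\<^sup>2) powr (- ?n)) \<partial>lborel)
    = (\<integral>\<^sup>+x. (\<integral>\<^sup>+l. ennreal (l powr (?n - 1) * exp (- ((1 + (norm (x::'a))\<^sup>2) * l))) * ?I l \<partial>lborel) \<partial>lborel)"
    by (intro nn_integral_cong, rule nn_integral_Gamma[symmetric]) (auto intro: add_pos_nonneg)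
  also have "\<dots> = (\<integral>\<^sup>+l. (\<integral>\<^sup>+x. ennreal (l powr (?n - 1) * exp (- ((1 + (norm (x::'a))\<^sup>2) * l))) * ?I l \<partial>lborel) \<partial>lborel)"
    by (rule lborel_pair.Fubini') measurable
  also have "\<dots> = (\<integral>\<^sup>+l. ennreal (pi powr (?n / 2)) * (ennreal (l powr (?n / 2 - 1) * exp (- (1 * l))) * ?I l) \<partial>lborel)"
  proof (rule nn_integral_cong)
    fix l :: real
    show "(\<integral>\<^sup>+x. ennreal (l powr (?n - 1) * exp (- ((1 + (norm (x::'a))\<^sup>2) * l))) * ?I l \<partial>lborel)
      = ennreal (pi powr (?n / 2)) * (ennreal (l powr (?n / 2 - 1) * exp (- (1 * l))) * ?I l)"
    proof (cases "l > 0")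
      case True
      have "(\<integral>\<^sup>+x. ennreal (l powr (?n - 1) * exp (- ((1 + (norm (x::'a))\<^sup>2) * l))) * ?I l \<partial>lborel)
        = (\<integral>\<^sup>+x. ennreal (l powr (?n - 1) * exp (- l)) * ennreal (exp (- (l * (norm (x::'a))\<^sup>2))) \<partial>lborel)"
        using True by (intro nn_integral_cong) (simp add: ennreal_mult''[symmetric] exp_add[symmetric] algebra_simps)
      also have "\<dots> = ennreal (l powr (?n - 1) * exp (- l)) * (\<integral>\<^sup>+x. ennreal (exp (- (l * (norm (x::'a))\<^sup>2))) \<partial>lborel)"
        by (rule nn_integral_cmult) measurable
      also have "\<dots> = ennreal (l powr (?n - 1) * exp (- l) * (pi / l) powr (?n / 2))"
        unfolding nn_integral_gaussian[OF True] by (rule ennreal_mult''[symmetric]) simp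
      also have "l powr (?n - 1) * exp (- l) * (pi / l) powr (?n / 2) = pi powr (?n / 2) * (l powr (?n / 2 - 1) * exp (- (1 * l)))"
      proof -
        have "l powr (?n - 1) = l powr (?n / 2 - 1) * l powr (?n / 2)"
          by (simp only: powr_add[symmetric], rule arg_cong[where f = "(powr) l"], simp)
        then show ?thesis using True by (simp add: powr_divide)
      qed
      finally show ?thesis using True by (simp add: ennreal_mult')
    qed simp
  qed
  also have "\<dots> = ennreal (pi powr (?n / 2)) * (\<integral>\<^sup>+l\<in>{0<..}. ennreal (l powr (?n / 2 - 1) * exp (- (1 * l))) \<partial>lborel)"
    by (rule nn_integral_cmult) measurable
  also have "\<dots> = ennreal (pi powr (?n / 2)) * ennreal (Gamma (?n / 2) * 1 powr (- (?n / 2)))"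
    by (subst nn_integral_Gamma) simp_all
  finally have 1: "(\<integral>\<^sup>+x. ennreal (Gamma ?n * (1 + (norm (x::'a))\<^sup>2) powr (- ?n)) \<partial>lborel) < \<infinity>"
    by (simp add: ennreal_mult_less_top)
  have "(\<integral>\<^sup>+x. ennreal (Gamma ?n * (1 + (norm (x::'a))\<^sup>2) powr (- ?n)) \<partial>lborel) = ennreal (Gamma ?n) * (\<integral>\<^sup>+x. ennreal ((1 + (norm (x::'a))\<^sup>2) powr (- ?n)) \<partial>lborel)"
    using G by (subst nn_integral_cmult[symmetric], measurable) (simp add: ennreal_mult)
  with 1 G show ?thesis by (auto simp: ennreal_mult_less_top)
qed

text \<open>Since \<open>(1 + r) ^ n \<le> 2 ^ n * (1 + r ^ n)\<close> for
  \<open>r = norm x ^ 2\<close>, the two bounds combine into the majorant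
  \<open>2 ^ n * (C + C') * (1 + r) powr (- n)\<close>.\<close>

lemma integrable_polynomial_decay:
  fixes h :: "'a::euclidean_space \<Rightarrow> 'b::{banach, second_countable_topology}"
  assumes "h \<in> borel_measurable borel"
    and "\<And>x. norm (h x) \<le> C" and "\<And>x. norm x ^ (2 * DIM('a)) * norm (h x) \<le> C'"
  shows "integrable lborel h"
proof -
  let ?n = "DIM('a)"
  let ?J = "\<lambda>x::'a. (1 + (norm x)\<^sup>2) powr (- real ?n)"
  have "integrable lborel (\<lambda>x. (2 ^ ?n * (C + C')) * ?J x)"
    by (intro Bochner_Integration.integrable_mult_right)
      (use nn_integral_inverse_power_finite[where 'a='a] in \<open>simp add: integrable_iff_bounded\<close>)
  then show ?thesis
  proof (rule Bochner_Integration.integrable_bound)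
    show "AE x in lborel. norm (h x) \<le> norm ((2 ^ ?n * (C + C')) * ?J x)"
    proof (rule AE_I2)
      fix x :: 'a
      define r where "r = (norm x)\<^sup>2"
      have r: "r \<ge> 0" by (simp add: r_def)
      have "(1 + r) ^ ?n \<le> 2 ^ ?n * (1 + r ^ ?n)"
      proof (cases "r \<le> 1")
        case True
        then have "(1 + r) ^ ?n \<le> 2 ^ ?n" using r by (intro power_mono) auto
        also have "\<dots> \<le> 2 ^ ?n * (1 + r ^ ?n)" using r by simp
        finally show ?thesis .
      next
        case False
        then have "(1 + r) ^ ?n \<le> (2 * r) ^ ?n" by (intro power_mono) auto
        also have "\<dots> \<le> 2 ^ ?n * (1 + r ^ ?n)" by (simp add: power_mult_distrib)
        finally show ?thesis .
      qed
      then have "(1 + r) ^ ?n * norm (h x) \<le> 2 ^ ?n * (1 + r ^ ?n) * norm (h x)"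
        by (intro mult_right_mono) auto
      also have "\<dots> = 2 ^ ?n * (norm (h x) + norm x ^ (2 * ?n) * norm (h x))"
        by (simp add: r_def power_mult[symmetric] algebra_simps)
      also have "\<dots> \<le> 2 ^ ?n * (C + C')"
        using assms(2,3)[of x] by (intro mult_left_mono add_mono) auto
      finally have le: "(1 + r) ^ ?n * norm (h x) \<le> 2 ^ ?n * (C + C')" .
      have J: "?J x * (1 + r) ^ ?n = 1"
        using r unfolding r_def[symmetric] by (simp add: powr_minus powr_realpow add_pos_nonneg)
      have "norm (h x) = ?J x * ((1 + r) ^ ?n * norm (h x))"
        by (simp only: mult.assoc[symmetric] J mult_1_left)
      also have "\<dots> \<le> ?J x * (2 ^ ?n * (C + C'))"
        by (intro mult_left_mono le) simp
      also have "\<dots> \<le> norm ((2 ^ ?n * (C + C')) * ?J x)"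
        by (simp only: mult.commute real_norm_def abs_ge_self)
      finally show "norm (h x) \<le> norm ((2 ^ ?n * (C + C')) * ?J x)" .
    qed
  qed (use assms in measurable)
qed

text \<open>Writing \<open>1 / norm x\<close> as a mixture of Gaussians with exponent
  \<open>1/2\<close> and integrating out \<open>x\<close> leaves a Beta integral with parameters
  \<open>1/2\<close> and \<open>n / 2 - 1/2\<close>. The second is positive because the dimension
  \<open>n\<close> is at least 2.\<close>

lemma nn_integral_gaussian_over_norm_finite:
  assumes "DIM('a) \<ge> 2"
  shows "(\<integral>\<^sup>+x. ennreal (exp (- (norm (x::'a::euclidean_space))\<^sup>2) / norm x) \<partial>lborel) < \<infinity>"
proof -
  let ?n = "real DIM('a)"
  let ?I = "\<lambda>x. indicator {0<..} x :: ennreal"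
  have G: "Gamma (1/2 :: real) > 0" by (rule Gamma_real_pos) simp
  have "(\<integral>\<^sup>+x. ennreal (Gamma (1/2) * (exp (- (norm (x::'a))\<^sup>2) / norm x)) \<partial>lborel)
    = (\<integral>\<^sup>+x. (\<integral>\<^sup>+s. ennreal (s powr (1/2 - 1) * exp (- ((1 + s) * (norm (x::'a))\<^sup>2))) * ?I s \<partial>lborel) \<partial>lborel)"
    using AE_lborel_singleton[of "0::'a"]
  proof (intro nn_integral_cong_AE, eventually_elim)
    fix x :: 'a assume x: "x \<noteq> 0"
    have "(\<integral>\<^sup>+s. ennreal (s powr (1/2 - 1) * exp (- ((1 + s) * (norm x)\<^sup>2))) * ?I s \<partial>lborel)
      = (\<integral>\<^sup>+s. ennreal (exp (- (norm x)\<^sup>2)) * (ennreal (s powr (1/2 - 1) * exp (- ((norm x)\<^sup>2 * s))) * ?I s) \<partial>lborel)"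
    proof (intro nn_integral_cong)
      fix s :: real
      have "s powr (1/2 - 1) * exp (- ((1 + s) * (norm x)\<^sup>2)) = exp (- (norm x)\<^sup>2) * (s powr (1/2 - 1) * exp (- ((norm x)\<^sup>2 * s)))"
        by (simp add: exp_add[symmetric] algebra_simps)
      then show "ennreal (s powr (1/2 - 1) * exp (- ((1 + s) * (norm x)\<^sup>2))) * ?I s = ennreal (exp (- (norm x)\<^sup>2)) * (ennreal (s powr (1/2 - 1) * exp (- ((norm x)\<^sup>2 * s))) * ?I s)"
        by (simp only: ennreal_mult' exp_ge_zero mult.assoc)
    qed
    also have "\<dots> = ennreal (exp (- (norm x)\<^sup>2)) * (\<integral>\<^sup>+s\<in>{0<..}. ennreal (s powr (1/2 - 1) * exp (- ((norm x)\<^sup>2 * s))) \<partial>lborel)"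
      by (rule nn_integral_cmult) measurable
    also have "(\<integral>\<^sup>+s\<in>{0<..}. ennreal (s powr (1/2 - 1) * exp (- ((norm x)\<^sup>2 * s))) \<partial>lborel) = ennreal (Gamma (1/2) * ((norm x)\<^sup>2) powr (- (1/2)))"
      by (rule nn_integral_Gamma) (use x in auto)
    also have "((norm x)\<^sup>2) powr (- (1/2)) = inverse (norm x)"
      using x by (simp add: power2_powr powr_minus)
    also have "ennreal (exp (- (norm x)\<^sup>2)) * ennreal (Gamma (1/2) * inverse (norm x)) = ennreal (exp (- (norm x)\<^sup>2) * (Gamma (1/2) * inverse (norm x)))"
      by (rule ennreal_mult'[symmetric]) simp
    also have "exp (- (norm x)\<^sup>2) * (Gamma (1/2) * inverse (norm x)) = Gamma (1/2) * (exp (- (norm x)\<^sup>2) / norm x)"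
      by (simp only: divide_inverse mult_ac)
    finally show "ennreal (Gamma (1/2) * (exp (- (norm x)\<^sup>2) / norm x)) = (\<integral>\<^sup>+s. ennreal (s powr (1/2 - 1) * exp (- ((1 + s) * (norm x)\<^sup>2))) * ?I s \<partial>lborel)" ..
  qed
  also have "\<dots> = (\<integral>\<^sup>+s. (\<integral>\<^sup>+x. ennreal (s powr (1/2 - 1) * exp (- ((1 + s) * (norm (x::'a))\<^sup>2))) * ?I s \<partial>lborel) \<partial>lborel)"
    by (rule lborel_pair.Fubini') measurable
  also have "\<dots> = (\<integral>\<^sup>+s. ennreal (pi powr (?n / 2)) * (ennreal (s powr (1/2 - 1) * (1 + s) powr (- (1/2 + (?n / 2 - 1/2)))) * ?I s) \<partial>lborel)"
  proof (rule nn_integral_cong)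
    fix s :: real
    show "(\<integral>\<^sup>+x. ennreal (s powr (1/2 - 1) * exp (- ((1 + s) * (norm (x::'a))\<^sup>2))) * ?I s \<partial>lborel)
      = ennreal (pi powr (?n / 2)) * (ennreal (s powr (1/2 - 1) * (1 + s) powr (- (1/2 + (?n / 2 - 1/2)))) * ?I s)"
    proof (cases "s > 0")
      case True
      have "(\<integral>\<^sup>+x. ennreal (s powr (1/2 - 1) * exp (- ((1 + s) * (norm (x::'a))\<^sup>2))) * ?I s \<partial>lborel)
        = (\<integral>\<^sup>+x. ennreal (s powr (1/2 - 1)) * ennreal (exp (- ((1 + s) * (norm (x::'a))\<^sup>2))) \<partial>lborel)"
        using True by (intro nn_integral_cong) (simp add: ennreal_mult''[symmetric])
      also have "\<dots> = ennreal (s powr (1/2 - 1)) * (\<integral>\<^sup>+x. ennreal (exp (- ((1 + s) * (norm (x::'a))\<^sup>2))) \<partial>lborel)"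
        by (rule nn_integral_cmult) measurable
      also have "\<dots> = ennreal (s powr (1/2 - 1)) * ennreal ((pi / (1 + s)) powr (?n / 2))"
        using True by (subst nn_integral_gaussian) simp_all
      also have "\<dots> = ennreal (s powr (1/2 - 1) * (pi / (1 + s)) powr (?n / 2))"
        by (rule ennreal_mult''[symmetric]) simp
      also have "s powr (1/2 - 1) * (pi / (1 + s)) powr (?n / 2) = pi powr (?n / 2) * (s powr (1/2 - 1) * (1 + s) powr (- (1/2 + (?n / 2 - 1/2))))"
      proof -
        have "1/2 + (?n / 2 - 1/2) = ?n / 2" by simp
        moreover have "(pi / (1 + s)) powr (?n / 2) = pi powr (?n / 2) * (1 + s) powr (- (?n / 2))"
          using True by (simp add: powr_divide powr_minus_divide)
        ultimately show ?thesis by (simp only: mult_ac)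
      qed
      finally show ?thesis using True by (simp add: ennreal_mult')
    qed simp
  qed
  also have "\<dots> = ennreal (pi powr (?n / 2)) * (\<integral>\<^sup>+s\<in>{0<..}. ennreal (s powr (1/2 - 1) * (1 + s) powr (- (1/2 + (?n / 2 - 1/2)))) \<partial>lborel)"
    by (rule nn_integral_cmult) measurable
  also have "\<dots> < \<infinity>"
    using assms by (subst nn_integral_beta_halfline) (auto simp: ennreal_mult_less_top)
  finally have 1: "(\<integral>\<^sup>+x. ennreal (Gamma (1/2) * (exp (- (norm (x::'a))\<^sup>2) / norm x)) \<partial>lborel) < \<infinity>" .
  have "(\<integral>\<^sup>+x. ennreal (Gamma (1/2) * (exp (- (norm (x::'a))\<^sup>2) / norm x)) \<partial>lborel)
    = ennreal (Gamma (1/2)) * (\<integral>\<^sup>+x. ennreal (exp (- (norm (x::'a))\<^sup>2) / norm x) \<partial>lborel)"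
    using G by (subst nn_integral_cmult[symmetric], measurable) (intro nn_integral_cong ennreal_mult', simp)
  with 1 show ?thesis by (auto simp: ennreal_mult_less_top Gamma_one_half_real)
qed

text \<open>Outside the unit ball dividing by the norm only decreases the modulus. Inside it
  \<open>1 \<le> exp (1 - norm x ^ 2)\<close>, so \<open>C * exp 1\<close> times the Gaussian
  dominates \<open>h\<close>.\<close>

lemma integrable_over_norm:
  fixes h :: "'a::euclidean_space \<Rightarrow> real"
  assumes h: "integrable lborel h" and b: "\<And>x. \<bar>h x\<bar> \<le> C" and n: "DIM('a) \<ge> 2"
  shows "integrable lborel (\<lambda>x. h x / norm x)"
proof -
  have [measurable]: "h \<in> borel_measurable borel"
    using borel_measurable_integrable[OF h] by simp
  have "integrable lborel (\<lambda>x::'a. exp (- (norm x)\<^sup>2) / norm x)"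
    using nn_integral_gaussian_over_norm_finite[OF n] by (simp add: integrable_iff_bounded)
  then have "integrable lborel (\<lambda>x::'a. \<bar>h x\<bar> + (C * exp 1) * (exp (- (norm x)\<^sup>2) / norm x))"
    using h by (intro Bochner_Integration.integrable_add Bochner_Integration.integrable_mult_right) auto
  then show ?thesis
  proof (rule Bochner_Integration.integrable_bound)
    show "AE x in lborel. norm (h x / norm x) \<le> norm (\<bar>h x\<bar> + (C * exp 1) * (exp (- (norm x)\<^sup>2) / norm x))"
    proof (rule AE_I2)
      fix x :: 'a
      have C: "C \<ge> 0" using b[of x] by linarith
      have nn: "0 \<le> (C * exp 1) * (exp (- (norm x)\<^sup>2) / norm x)" using C by simp
      have "\<bar>h x\<bar> / norm x \<le> \<bar>h x\<bar> + (C * exp 1) * (exp (- (norm x)\<^sup>2) / norm x)"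
      proof (cases "norm x \<ge> 1")
        case True
        then have "\<bar>h x\<bar> / norm x \<le> \<bar>h x\<bar>" by (simp add: divide_le_eq mult_left_le mult_le_cancel_left1)
        then show ?thesis using nn by linarith
      next
        case False
        then have "(norm x)\<^sup>2 \<le> 1" by (simp add: power_le_one)
        then have "1 \<le> exp (1 - (norm x)\<^sup>2)" by simp
        then have "\<bar>h x\<bar> \<le> C * exp (1 - (norm x)\<^sup>2)"
          using b[of x] mult_left_mono[OF _ C, of 1 "exp (1 - (norm x)\<^sup>2)"] by simp
        also have "C * exp (1 - (norm x)\<^sup>2) = C * exp 1 * exp (- (norm x)\<^sup>2)" by (simp add: exp_diff exp_minus field_simps)
        finally have "\<bar>h x\<bar> / norm x \<le> (C * exp 1 * exp (- (norm x)\<^sup>2)) / norm x" by (intro divide_right_mono) auto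
        then show ?thesis by simp
      qed
      then show "norm (h x / norm x) \<le> norm (\<bar>h x\<bar> + (C * exp 1) * (exp (- (norm x)\<^sup>2) / norm x))"
        using nn by simp
    qed
  qed measurable
qed

context
  fixes f :: "'a::euclidean_space \<Rightarrow> 'b::euclidean_space"
  assumes f: "f \<in> schwartz"
begin

lemma schwartz_iter_partial:
  assumes "set bs \<subseteq> Basis"
  shows "iter_partial bs f differentiable_on UNIV" and "\<exists>C. \<forall>x. norm x ^ m * norm (iter_partial bs f x) \<le> C"
  using f assms by (simp_all add: schwartz_def smooth_def)

lemma schwartz_differentiable: "f differentiable (at x)"
  using schwartz_iter_partial(1)[of "[]"] by (simp add: iter_partial_def differentiable_on_def)

lemma schwartz_continuous: "continuous_on UNIV f"
  by (intro differentiable_imp_continuous_on) (simp add: differentiable_on_def schwartz_differentiable)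

lemma schwartz_borel_measurable: "f \<in> borel_measurable borel"
  by (intro borel_measurable_continuous_onI schwartz_continuous)

lemma schwartz_decay: "\<exists>C. \<forall>x. norm x ^ m * norm (f x) \<le> C"
  using schwartz_iter_partial(2)[of "[]" m] by (simp add: iter_partial_def)

lemma schwartz_bounded: "\<exists>C. \<forall>x. norm (f x) \<le> C"
  using schwartz_decay[of 0] by simp

text \<open>First-order partial derivatives are bounded, their bounds add up to a bound for the
  operator norm of the derivative, and the mean value inequality applies on the convex whole
  space.\<close>

lemma schwartz_lipschitz: "\<exists>L. \<forall>x y. norm (f x - f y) \<le> L * norm (x - y)"
proof -
  let ?D = "\<lambda>x. frechet_derivative f (at x)"
  have D: "(f has_derivative ?D x) (at x)" for x
    using schwartz_differentiable frechet_derivative_works by blast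
  have "\<exists>C. \<forall>x. norm (?D x b) \<le> C" if "b \<in> Basis" for b
    using schwartz_iter_partial(2)[of "[b]" 0] that by (simp add: iter_partial_def partial_deriv_def)
  then obtain C where C: "norm (?D x b) \<le> C b" if "b \<in> Basis" for x b by metis
  have "onorm (?D x) \<le> (\<Sum>b\<in>Basis. C b)" for x
  proof (rule onorm_le)
    fix h
    have "?D x h = (\<Sum>b\<in>Basis. (h \<bullet> b) *\<^sub>R ?D x b)"
    proof -
      have "?D x h = ?D x (\<Sum>b\<in>Basis. (h \<bullet> b) *\<^sub>R b)"
        by (simp only: euclidean_representation)
      also have "\<dots> = (\<Sum>b\<in>Basis. (h \<bullet> b) *\<^sub>R ?D x b)"
        by (simp only: linear_sum[OF has_derivative_linear[OF D]] linear_cmul[OF has_derivative_linear[OF D]])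
      finally show ?thesis .
    qed
    then have "norm (?D x h) \<le> (\<Sum>b\<in>Basis. norm ((h \<bullet> b) *\<^sub>R ?D x b))"
      by (simp only:) (rule norm_sum)
    also have "\<dots> \<le> (\<Sum>b\<in>Basis. C b * norm h)"
    proof (rule sum_mono)
      fix b :: 'a assume b: "b \<in> Basis"
      have "norm ((h \<bullet> b) *\<^sub>R ?D x b) = \<bar>h \<bullet> b\<bar> * norm (?D x b)" by simp
      also have "\<dots> \<le> norm h * C b"
        using b by (intro mult_mono C Basis_le_norm) auto
      finally show "norm ((h \<bullet> b) *\<^sub>R ?D x b) \<le> C b * norm h" by (simp add: mult.commute)
    qed
    finally show "norm (?D x h) \<le> (\<Sum>b\<in>Basis. C b) * norm h" by (simp add: sum_distrib_right)
  qed
  then have "norm (f x - f y) \<le> (\<Sum>b\<in>Basis. C b) * norm (x - y)" for x y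
    using D by (intro differentiable_bound[of UNIV f ?D]) auto
  then show ?thesis by blast
qed

lemma schwartz_integrable: "integrable lborel f"
proof -
  obtain C where "\<And>x. norm (f x) \<le> C" using schwartz_bounded by blast
  moreover obtain C' where "\<And>x. norm x ^ (2 * DIM('a)) * norm (f x) \<le> C'" using schwartz_decay by blast
  ultimately show ?thesis by (intro integrable_polynomial_decay schwartz_borel_measurable)
qed

lemma schwartz_integrable_weighted: "integrable lborel (\<lambda>x. norm x * norm (f x))"
proof -
  obtain C where C: "\<And>x. norm x ^ 1 * norm (f x) \<le> C" using schwartz_decay by blast
  moreover obtain C' where "\<And>x. norm x ^ Suc (2 * DIM('a)) * norm (f x) \<le> C'" using schwartz_decay by blast
  ultimately show ?thesis using schwartz_borel_measurable
    by (intro integrable_polynomial_decay[of _ C C']) (auto simp: mult_ac)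
qed

text \<open>The weights \<open>norm x\<close> and \<open>1 / norm x\<close> together dominate both
  \<open>ln (norm x)\<close> and the quadratic remainder in the expansion of
  \<open>norm x powr (2 * a)\<close>.\<close>

lemma schwartz_sq_integrable:
  shows "integrable lborel (\<lambda>x. (norm (f x))\<^sup>2)"
    and "integrable lborel (\<lambda>x. norm x * (norm (f x))\<^sup>2)"
    and "DIM('a) \<ge> 2 \<Longrightarrow> integrable lborel (\<lambda>x. (norm (f x))\<^sup>2 / norm x)"
proof -
  note [measurable] = schwartz_borel_measurable
  obtain C where C: "\<And>x. norm (f x) \<le> C" using schwartz_bounded by blast
  have sq: "(norm (f x))\<^sup>2 \<le> C * norm (f x)" for x
    unfolding power2_eq_square by (intro mult_right_mono C norm_ge_zero)
  have C0: "C \<ge> 0" using order.trans[OF norm_ge_zero C[of 0]] .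
  show 1: "integrable lborel (\<lambda>x. (norm (f x))\<^sup>2)"
    by (rule Bochner_Integration.integrable_bound[OF integrable_mult_right[OF integrable_norm[OF schwartz_integrable], of C]])
      (use sq C0 in \<open>auto simp: abs_mult\<close>)
  show "integrable lborel (\<lambda>x. norm x * (norm (f x))\<^sup>2)"
  proof (rule Bochner_Integration.integrable_bound[OF integrable_mult_right[OF schwartz_integrable_weighted, of C]])
    show "AE x in lborel. norm (norm x * (norm (f x))\<^sup>2) \<le> norm (C * (norm x * norm (f x)))"
      using mult_left_mono[OF sq norm_ge_zero] C0 by (auto simp: abs_mult mult_ac)
  qed measurable
  have "\<bar>(norm (f x))\<^sup>2\<bar> \<le> C\<^sup>2" for x
    using C[of x] by (auto intro: power_mono)
  then show "integrable lborel (\<lambda>x. (norm (f x))\<^sup>2 / norm x)" if "DIM('a) \<ge> 2"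
    by (rule integrable_over_norm[OF 1 _ that])
qed

end

section \<open>The logarithmic inequality\<close>

definition mu_const :: "'a::euclidean_space itself \<Rightarrow> real" where
  "mu_const _ = 1 / (2 * pi) powr (DIM('a) / 2)"

lemma mu_const_pos: "mu_const TYPE('a::euclidean_space) > 0"
  by (simp add: mu_const_def)

lemma mu_eq: "(mu :: 'a::euclidean_space measure) = density lborel (\<lambda>_. ennreal (mu_const TYPE('a)))"
  by (simp add: mu_def mu_const_def)

lemma sets_mu [measurable_cong]: "sets (mu :: 'a::euclidean_space measure) = sets borel"
  by (simp add: mu_eq)

lemma space_mu [simp]: "space mu = UNIV"
  by (simp add: mu_eq)

lemma nn_integral_mu:
  fixes h :: "'a::euclidean_space \<Rightarrow> ennreal"
  assumes [measurable]: "h \<in> borel_measurable borel"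
  shows "(\<integral>\<^sup>+x. h x \<partial>mu) = ennreal (mu_const TYPE('a)) * (\<integral>\<^sup>+x. h x \<partial>lborel)"
  by (simp add: mu_eq nn_integral_density nn_integral_cmult)

lemma
  fixes h :: "'a::euclidean_space \<Rightarrow> 'b::{banach, second_countable_topology}"
  assumes [measurable]: "h \<in> borel_measurable borel"
  shows integral_mu: "(\<integral>x. h x \<partial>mu) = mu_const TYPE('a) *\<^sub>R (\<integral>x. h x \<partial>lborel)"
    and integrable_mu: "integrable mu h \<longleftrightarrow> integrable lborel h"
proof -
  have k: "mu_const TYPE('a) \<noteq> 0"
    using mu_const_pos[where 'a='a] by simp
  show "(\<integral>x. h x \<partial>mu) = mu_const TYPE('a) *\<^sub>R (\<integral>x. h x \<partial>lborel)"
    using mu_const_pos[where 'a='a] by (simp add: mu_eq integral_density)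
  have "integrable mu h \<longleftrightarrow> integrable lborel (\<lambda>x. mu_const TYPE('a) *\<^sub>R h x)"
    using mu_const_pos[where 'a='a] by (simp add: mu_eq integrable_density)
  also have "\<dots> \<longleftrightarrow> integrable lborel h"
  proof
    assume "integrable lborel (\<lambda>x. mu_const TYPE('a) *\<^sub>R h x)"
    then have "integrable lborel (\<lambda>x. inverse (mu_const TYPE('a)) *\<^sub>R (mu_const TYPE('a) *\<^sub>R h x))"
      by (rule integrable_scaleR_right)
    then show "integrable lborel h" using k by simp
  qed simp
  finally show "integrable mu h \<longleftrightarrow> integrable lborel h" .
qed

lemma AE_mu:
  fixes P :: "'a::euclidean_space \<Rightarrow> bool"
  assumes "AE x in lborel. P x"
  shows "AE x in mu. P x"
  unfolding mu_eq by (subst AE_density) (use assms in auto)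

lemma sigma_finite_mu: "sigma_finite_measure (mu :: 'a::euclidean_space measure)"
  unfolding mu_eq by (subst sigma_finite_measure.sigma_finite_iff_density_finite[OF sigma_finite_lborel]) auto

interpretation mu: sigma_finite_measure "mu :: 'a::euclidean_space measure"
  by (rule sigma_finite_mu)

interpretation mu_pair: pair_sigma_finite "mu :: 'a::euclidean_space measure" "mu :: 'b::euclidean_space measure" ..

section \<open>Elementary estimates for logarithms and powers, and the Gamma quotient\<close>

lemma abs_ln_le:
  fixes r :: real
  assumes "r \<ge> 0"
  shows "\<bar>ln r\<bar> \<le> r + 1 / r"
proof (cases "r = 0")
  case False
  with assms have r: "r > 0" by simp
  then have "ln r \<le> r" "ln (1 / r) \<le> 1 / r"
    using ln_le_minus_one[of r] ln_le_minus_one[of "1 / r"] by auto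
  then show ?thesis using r by (simp add: ln_div abs_le_iff add_increasing add_increasing2)
\<comment> \<open>For \<open>r = 0\<close> both sides vanish by the conventions for
  \<open>ln 0\<close> and \<open>1 / 0\<close>.\<close>
qed simp

text \<open>Second-order expansion of \<open>exp (2 * a * ln r)\<close> with a remainder uniform in
  \<open>a\<close>. With \<open>l = ln r\<close> and \<open>a \<le> 1 / 4\<close> the remainder
  exponential is at most \<open>exp (\<bar>l\<bar> / 2)\<close>, and \<open>l ^ 2\<close> is at most
  8 times the same quantity. Their product is controlled by \<open>exp \<bar>l\<bar>\<close>, which
  is \<open>r\<close> or \<open>1 / r\<close>; the 16 is 2 times 8.\<close>

lemma powr_taylor_bound:
  fixes r a :: real
  assumes r: "r > 0" and a: "0 \<le> a" "a \<le> 1 / 4"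
  shows "r powr (2 * a) \<le> 1 + 2 * a * ln r + 16 * a\<^sup>2 * (r + 1 / r)"
proof -
  define l where "l = ln r"
  define y where "y = 2 * a * l"
  obtain t where t: "\<bar>t\<bar> \<le> \<bar>y\<bar>" "exp y = 1 + y + exp t / 2 * y\<^sup>2"
    using Maclaurin_exp_le[of y 2] by (auto simp: numeral_2_eq_2)
  have "\<bar>y\<bar> \<le> \<bar>l\<bar> / 2"
    using a mult_right_mono[of "2 * a" "1 / 2" "\<bar>l\<bar>"] by (simp add: y_def abs_mult)
  then have 1: "exp t \<le> exp (\<bar>l\<bar> / 2)" using t(1) by simp
  have 2: "l\<^sup>2 \<le> 8 * exp (\<bar>l\<bar> / 2)"
    using exp_lower_Taylor_quadratic[of "\<bar>l\<bar> / 2"] by (simp add: power_divide)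
  have "exp t / 2 * y\<^sup>2 = 2 * a\<^sup>2 * (exp t * l\<^sup>2)" by (simp add: y_def power_mult_distrib)
  also have "\<dots> \<le> 2 * a\<^sup>2 * (exp (\<bar>l\<bar> / 2) * (8 * exp (\<bar>l\<bar> / 2)))"
    by (intro mult_left_mono mult_mono 1 2) auto
  also have "\<dots> = 16 * a\<^sup>2 * exp \<bar>l\<bar>"
    by (simp add: exp_add[symmetric])
  also have "\<dots> \<le> 16 * a\<^sup>2 * (r + 1 / r)"
  proof (intro mult_left_mono)
    have "exp \<bar>l\<bar> = r \<or> exp \<bar>l\<bar> = 1 / r"
      using r by (auto simp: l_def abs_if exp_minus inverse_eq_divide)
    then show "exp \<bar>l\<bar> \<le> r + 1 / r" using r by auto
  qed simp
  finally have "exp y \<le> 1 + y + 16 * a\<^sup>2 * (r + 1 / r)" using t(2) by simp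
  then show ?thesis using r by (simp add: powr_def y_def l_def)
qed

lemma ln_le_powr_neg:
  fixes r a :: real
  assumes "r > 0"
  shows "- (2 * a) * ln r \<le> r powr (- (2 * a)) - 1"
  using exp_ge_add_one_self[of "- (2 * a) * ln r"] assms by (simp add: powr_def)

text \<open>Numerator and denominator each contribute \<open>- Digamma m\<close>. This slope is the
  constant of the logarithmic inequality.\<close>

lemma has_real_derivative_Gamma_quotient:
  fixes m :: real
  assumes "m > 0"
  shows "((\<lambda>a. Gamma (m - a) / Gamma (m + a)) has_real_derivative - 2 * Digamma m) (at 0)"
proof -
  have G: "Gamma m > 0" and m: "m \<notin> \<int>\<^sub>\<le>\<^sub>0" using assms by (auto intro: Gamma_real_pos elim!: nonpos_Ints_cases)
  show ?thesis
    using G m by (auto intro!: derivative_eq_intros simp: field_simps)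
qed

lemma deriv_Gamma_quotient:
  fixes m :: real
  assumes "m > 0"
  shows "deriv Gamma m / Gamma m = Digamma m"
proof -
  have G: "Gamma m > 0" and m: "m \<notin> \<int>\<^sub>\<le>\<^sub>0" using assms by (auto intro: Gamma_real_pos elim!: nonpos_Ints_cases)
  have "deriv Gamma m = Gamma m * Digamma m"
    using m by (intro DERIV_imp_deriv has_field_derivative_Gamma)
  then show ?thesis using G by simp
qed

lemma wigner_eq_qft: "wigner f g x w = mu_const TYPE((real ^ 'd) \<times> (real ^ 'd)) *\<^sub>R qft (correlation f g x) w"
  if [measurable]: "f \<in> borel_measurable borel" "g \<in> borel_measurable borel"
  for f g :: "(real ^ 'd) \<times> (real ^ 'd) \<Rightarrow> quat"
proof -
  have "wigner f g x w = (\<integral>t. twist w t (correlation f g x t) \<partial>mu)"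
    unfolding wigner_def twist_def correlation_def by (simp only: mult.assoc)
  also have "\<dots> = mu_const TYPE((real ^ 'd) \<times> (real ^ 'd)) *\<^sub>R qft (correlation f g x) w"
    unfolding qft_def by (rule integral_mu) measurable
  finally show ?thesis .
qed

section \<open>Moyal's formula, Pitt's inequality and logarithmic integrability for two Schwartz
  functions\<close>

context
  fixes f g :: "(real ^ 'd) \<times> (real ^ 'd) \<Rightarrow> quat"
    and \<kappa> :: real
  assumes f: "f \<in> schwartz" and g: "g \<in> schwartz"
    and kappa_def: "\<kappa> = mu_const TYPE((real ^ 'd) \<times> (real ^ 'd))"
begin

lemma kappa_pos: "\<kappa> > 0"
  unfolding kappa_def by (rule mu_const_pos)

text \<open>In dimension \<open>2 d\<close> the normalising constant is the inverse of
  \<open>(2 * pi) ^ d\<close>, so its square exactly cancels the Plancherel constant of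
  \<open>qft\<close>.\<close>

lemma kappa_sq: "\<kappa>\<^sup>2 * (2 * pi) ^ (2 * CARD('d)) = 1"
  by (simp add: kappa_def mu_const_def powr_realpow power_divide power_even_eq)

lemmas [measurable] = schwartz_borel_measurable[OF f] schwartz_borel_measurable[OF g]

text \<open>One factor is integrable and the other bounded, which gives integrability for every
  \<open>x\<close> and not only almost everywhere.\<close>

lemma
  shows integrable_correlation: "integrable lborel (correlation f g x)"
    and integrable_correlation_sq: "integrable lborel (\<lambda>t. (norm (correlation f g x t))\<^sup>2)"
proof -
  obtain C where C: "\<And>x. norm (f x) \<le> C" using schwartz_bounded[OF f] by blast
  obtain C' where C': "\<And>x. norm (g x) \<le> C'" using schwartz_bounded[OF g] by blast
  have C0: "C \<ge> 0" "C' \<ge> 0" using order.trans[OF norm_ge_zero C[of 0]] order.trans[OF norm_ge_zero C'[of 0]] by auto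
  have "(\<integral>\<^sup>+t. ennreal (norm (f (x + t /\<^sub>R 2))) \<partial>lborel) < \<infinity>"
    using schwartz_integrable[OF f] nn_integral_half_shift[of "\<lambda>u. ennreal (norm (f u))" x]
    by (simp add: integrable_iff_bounded ennreal_mult_less_top)
  then have "integrable lborel (\<lambda>t. f (x + t /\<^sub>R 2))"
    by (simp add: integrable_iff_bounded)
  from integrable_mult_right[OF integrable_norm[OF this], of C']
  show 1: "integrable lborel (correlation f g x)"
  proof (rule Bochner_Integration.integrable_bound)
    show "AE t in lborel. norm (correlation f g x t) \<le> norm (C' * norm (f (x + t /\<^sub>R 2)))"
      using mult_left_mono[OF C' norm_ge_zero] C0 by (intro AE_I2) (simp add: norm_correlation mult.commute)
  qed measurable
  from integrable_mult_right[OF integrable_norm[OF this], of "C * C'"]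
  show "integrable lborel (\<lambda>t. (norm (correlation f g x t))\<^sup>2)"
  proof (rule Bochner_Integration.integrable_bound)
    have "norm (correlation f g x t) \<le> C * C'" for t
      unfolding norm_correlation using C0 by (intro mult_mono C C') auto
    then have "(norm (correlation f g x t))\<^sup>2 \<le> C * C' * norm (correlation f g x t)" for t
      unfolding power2_eq_square by (intro mult_right_mono) auto
    then show "AE t in lborel. norm ((norm (correlation f g x t))\<^sup>2) \<le> norm (C * C' * norm (correlation f g x t))"
      using C0 by (intro AE_I2) (simp add: abs_mult)
  qed measurable
qed

text \<open>The product rule for differences, with both functions bounded and Lipschitz. What
  matters is that \<open>L\<close> is independent of \<open>x\<close>.\<close>

lemma lipschitz_correlation: "\<exists>L. \<forall>x t t'. norm (correlation f g x t - correlation f g x t') \<le> L * norm (t - t')"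
proof -
  obtain C where C: "\<And>x. norm (f x) \<le> C" using schwartz_bounded[OF f] by blast
  obtain C' where C': "\<And>x. norm (g x) \<le> C'" using schwartz_bounded[OF g] by blast
  obtain L where L: "\<And>x y. norm (f x - f y) \<le> L * norm (x - y)" using schwartz_lipschitz[OF f] by blast
  obtain L' where L': "\<And>x y. norm (g x - g y) \<le> L' * norm (x - y)" using schwartz_lipschitz[OF g] by blast
  have "norm (correlation f g x t - correlation f g x t') \<le> ((L * C' + C * L') / 2) * norm (t - t')" for x t t'
  proof -
    let ?u = "x + t /\<^sub>R 2" let ?u' = "x + t' /\<^sub>R 2" let ?v = "x - t /\<^sub>R 2" let ?v' = "x - t' /\<^sub>R 2"
    have uu: "norm (?u - ?u') = norm (t - t') / 2" "norm (?v - ?v') = norm (t - t') / 2"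
      by (simp_all add: scaleR_diff_right[symmetric] norm_minus_commute)
    have "correlation f g x t - correlation f g x t' = (f ?u - f ?u') * qcnj (g ?v) + f ?u' * qcnj (g ?v - g ?v')"
      by (simp add: correlation_def algebra_simps linear_diff[OF bounded_linear.linear[OF bounded_linear_qcnj]])
    then have "norm (correlation f g x t - correlation f g x t') \<le> norm (f ?u - f ?u') * norm (g ?v) + norm (f ?u') * norm (g ?v - g ?v')"
      by (simp only:) (rule order.trans[OF norm_triangle_ineq], simp only: norm_mult norm_qcnj order.refl)
    also have "\<dots> \<le> (L * norm (?u - ?u')) * C' + C * (L' * norm (?v - ?v'))"
      by (intro add_mono mult_mono L L' C C' norm_ge_zero order.trans[OF norm_ge_zero L] order.trans[OF norm_ge_zero C])
    also have "\<dots> = ((L * C' + C * L') / 2) * norm (t - t')"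
      unfolding uu by (simp add: field_simps)
    finally show ?thesis .
  qed
  then show ?thesis by blast
qed

lemma norm_wigner_sq: "(norm (wigner f g x w))\<^sup>2 = \<kappa>\<^sup>2 * (norm (qft (correlation f g x) w))\<^sup>2"
  by (simp add: wigner_eq_qft power_mult_distrib kappa_def)

lemma borel_measurable_wigner [measurable]:
  "(\<lambda>z. wigner f g (fst z) (snd z)) \<in> borel_measurable (borel \<Otimes>\<^sub>M borel)"
  unfolding wigner_eq_qft[OF schwartz_borel_measurable[OF f] schwartz_borel_measurable[OF g]] by measurable

text \<open>Two of the four factors \<open>\<kappa>\<close> come from the squared modulus, and one
  from each of the two measures.\<close>

lemma nn_integral_wigner_weighted:
  fixes \<phi> :: "(real ^ 'd) \<times> (real ^ 'd) \<Rightarrow> real"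
  assumes [measurable]: "\<phi> \<in> borel_measurable borel"
  shows "(\<integral>\<^sup>+z. ennreal (\<phi> (snd z) * (norm (wigner f g (fst z) (snd z)))\<^sup>2) \<partial>(mu \<Otimes>\<^sub>M mu))
    = ennreal (\<kappa> ^ 4) * (\<integral>\<^sup>+x. (\<integral>\<^sup>+w. ennreal (\<phi> w * (norm (qft (correlation f g x) w))\<^sup>2) \<partial>lborel) \<partial>lborel)"
proof -
  let ?q = "\<lambda>x w. ennreal (\<phi> w * (norm (qft (correlation f g x) w))\<^sup>2)"
  have k: "\<kappa> > 0" by (rule kappa_pos)
  have "(\<integral>\<^sup>+z. ennreal (\<phi> (snd z) * (norm (wigner f g (fst z) (snd z)))\<^sup>2) \<partial>(mu \<Otimes>\<^sub>M mu))
    = (\<integral>\<^sup>+x. (\<integral>\<^sup>+w. ennreal (\<phi> w * (norm (wigner f g x w))\<^sup>2) \<partial>mu) \<partial>mu)"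
    by (subst mu.nn_integral_fst[symmetric]) simp_all
  also have "\<dots> = (\<integral>\<^sup>+x. ennreal (\<kappa> ^ 3) * (\<integral>\<^sup>+w. ?q x w \<partial>lborel) \<partial>mu)"
  proof (rule nn_integral_cong)
    fix x :: "(real ^ 'd) \<times> (real ^ 'd)"
    have "(\<integral>\<^sup>+w. ennreal (\<phi> w * (norm (wigner f g x w))\<^sup>2) \<partial>mu) = (\<integral>\<^sup>+w. ennreal (\<kappa>\<^sup>2) * ?q x w \<partial>mu)"
      unfolding norm_wigner_sq by (intro nn_integral_cong) (simp add: ennreal_mult'[symmetric] mult_ac)
    also have "\<dots> = ennreal \<kappa> * (\<integral>\<^sup>+w. ennreal (\<kappa>\<^sup>2) * ?q x w \<partial>lborel)"
      unfolding kappa_def by (rule nn_integral_mu) measurable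
    also have "(\<integral>\<^sup>+w. ennreal (\<kappa>\<^sup>2) * ?q x w \<partial>lborel) = ennreal (\<kappa>\<^sup>2) * (\<integral>\<^sup>+w. ?q x w \<partial>lborel)"
      by (rule nn_integral_cmult) measurable
    also have "ennreal \<kappa> * (ennreal (\<kappa>\<^sup>2) * (\<integral>\<^sup>+w. ?q x w \<partial>lborel)) = ennreal (\<kappa> * \<kappa>\<^sup>2) * (\<integral>\<^sup>+w. ?q x w \<partial>lborel)"
      using k by (simp add: ennreal_mult' mult.assoc)
    also have "\<kappa> * \<kappa>\<^sup>2 = \<kappa> ^ 3" by (simp add: eval_nat_numeral)
    finally show "(\<integral>\<^sup>+w. ennreal (\<phi> w * (norm (wigner f g x w))\<^sup>2) \<partial>mu) = ennreal (\<kappa> ^ 3) * (\<integral>\<^sup>+w. ?q x w \<partial>lborel)" .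
  qed
  also have "\<dots> = ennreal \<kappa> * (\<integral>\<^sup>+x. ennreal (\<kappa> ^ 3) * (\<integral>\<^sup>+w. ?q x w \<partial>lborel) \<partial>lborel)"
    unfolding kappa_def by (rule nn_integral_mu) measurable
  also have "(\<integral>\<^sup>+x. ennreal (\<kappa> ^ 3) * (\<integral>\<^sup>+w. ?q x w \<partial>lborel) \<partial>lborel) = ennreal (\<kappa> ^ 3) * (\<integral>\<^sup>+x. (\<integral>\<^sup>+w. ?q x w \<partial>lborel) \<partial>lborel)"
    by (rule nn_integral_cmult) measurable
  also have "ennreal \<kappa> * (ennreal (\<kappa> ^ 3) * (\<integral>\<^sup>+x. (\<integral>\<^sup>+w. ?q x w \<partial>lborel) \<partial>lborel)) = ennreal (\<kappa> * \<kappa> ^ 3) * (\<integral>\<^sup>+x. (\<integral>\<^sup>+w. ?q x w \<partial>lborel) \<partial>lborel)"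
    using k by (simp add: ennreal_mult' mult.assoc)
  also have "\<kappa> * \<kappa> ^ 3 = \<kappa> ^ 4" by (simp add: eval_nat_numeral)
  finally show ?thesis .
qed

text \<open>The case \<open>p = 2\<close> serves Moyal's formula, the case \<open>p = 1\<close> the
  logarithmic tail.\<close>

lemma nn_integral_correlation:
  fixes p :: nat
  shows "(\<integral>\<^sup>+x. (\<integral>\<^sup>+t. ennreal (norm (correlation f g x t) ^ p) \<partial>lborel) \<partial>lborel)
    = (\<integral>\<^sup>+u. ennreal (norm (f u) ^ p) \<partial>lborel) * (\<integral>\<^sup>+v. ennreal (norm (g v) ^ p) \<partial>lborel)"
proof -
  let ?h = "\<lambda>z. ennreal (norm (f (fst z)) ^ p) * ennreal (norm (g (snd z)) ^ p)"
  have "(\<integral>\<^sup>+x. (\<integral>\<^sup>+t. ennreal (norm (correlation f g x t) ^ p) \<partial>lborel) \<partial>lborel)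
    = (\<integral>\<^sup>+x. (\<integral>\<^sup>+t. ?h (x + t /\<^sub>R 2, x - t /\<^sub>R 2) \<partial>lborel) \<partial>lborel)"
    by (simp add: norm_correlation power_mult_distrib ennreal_mult)
  also have "\<dots> = (\<integral>\<^sup>+u. (\<integral>\<^sup>+v. ?h (u, v) \<partial>lborel) \<partial>lborel)"
    by (rule nn_integral_wigner_shift) measurable
  also have "\<dots> = (\<integral>\<^sup>+u. ennreal (norm (f u) ^ p) * (\<integral>\<^sup>+v. ennreal (norm (g v) ^ p) \<partial>lborel) \<partial>lborel)"
    by (simp add: nn_integral_cmult)
  also have "\<dots> = (\<integral>\<^sup>+u. ennreal (norm (f u) ^ p) \<partial>lborel) * (\<integral>\<^sup>+v. ennreal (norm (g v) ^ p) \<partial>lborel)"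
    by (rule nn_integral_multc) measurable
  finally show ?thesis .
qed

lemma L2norm_sq:
  "(L2norm h)\<^sup>2 = (\<integral>x. (norm (h x))\<^sup>2 \<partial>mu)"
  by (simp add: L2norm_def)

lemma nn_integral_norm_sq:
  fixes h :: "(real ^ 'd) \<times> (real ^ 'd) \<Rightarrow> quat"
  assumes h: "h \<in> schwartz"
  shows "ennreal \<kappa> * (\<integral>\<^sup>+x. ennreal ((norm (h x))\<^sup>2) \<partial>lborel) = ennreal ((L2norm h)\<^sup>2)"
proof -
  note [measurable] = schwartz_borel_measurable[OF h]
  have "ennreal \<kappa> * (\<integral>\<^sup>+x. ennreal ((norm (h x))\<^sup>2) \<partial>lborel) = (\<integral>\<^sup>+x. ennreal ((norm (h x))\<^sup>2) \<partial>mu)"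
    by (simp add: nn_integral_mu kappa_def)
  also have "\<dots> = ennreal (\<integral>x. (norm (h x))\<^sup>2 \<partial>mu)"
    using schwartz_sq_integrable(1)[OF h] by (intro nn_integral_eq_integral) (auto simp: integrable_mu)
  finally show ?thesis by (simp add: L2norm_sq)
qed

text \<open>Of the four factors \<open>\<kappa>\<close>, two cancel the Plancherel constant and the
  other two normalise the norms of \<open>f\<close> and \<open>g\<close>.\<close>

lemma moyal_wigner:
  "(\<integral>\<^sup>+z. ennreal ((norm (wigner f g (fst z) (snd z)))\<^sup>2) \<partial>(mu \<Otimes>\<^sub>M mu)) = ennreal ((L2norm f)\<^sup>2 * (L2norm g)\<^sup>2)"
proof -
  have k: "\<kappa> > 0" by (rule kappa_pos)
  obtain L where L: "\<And>x t t'. norm (correlation f g x t - correlation f g x t') \<le> L * norm (t - t')"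
    using lipschitz_correlation by blast
  let ?A = "\<integral>\<^sup>+u. ennreal ((norm (f u))\<^sup>2) \<partial>lborel" let ?B = "\<integral>\<^sup>+u. ennreal ((norm (g u))\<^sup>2) \<partial>lborel"
  have "(\<integral>\<^sup>+w. ennreal (1 * (norm (qft (correlation f g x) w))\<^sup>2) \<partial>lborel)
    = ennreal ((2 * pi) ^ (2 * CARD('d))) * (\<integral>\<^sup>+t. ennreal ((norm (correlation f g x t))\<^sup>2) \<partial>lborel)" for x
  proof -
    have "(\<integral>\<^sup>+t. ennreal ((norm (correlation f g x t))\<^sup>2) \<partial>lborel) = ennreal (\<integral>t. (norm (correlation f g x t))\<^sup>2 \<partial>lborel)"
      by (intro nn_integral_eq_integral integrable_correlation_sq) auto
    then show ?thesis
      using plancherel_qft[OF integrable_correlation integrable_correlation_sq L, of x] by (simp add: ennreal_mult')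
  qed
  then have "(\<integral>\<^sup>+z. ennreal (1 * (norm (wigner f g (fst z) (snd z)))\<^sup>2) \<partial>(mu \<Otimes>\<^sub>M mu))
    = ennreal (\<kappa> ^ 4) * (\<integral>\<^sup>+x. ennreal ((2 * pi) ^ (2 * CARD('d))) * (\<integral>\<^sup>+t. ennreal ((norm (correlation f g x t))\<^sup>2) \<partial>lborel) \<partial>lborel)"
    by (subst nn_integral_wigner_weighted) simp_all
  also have "(\<integral>\<^sup>+x. ennreal ((2 * pi) ^ (2 * CARD('d))) * (\<integral>\<^sup>+t. ennreal ((norm (correlation f g x t))\<^sup>2) \<partial>lborel) \<partial>lborel)
     = ennreal ((2 * pi) ^ (2 * CARD('d))) * (?A * ?B)"
    by (subst nn_integral_cmult, measurable) (simp only: nn_integral_correlation)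
  also have "ennreal (\<kappa> ^ 4) * (ennreal ((2 * pi) ^ (2 * CARD('d))) * (?A * ?B)) = ennreal (\<kappa> ^ 4 * (2 * pi) ^ (2 * CARD('d))) * (?A * ?B)"
    by (simp add: ennreal_mult mult.assoc)
  also have "\<kappa> ^ 4 * (2 * pi) ^ (2 * CARD('d)) = \<kappa> * \<kappa>"
  proof -
    have "\<kappa> ^ 4 = \<kappa> * \<kappa> * \<kappa>\<^sup>2" by (simp add: eval_nat_numeral)
    then show ?thesis using kappa_sq by (simp only: mult.assoc mult_1_right)
  qed
  also have "ennreal (\<kappa> * \<kappa>) * (?A * ?B) = (ennreal \<kappa> * ?A) * (ennreal \<kappa> * ?B)"
    using k by (simp add: ennreal_mult mult_ac)
  also have "\<dots> = ennreal ((L2norm f)\<^sup>2 * (L2norm g)\<^sup>2)"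
    unfolding nn_integral_norm_sq[OF f] nn_integral_norm_sq[OF g] by (simp add: ennreal_mult)
  finally show ?thesis by simp
qed

lemma pitt_wigner:
  assumes a: "0 < a" "a < CARD('d) / 2"
  shows "(\<integral>\<^sup>+z. ennreal (norm (snd z) powr (- (2 * a)) * (norm (wigner f g (fst z) (snd z)))\<^sup>2) \<partial>(mu \<Otimes>\<^sub>M mu))
    \<le> ennreal (Gamma (CARD('d) / 2 - a) / Gamma (CARD('d) / 2 + a) * (L2norm g)\<^sup>2) * (\<integral>\<^sup>+u. ennreal (norm u powr (2 * a) * (norm (f u))\<^sup>2) \<partial>mu)"
proof -
  define G where "G = Gamma (CARD('d) / 2 - a) / Gamma (CARD('d) / 2 + a)"
  have G: "G \<ge> 0" using a by (auto simp: G_def intro!: divide_nonneg_nonneg Gamma_real_pos less_imp_le)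
  have k: "\<kappa> > 0" by (rule kappa_pos)
  let ?B = "\<integral>\<^sup>+v. ennreal ((norm (g v))\<^sup>2) \<partial>lborel" let ?R = "\<integral>\<^sup>+u. ennreal (norm u powr (2 * a) * (norm (f u))\<^sup>2) \<partial>lborel"
  have "(\<integral>\<^sup>+z. ennreal (norm (snd z) powr (- (2 * a)) * (norm (wigner f g (fst z) (snd z)))\<^sup>2) \<partial>(mu \<Otimes>\<^sub>M mu))
    \<le> ennreal (\<kappa> ^ 4) * (ennreal ((2 * pi) ^ (2 * CARD('d)) * G) * ?B * ?R)"
    using pitt_correlation[OF schwartz_borel_measurable[OF f] schwartz_borel_measurable[OF g] integrable_correlation, of a] a
    by (subst nn_integral_wigner_weighted) (auto simp: G_def intro!: mult_left_mono)
  also have "\<dots> = ennreal (\<kappa> ^ 4 * ((2 * pi) ^ (2 * CARD('d)) * G)) * ?B * ?R"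
    by (simp add: ennreal_mult' mult.assoc)
  also have "\<kappa> ^ 4 * ((2 * pi) ^ (2 * CARD('d)) * G) = \<kappa> * \<kappa> * G"
  proof -
    have "\<kappa> ^ 4 * ((2 * pi) ^ (2 * CARD('d)) * G) = \<kappa> * \<kappa> * G * (\<kappa>\<^sup>2 * (2 * pi) ^ (2 * CARD('d)))" by (simp add: eval_nat_numeral)
    then show ?thesis by (simp only: kappa_sq mult_1_right)
  qed
  also have "ennreal (\<kappa> * \<kappa> * G) * ?B * ?R = ennreal G * (ennreal \<kappa> * ?B) * (ennreal \<kappa> * ?R)"
    using k G by (simp add: ennreal_mult mult_ac)
  also have "ennreal \<kappa> * ?R = (\<integral>\<^sup>+u. ennreal (norm u powr (2 * a) * (norm (f u))\<^sup>2) \<partial>mu)"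
    unfolding kappa_def by (rule nn_integral_mu[symmetric]) measurable
  also have "ennreal G * (ennreal \<kappa> * ?B) = ennreal (G * (L2norm g)\<^sup>2)"
    unfolding nn_integral_norm_sq[OF g] using G by (simp add: ennreal_mult)
  finally show ?thesis unfolding G_def .
qed

text \<open>For each \<open>x\<close> the tail is at most a fixed multiple of the integral of the
  modulus of the correlation. Integrated over \<open>x\<close>, this modulus gives the product of
  the integrals of \<open>norm (f u)\<close> and \<open>norm (g v)\<close>.\<close>

lemma wigner_log_tail_finite:
  "(\<integral>\<^sup>+z. ennreal (max 0 (ln (norm (snd z))) * (norm (wigner f g (fst z) (snd z)))\<^sup>2) \<partial>(mu \<Otimes>\<^sub>M mu)) < \<infinity>"
proof -
  obtain L where L: "\<And>x t t'. norm (correlation f g x t - correlation f g x t') \<le> L * norm (t - t')"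
    using lipschitz_correlation by blast
  let ?c = "2 * L * moment_const TYPE(real ^ 'd) / (1 - exp (- 1))"
  have L0: "L \<ge> 0"
    by (rule lipschitz_const_nonneg[OF integrable_correlation integrable_correlation_sq L])
  have c: "?c \<ge> 0"
    using L0 by (simp add: moment_const_def)
  have le: "(\<integral>\<^sup>+w. ennreal (max 0 (ln (norm w)) * (norm (qft (correlation f g x) w))\<^sup>2) \<partial>lborel)
    \<le> ennreal ?c * (\<integral>\<^sup>+t. ennreal (norm (correlation f g x t) ^ 1) \<partial>lborel)" for x
  proof -
    have "(\<integral>\<^sup>+t. ennreal (norm (correlation f g x t) ^ 1) \<partial>lborel) = ennreal (\<integral>t. norm (correlation f g x t) \<partial>lborel)"
      using integrable_correlation by (simp add: nn_integral_eq_integral)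
    then show ?thesis
      using qft_log_tail[OF integrable_correlation integrable_correlation_sq L, of x] by (simp only: ennreal_mult'[OF c])
  qed
  have "(\<integral>\<^sup>+z. ennreal (max 0 (ln (norm (snd z))) * (norm (wigner f g (fst z) (snd z)))\<^sup>2) \<partial>(mu \<Otimes>\<^sub>M mu))
    = ennreal (\<kappa> ^ 4) * (\<integral>\<^sup>+x. (\<integral>\<^sup>+w. ennreal (max 0 (ln (norm w)) * (norm (qft (correlation f g x) w))\<^sup>2) \<partial>lborel) \<partial>lborel)"
    by (rule nn_integral_wigner_weighted) measurable
  also have "\<dots> \<le> ennreal (\<kappa> ^ 4) * (\<integral>\<^sup>+x. ennreal ?c * (\<integral>\<^sup>+t. ennreal (norm (correlation f g x t) ^ 1) \<partial>lborel) \<partial>lborel)"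
    by (intro mult_left_mono nn_integral_mono le) simp
  also have "\<dots> = ennreal (\<kappa> ^ 4) * (ennreal ?c * ((\<integral>\<^sup>+u. ennreal (norm (f u) ^ 1) \<partial>lborel) * (\<integral>\<^sup>+v. ennreal (norm (g v) ^ 1) \<partial>lborel)))"
    by (subst nn_integral_cmult, measurable) (simp only: nn_integral_correlation)
  also have "\<dots> < \<infinity>"
    using schwartz_integrable[OF f] schwartz_integrable[OF g]
    by (simp add: integrable_iff_bounded ennreal_mult_less_top)
  finally show ?thesis .
qed

lemma integrable_log_sq:
  "integrable mu (\<lambda>u. ln (norm u) * (norm (f u))\<^sup>2)"
  "integrable mu (\<lambda>u. (norm u + 1 / norm u) * (norm (f u))\<^sup>2)"
proof -
  \<comment> \<open>The underlying space has dimension \<open>2 d\<close>, hence at least 2 even for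
    \<open>d = 1\<close>; this makes \<open>1 / norm u\<close> locally integrable.\<close>
  have d: "DIM((real ^ 'd) \<times> (real ^ 'd)) \<ge> 2"
    using zero_less_card_finite[where 'a='d] by (simp del: zero_less_card_finite)
  note sq = schwartz_sq_integrable(2)[OF f] schwartz_sq_integrable(3)[OF f d]
  have "integrable lborel (\<lambda>u. norm u * (norm (f u))\<^sup>2 + (norm (f u))\<^sup>2 / norm u)"
    by (intro Bochner_Integration.integrable_add sq)
  then show 1: "integrable mu (\<lambda>u. (norm u + 1 / norm u) * (norm (f u))\<^sup>2)"
    by (subst integrable_mu) (simp_all add: distrib_right)
  then show "integrable mu (\<lambda>u. ln (norm u) * (norm (f u))\<^sup>2)"
  proof (rule Bochner_Integration.integrable_bound)
    have "\<bar>ln (norm u)\<bar> * (norm (f u))\<^sup>2 \<le> (norm u + 1 / norm u) * (norm (f u))\<^sup>2" for u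
      by (intro mult_right_mono abs_ln_le) auto
    then show "AE u in mu. norm (ln (norm u) * (norm (f u))\<^sup>2) \<le> norm ((norm u + 1 / norm u) * (norm (f u))\<^sup>2)"
      by (intro AE_I2) (simp add: abs_mult)
  qed measurable
qed

lemma powr_sq_taylor:
  assumes a: "0 \<le> a" "a \<le> 1 / 4"
  shows "integrable mu (\<lambda>u. norm u powr (2 * a) * (norm (f u))\<^sup>2)" (is ?int)
    and "(\<integral>u. norm u powr (2 * a) * (norm (f u))\<^sup>2 \<partial>mu)
      \<le> (L2norm f)\<^sup>2 + 2 * a * (\<integral>u. ln (norm u) * (norm (f u))\<^sup>2 \<partial>mu) + 16 * a\<^sup>2 * (\<integral>u. (norm u + 1 / norm u) * (norm (f u))\<^sup>2 \<partial>mu)"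
      (is "_ \<le> ?b")
proof -
  let ?r = "\<lambda>u. (norm (f u))\<^sup>2 + 2 * a * (ln (norm u) * (norm (f u))\<^sup>2) + 16 * a\<^sup>2 * ((norm u + 1 / norm u) * (norm (f u))\<^sup>2)"
  have i0: "integrable mu (\<lambda>u. (norm (f u))\<^sup>2)"
    using schwartz_sq_integrable(1)[OF f] by (simp add: integrable_mu)
  have r: "integrable mu ?r"
    by (intro Bochner_Integration.integrable_add Bochner_Integration.integrable_mult_right i0 integrable_log_sq)
  have le: "norm u powr (2 * a) * (norm (f u))\<^sup>2 \<le> ?r u" if "u \<noteq> 0" for u
  proof -
    have "norm u powr (2 * a) * (norm (f u))\<^sup>2 \<le> (1 + 2 * a * ln (norm u) + 16 * a\<^sup>2 * (norm u + 1 / norm u)) * (norm (f u))\<^sup>2"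
      using that a by (intro mult_right_mono powr_taylor_bound) auto
    also have "\<dots> = ?r u" by (simp only: distrib_right mult_1_left mult.assoc)
    finally show ?thesis .
  qed
  have ae: "AE u in mu. norm u powr (2 * a) * (norm (f u))\<^sup>2 \<le> ?r u"
    using AE_mu[OF AE_lborel_singleton[of "0 :: (real ^ 'd) \<times> (real ^ 'd)"]] by eventually_elim (rule le)
  show int: ?int
  proof (rule Bochner_Integration.integrable_bound[OF r])
    show "AE u in mu. norm (norm u powr (2 * a) * (norm (f u))\<^sup>2) \<le> norm (?r u)"
      using ae by eventually_elim (simp only: real_norm_def, rule order.trans[OF _ abs_ge_self], simp)
  qed measurable
  have "(\<integral>u. norm u powr (2 * a) * (norm (f u))\<^sup>2 \<partial>mu) \<le> (\<integral>u. ?r u \<partial>mu)"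
    by (intro integral_mono_AE int r ae)
  also have "\<dots> = ?b"
    using i0 integrable_log_sq by (simp add: L2norm_sq)
  finally show "(\<integral>u. norm u powr (2 * a) * (norm (f u))\<^sup>2 \<partial>mu) \<le> ?b" .
qed

lemma log_uncertainty:
  "(\<integral>(x, w). ln (norm w) * (norm (wigner f g x w))\<^sup>2 \<partial>(mu \<Otimes>\<^sub>M mu))
     + (L2norm g)\<^sup>2 * (\<integral>t. ln (norm t) * (norm (f t))\<^sup>2 \<partial>mu)
   \<ge> Digamma (CARD('d) / 2) * (L2norm f)\<^sup>2 * (L2norm g)\<^sup>2"
proof -
  let ?M = "mu \<Otimes>\<^sub>M mu :: (((real ^ 'd) \<times> (real ^ 'd)) \<times> ((real ^ 'd) \<times> (real ^ 'd))) measure"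
  let ?W = "\<lambda>z. (norm (wigner f g (fst z) (snd z)))\<^sup>2"
  define Nf where "Nf = (L2norm f)\<^sup>2"
  define Ng where "Ng = (L2norm g)\<^sup>2"
  define L1 where "L1 = (\<integral>t. ln (norm t) * (norm (f t))\<^sup>2 \<partial>mu)"
  define K where "K = (\<integral>u. (norm u + 1 / norm u) * (norm (f u))\<^sup>2 \<partial>mu)"
  define m where "m = CARD('d) / 2"
  define S where "S = (\<integral>z. ln (norm (snd z)) * ?W z \<partial>?M)"
  \<comment> \<open>The bound \<open>1 / 2\<close> leaves room for all \<open>a \<le> 1 / 4\<close>
    in Pitt's inequality, which requires \<open>a < m\<close>.\<close>
  have m: "m \<ge> 1 / 2" "m > 0"
    using zero_less_card_finite[where 'a='d] by (auto simp: m_def)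
  have ae: "AE z in ?M. snd z \<noteq> 0"
    using AE_mu[OF AE_lborel_singleton, of "0 :: (real ^ 'd) \<times> (real ^ 'd)"]
    by (intro mu_pair.AE_pair_measure) auto
  have W: "integrable ?M ?W" "(\<integral>z. ?W z \<partial>?M) = Nf * Ng"
  proof -
    have "has_bochner_integral ?M ?W (Nf * Ng)"
      unfolding Nf_def Ng_def by (rule has_bochner_integral_nn_integral) (auto simp: moyal_wigner)
    then show "integrable ?M ?W" "(\<integral>z. ?W z \<partial>?M) = Nf * Ng" by (auto simp: has_bochner_integral_iff)
  qed
  \<comment> \<open>The weighted integral of \<open>f\<close> is replaced by its quadratic majorant
    in \<open>a\<close>. \<open>R\<close> is then explicit in \<open>a\<close> and can be
    differentiated at 0 without differentiating under an integral.\<close>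
  define R where "R a = Gamma (m - a) / Gamma (m + a) * Ng * (Nf + 2 * a * L1 + 16 * a\<^sup>2 * K)" for a
  have pitt: "integrable ?M (\<lambda>z. norm (snd z) powr (- (2 * a)) * ?W z) \<and> (\<integral>z. norm (snd z) powr (- (2 * a)) * ?W z \<partial>?M) \<le> R a"
    if a: "0 < a" "a \<le> 1 / 4" for a
  proof -
    have G: "Gamma (m - a) / Gamma (m + a) * Ng \<ge> 0"
      using a m by (auto simp: Ng_def intro!: mult_nonneg_nonneg divide_nonneg_nonneg Gamma_real_pos less_imp_le)
    let ?J = "\<integral>u. norm u powr (2 * a) * (norm (f u))\<^sup>2 \<partial>mu"
    have "(\<integral>\<^sup>+z. ennreal (norm (snd z) powr (- (2 * a)) * ?W z) \<partial>?M)
      \<le> ennreal (Gamma (m - a) / Gamma (m + a) * Ng) * (\<integral>\<^sup>+u. ennreal (norm u powr (2 * a) * (norm (f u))\<^sup>2) \<partial>mu)"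
      using pitt_wigner[of a] a m unfolding m_def Ng_def by auto
    also have "(\<integral>\<^sup>+u. ennreal (norm u powr (2 * a) * (norm (f u))\<^sup>2) \<partial>mu) = ennreal ?J"
      using a by (intro nn_integral_eq_integral powr_sq_taylor) auto
    also have "ennreal (Gamma (m - a) / Gamma (m + a) * Ng) * ennreal ?J = ennreal (Gamma (m - a) / Gamma (m + a) * Ng * ?J)"
      by (rule ennreal_mult'[symmetric, OF G])
    finally have le: "(\<integral>\<^sup>+z. ennreal (norm (snd z) powr (- (2 * a)) * ?W z) \<partial>?M) \<le> ennreal (Gamma (m - a) / Gamma (m + a) * Ng * ?J)" .
    have int: "integrable ?M (\<lambda>z. norm (snd z) powr (- (2 * a)) * ?W z)"
      using le by (intro integrableI_nonneg) (auto intro: order.strict_trans1)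
    have eq: "ennreal (\<integral>z. norm (snd z) powr (- (2 * a)) * ?W z \<partial>?M) = (\<integral>\<^sup>+z. ennreal (norm (snd z) powr (- (2 * a)) * ?W z) \<partial>?M)"
      by (rule nn_integral_eq_integral[symmetric, OF int]) auto
    have "Gamma (m - a) / Gamma (m + a) * Ng * ?J \<ge> 0"
      by (intro mult_nonneg_nonneg[OF G] integral_nonneg_AE) auto
    then have "(\<integral>z. norm (snd z) powr (- (2 * a)) * ?W z \<partial>?M) \<le> Gamma (m - a) / Gamma (m + a) * Ng * ?J"
      using le by (simp only: eq[symmetric] ennreal_le_iff)
    also have "\<dots> \<le> R a"
      unfolding R_def Nf_def L1_def K_def using a by (intro mult_left_mono[OF _ G] powr_sq_taylor) auto
    finally show ?thesis using int by simp
  qed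
  \<comment> \<open>Without this the left-hand side of the claim could be the junk value 0 of a divergent integral.\<close>
  have lnW: "integrable ?M (\<lambda>z. ln (norm (snd z)) * ?W z)"
  proof -
    have "integrable ?M (\<lambda>z. max 0 (ln (norm (snd z))) * ?W z)"
      using wigner_log_tail_finite by (intro integrableI_nonneg) auto
    moreover have "integrable ?M (\<lambda>z. norm (snd z) powr (- (2 * (1 / 4))) * ?W z)"
      using pitt[of "1 / 4"] by simp
    ultimately have "integrable ?M (\<lambda>z. max 0 (ln (norm (snd z))) * ?W z + 2 * (norm (snd z) powr (- (2 * (1 / 4))) * ?W z))"
      by (intro Bochner_Integration.integrable_add Bochner_Integration.integrable_mult_right)
    then show ?thesis
    proof (rule Bochner_Integration.integrable_bound)
      show "AE z in ?M. norm (ln (norm (snd z)) * ?W z) \<le> norm (max 0 (ln (norm (snd z))) * ?W z + 2 * (norm (snd z) powr (- (2 * (1 / 4))) * ?W z))"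
        using ae
      proof eventually_elim
        fix z :: "((real ^ 'd) \<times> (real ^ 'd)) \<times> ((real ^ 'd) \<times> (real ^ 'd))" assume z: "snd z \<noteq> 0"
        \<comment> \<open>Near \<open>w = 0\<close> the logarithm is dominated by
          \<open>2 * norm w powr (- 1 / 2)\<close>, whose integral is finite by Pitt's inequality at
          \<open>a = 1 / 4\<close>; the positive part of the logarithm is the tail already
          bounded.\<close>
        have "- (2 * (1 / 4)) * ln (norm (snd z)) \<le> norm (snd z) powr (- (2 * (1 / 4)))"
          using ln_le_powr_neg[of "norm (snd z)" "1 / 4"] z by simp
        then have "\<bar>ln (norm (snd z))\<bar> \<le> max 0 (ln (norm (snd z))) + 2 * norm (snd z) powr (- (2 * (1 / 4)))"
          by (auto simp: abs_if max_def)
        then have "\<bar>ln (norm (snd z))\<bar> * ?W z \<le> (max 0 (ln (norm (snd z))) + 2 * norm (snd z) powr (- (2 * (1 / 4)))) * ?W z"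
          by (intro mult_right_mono) auto
        also have "\<dots> = max 0 (ln (norm (snd z))) * ?W z + 2 * (norm (snd z) powr (- (2 * (1 / 4))) * ?W z)"
          by (simp only: distrib_right mult.assoc)
        finally show "norm (ln (norm (snd z)) * ?W z) \<le> norm (max 0 (ln (norm (snd z))) * ?W z + 2 * (norm (snd z) powr (- (2 * (1 / 4))) * ?W z))"
          by (simp only: real_norm_def abs_mult abs_power2 abs_norm_cancel power_abs)
      qed
    qed measurable
  qed
  \<comment> \<open>\<open>E\<close> vanishes at 0 because both bounds reduce to Moyal's formula
    there, and it is non-negative just to the right of 0. Half its slope at 0 is the difference of
    the two sides of the claim.\<close>
  define E where "E a = R a - Nf * Ng + 2 * a * S" for a
  have E: "E a \<ge> 0" if a: "0 < a" "a \<le> 1 / 4" for a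
  proof -
    have "- (2 * a) * S = (\<integral>z. - (2 * a) * (ln (norm (snd z)) * ?W z) \<partial>?M)"
      unfolding S_def by (rule integral_mult_right_zero[symmetric])
    also have "\<dots> \<le> (\<integral>z. norm (snd z) powr (- (2 * a)) * ?W z - ?W z \<partial>?M)"
    proof (rule integral_mono_AE)
      show "AE z in ?M. - (2 * a) * (ln (norm (snd z)) * ?W z) \<le> norm (snd z) powr (- (2 * a)) * ?W z - ?W z"
        using ae
      proof eventually_elim
        fix z :: "((real ^ 'd) \<times> (real ^ 'd)) \<times> ((real ^ 'd) \<times> (real ^ 'd))" assume z: "snd z \<noteq> 0"
        have "(- (2 * a) * ln (norm (snd z))) * ?W z \<le> (norm (snd z) powr (- (2 * a)) - 1) * ?W z"
          using z by (intro mult_right_mono ln_le_powr_neg) auto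
        then show "- (2 * a) * (ln (norm (snd z)) * ?W z) \<le> norm (snd z) powr (- (2 * a)) * ?W z - ?W z"
          by (simp only: left_diff_distrib mult_1_left mult.assoc)
      qed
    qed (intro Bochner_Integration.integrable_mult_right Bochner_Integration.integrable_diff lnW W(1) pitt[OF a, THEN conjunct1])+
    also have "\<dots> = (\<integral>z. norm (snd z) powr (- (2 * a)) * ?W z \<partial>?M) - Nf * Ng"
      unfolding W(2)[symmetric] by (intro Bochner_Integration.integral_diff W(1) pitt[OF a, THEN conjunct1])
    also have "\<dots> \<le> R a - Nf * Ng" using pitt[OF a] by simp
    finally show ?thesis by (simp add: E_def)
  qed
  have Gm: "Gamma m \<noteq> 0"
    by (rule less_imp_neq[OF Gamma_real_pos[OF m(2)], symmetric])
  have E0: "E 0 = 0"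
    using Gm by (simp add: E_def R_def)
  have "(R has_real_derivative - 2 * Digamma m * Ng * Nf + Ng * (2 * L1)) (at 0)"
  proof -
    define C where "C a = Gamma (m - a) / Gamma (m + a)" for a
    have C: "(C has_real_derivative - 2 * Digamma m) (at 0)" "C 0 = 1"
      using has_real_derivative_Gamma_quotient[OF m(2)] Gm by (simp_all add: C_def[abs_def])
    have "((\<lambda>a. C a * Ng * (Nf + 2 * a * L1 + 16 * a\<^sup>2 * K)) has_real_derivative - 2 * Digamma m * Ng * Nf + Ng * (2 * L1)) (at 0)"
      by (auto intro!: derivative_eq_intros C(1) simp: C(2))
    then show ?thesis by (simp add: R_def[abs_def] C_def)
  qed
  then have "(E has_real_derivative - 2 * Digamma m * Ng * Nf + Ng * (2 * L1) + 2 * S) (at 0)"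
    unfolding E_def by (auto intro!: derivative_eq_intros)
  \<comment> \<open>A negative slope would force \<open>E\<close> below zero immediately to the
    right of 0. The test point \<open>min (d / 2) (1 / 4)\<close> lies both in that neighbourhood
    and in the range where \<open>E\<close> is known to be non-negative.\<close>
  then have "\<not> - 2 * Digamma m * Ng * Nf + Ng * (2 * L1) + 2 * S < 0"
  proof (rule contrapos_pn)
    assume neg: "- 2 * Digamma m * Ng * Nf + Ng * (2 * L1) + 2 * S < 0"
    show "\<not> (E has_real_derivative - 2 * Digamma m * Ng * Nf + Ng * (2 * L1) + 2 * S) (at 0)"
    proof
      assume "(E has_real_derivative - 2 * Digamma m * Ng * Nf + Ng * (2 * L1) + 2 * S) (at 0)"
      from DERIV_neg_dec_right[OF this neg] obtain d where "d > 0" "\<And>h. 0 < h \<Longrightarrow> h < d \<Longrightarrow> E h < 0"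
        using E0 by auto
      then have "E (min (d / 2) (1 / 4)) < 0" by auto
      moreover have "E (min (d / 2) (1 / 4)) \<ge> 0" using \<open>d > 0\<close> by (intro E) auto
      ultimately show False by simp
    qed
  qed
  then have "Digamma m * Nf * Ng \<le> S + Ng * L1" by (simp add: mult_ac)
  then show ?thesis
    by (simp add: S_def Nf_def Ng_def L1_def m_def case_prod_unfold)
qed

end

theorem corollary8:
  fixes f g :: "(real ^ 'd) \<times> (real ^ 'd) \<Rightarrow> quat"
  assumes "f \<in> schwartz" and "g \<in> schwartz"
  shows "(\<integral>(x, w). ln (norm w) * (norm (wigner f g x w))\<^sup>2 \<partial>(mu \<Otimes>\<^sub>M mu))
           + (L2norm g)\<^sup>2 * (\<integral>t. ln (norm t) * (norm (f t))\<^sup>2 \<partial>mu)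
         \<ge> ((deriv Gamma (real CARD('d) / 2) / Gamma (real CARD('d) / 2) + ln 2) - ln 2)
             * (L2norm f)\<^sup>2 * (L2norm g)\<^sup>2"
  using log_uncertainty[OF assms refl] deriv_Gamma_quotient[of "real CARD('d) / 2"] by simp

end
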